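(* Let $(W,S)$ be a Coxeter system of finite rank, $c$ a Coxeter element, and $A$ a collection of $c$-sortable elements of $W$. If $A$ is nonempty then $\bigwedge A$ is $c$-sortable. If $A$ has an upper bound then $\bigvee A$ is $c$-sortable. (Meets and joins are in the right weak order.)
   Context: $S$ finite; $T$ = reflections; $\mathrm{inv}(w)=\{t\in T:\ell(tw)<\ell(w)\}$; weak order $v\le w$ iff $\mathrm{inv}(v)\subseteq\mathrm{inv}(w)$. The weak order is a complete meet-semilattice: every nonempty set has a meet $\bigwedge$, and every set with an upper bound has a join $\bigvee$. Coxeter element $c=s_1\cdots s_n$ (all of $S$ in some order). The $c$-sorting word of $w$ is the lexicographically first (by positions) subword of $(s_1\cdots s_n)^\infty$ that is a reduced word for $w$; $w$ is $c$-sortable if the sets of letters in successive copies of $s_1\cdots s_n$ weakly decrease under inclusion (independent of the reduced word for $c$). *)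

theory Defs
  imports "HOL-Algebra.Generated_Groups" "HOL-Algebra.Lattice"
begin

definition word_prod :: "('a, 'b) monoid_scheme \<Rightarrow> 'a list \<Rightarrow> 'a" where
  "word_prod G ws = foldr (\<lambda>x y. x \<otimes>\<^bsub>G\<^esub> y) ws \<one>\<^bsub>G\<^esub>"

(* A Coxeter matrix with the entry infinity encoded as 0, so that the relation (s t)^(m s t) = 1
   is trivial exactly when there is none. *)
definition coxeter_matrix :: "'a set \<Rightarrow> ('a \<Rightarrow> 'a \<Rightarrow> nat) \<Rightarrow> bool" where
  "coxeter_matrix S m \<longleftrightarrow>
     (\<forall>s\<in>S. m s s = 1) \<and>
     (\<forall>s\<in>S. \<forall>t\<in>S. m s t = m t s) \<and>
     (\<forall>s\<in>S. \<forall>t\<in>S. s \<noteq> t \<longrightarrow> m s t = 0 \<or> m s t \<ge> 2)"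

(* The congruence on words over S generated by (s t)^(m s t) ~ 1.  No formal inverses are needed:
   m s s = 1 gives s s ~ 1, so the quotient of the free monoid is already the group with
   presentation < S | (s t)^(m s t) = 1 >. *)
inductive coxeter_cong :: "'a set \<Rightarrow> ('a \<Rightarrow> 'a \<Rightarrow> nat) \<Rightarrow> 'a list \<Rightarrow> 'a list \<Rightarrow> bool"
  for S :: "'a set" and m :: "'a \<Rightarrow> 'a \<Rightarrow> nat" where
  relation: "\<lbrakk>s \<in> S; t \<in> S; us \<in> lists S; vs \<in> lists S\<rbrakk> \<Longrightarrow>
     coxeter_cong S m (us @ concat (replicate (m s t) [s, t]) @ vs) (us @ vs)"
| refl: "us \<in> lists S \<Longrightarrow> coxeter_cong S m us us"
| sym: "coxeter_cong S m us vs \<Longrightarrow> coxeter_cong S m vs us"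
| trans: "\<lbrakk>coxeter_cong S m us vs; coxeter_cong S m vs ws\<rbrakk> \<Longrightarrow> coxeter_cong S m us ws"

locale coxeter_system = group G for G :: "('a, 'b) monoid_scheme" (structure) +
  fixes S :: "'a set"
  assumes generators_closed: "S \<subseteq> carrier G"
    and generates: "generate G S = carrier G"
    and presentation: "\<exists>m. coxeter_matrix S m \<and>
      (\<forall>us\<in>lists S. \<forall>vs\<in>lists S. word_prod G us = word_prod G vs \<longleftrightarrow> coxeter_cong S m us vs)"

definition cox_length :: "('a, 'b) monoid_scheme \<Rightarrow> 'a set \<Rightarrow> 'a \<Rightarrow> nat" where
  "cox_length G S w = (LEAST k. \<exists>ws\<in>lists S. word_prod G ws = w \<and> length ws = k)"

definition reduced_word :: "('a, 'b) monoid_scheme \<Rightarrow> 'a set \<Rightarrow> 'a list \<Rightarrow> 'a \<Rightarrow> bool" where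
  "reduced_word G S ws w \<longleftrightarrow>
     ws \<in> lists S \<and> word_prod G ws = w \<and> length ws = cox_length G S w"

definition reflections :: "('a, 'b) monoid_scheme \<Rightarrow> 'a set \<Rightarrow> 'a set" where
  "reflections G S = {w \<otimes>\<^bsub>G\<^esub> s \<otimes>\<^bsub>G\<^esub> inv\<^bsub>G\<^esub> w | w s. w \<in> carrier G \<and> s \<in> S}"

definition inversions :: "('a, 'b) monoid_scheme \<Rightarrow> 'a set \<Rightarrow> 'a \<Rightarrow> 'a set" where
  "inversions G S w = {t \<in> reflections G S. cox_length G S (t \<otimes>\<^bsub>G\<^esub> w) < cox_length G S w}"

definition right_weak_order :: "('a, 'b) monoid_scheme \<Rightarrow> 'a set \<Rightarrow> 'a gorder" where
  "right_weak_order G S =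
     \<lparr>carrier = carrier G, eq = (=), le = (\<lambda>v w. inversions G S v \<subseteq> inversions G S w)\<rparr>"

definition coxeter_word :: "('a, 'b) monoid_scheme \<Rightarrow> 'a set \<Rightarrow> 'a list \<Rightarrow> 'a \<Rightarrow> bool" where
  "coxeter_word G S ss c \<longleftrightarrow> distinct ss \<and> set ss = S \<and> word_prod G ss = c"

definition coxeter_element :: "('a, 'b) monoid_scheme \<Rightarrow> 'a set \<Rightarrow> 'a \<Rightarrow> bool" where
  "coxeter_element G S c \<longleftrightarrow> (\<exists>ss. coxeter_word G S ss c)"

(* Letter at position i (counted from 0) of the infinite word (s_1 ... s_n)^\<infinity>, which lies in its
   copy number i div n. *)
definition periodic_letter :: "'a list \<Rightarrow> nat \<Rightarrow> 'a" where
  "periodic_letter ss i = ss ! (i mod length ss)"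

definition subword_for ::
  "('a, 'b) monoid_scheme \<Rightarrow> 'a set \<Rightarrow> 'a list \<Rightarrow> 'a \<Rightarrow> nat list \<Rightarrow> bool" where
  "subword_for G S ss w ps \<longleftrightarrow>
     sorted_wrt (<) ps \<and> reduced_word G S (map (periodic_letter ss) ps) w"

(* The sorting word is recorded by its list of positions, since the letters alone do not determine
   which copy of s_1 ... s_n they come from. *)
definition sorting_positions ::
  "('a, 'b) monoid_scheme \<Rightarrow> 'a set \<Rightarrow> 'a list \<Rightarrow> 'a \<Rightarrow> nat list \<Rightarrow> bool" where
  "sorting_positions G S ss w ps \<longleftrightarrow>
     subword_for G S ss w ps \<and>
     (\<forall>qs. subword_for G S ss w qs \<longrightarrow> qs = ps \<or> (ps, qs) \<in> lexord less_than)"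

definition block :: "'a list \<Rightarrow> nat list \<Rightarrow> nat \<Rightarrow> 'a set" where
  "block ss ps k = {periodic_letter ss i | i. i \<in> set ps \<and> i div length ss = k}"

(* Sortability does not depend on the word ss chosen for c, so asking for some ss is the same as
   asking for all of them. *)
definition c_sortable :: "('a, 'b) monoid_scheme \<Rightarrow> 'a set \<Rightarrow> 'a \<Rightarrow> 'a \<Rightarrow> bool" where
  "c_sortable G S c w \<longleftrightarrow>
     (\<exists>ss ps. coxeter_word G S ss c \<and> sorting_positions G S ss w ps \<and>
       (\<forall>k. block ss ps (Suc k) \<subseteq> block ss ps k))"

end

theory Submission
  imports Defs Complex_Main
begin

text \<open>
  Write \<open>N w\<close> for the positive roots of the geometric representation that \<open>w\<^sup>-\<^sup>1\<close> makes negative, so that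
  \<open>v \<le> w\<close> iff \<open>N v \<subseteq> N w\<close>. For a word \<open>s # ss\<close> let the projection of \<open>y\<close> be \<open>s\<close> times the projection
  of \<open>s y\<close> along \<open>ss @ [s]\<close> if \<open>s \<le> y\<close>, and the projection of \<open>y\<close> along \<open>ss\<close> otherwise; the sortable
  elements are its fixed points. Let \<open>E\<close> be the Euler form of the word. A direct recursion shows: if
  \<open>x \<ge> 0\<close> and \<open>E x \<gamma> \<le> 0\<close> for all inversions \<open>\<gamma>\<close> of the projection of \<open>y\<close>, then \<open>y\<^sup>-\<^sup>1 x \<ge> 0\<close>.
  Moreover the last inversion \<open>\<gamma>\<close> of a sortable element satisfies \<open>E \<gamma> \<mu> \<le> 0 \<le> E \<mu> \<gamma>\<close> for its other
  inversions \<open>\<mu>\<close>. Together these imply that the projection of \<open>y\<close> is the largest sortable element below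
  \<open>y\<close>. Hence a join of sortable elements, lying below its own projection, is sortable. For meets one
  strips the initial letter \<open>s\<close> if it lies below all elements, and otherwise replaces every element by
  its projection along the word without \<open>s\<close>, which has the same inversions in the parabolic subgroup.
\<close>

text \<open>The Euler form fits the greedy recursion because it is invariant under it: applying
  \<open>s\<close> to both arguments and moving \<open>s\<close> to the end of the word leaves its
  value unchanged. Sign conditions on inversions therefore survive the stripping of a descent. The
  obstacle is a sortable \<open>v\<close> without the descent \<open>s\<close> below a
  \<open>y\<close> that has it: the recursion strips \<open>s\<close> from \<open>y\<close> but
  cannot strip it from \<open>v\<close>. Then \<open>y\<close> is replaced by the join of
  \<open>s\<close> and \<open>v\<close>, and the inversions of \<open>v\<close> are recovered one at
  a time. If the last one, \<gamma>, were missing from the projection, it would be a cover root of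
  the join; comparing coefficients of \<gamma> in the cone over \<alpha>_s and \<open>N v\<close>
  makes the form nonpositive between \<gamma> and every inversion of the projection, so that
  \<gamma> is no inversion of the join at all. This is why joins are built together with the
  information that their inversions lie in the cone of the given ones. For meets, the largest
  sortable lower bound is the projection of the meet; the point to prove is that the meet itself is
  not larger. The group may be infinite and the form degenerate, so all inductions run over lengths
  and words, and positivity is read off coordinates.\<close>

definition madd :: "('a \<Rightarrow> real) \<Rightarrow> real \<Rightarrow> ('a \<Rightarrow> real) \<Rightarrow> 'a \<Rightarrow> real" where
  "madd x c y = (\<lambda>t. x t + c * y t)"

definition sroot :: "'a \<Rightarrow> 'a \<Rightarrow> real" where
  "sroot s = (\<lambda>t. if t = s then 1 else 0)"

definition nneg :: "('a \<Rightarrow> real) \<Rightarrow> bool" where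
  "nneg x \<longleftrightarrow> (\<forall>t. 0 \<le> x t)"

definition neg :: "('a \<Rightarrow> real) \<Rightarrow> 'a \<Rightarrow> real" where
  "neg x = (\<lambda>t. - x t)"

section \<open>Cones of coefficient vectors\<close>

inductive_set cone :: "('a \<Rightarrow> real) set \<Rightarrow> ('a \<Rightarrow> real) set" for X where
  zero: "(\<lambda>_. 0) \<in> cone X"
| add: "\<lbrakk>x \<in> cone X; \<beta> \<in> X; 0 \<le> c\<rbrakk> \<Longrightarrow> madd x c \<beta> \<in> cone X"

lemma madd_cone: "\<lbrakk>y \<in> cone Y; x \<in> cone Y; 0 \<le> c\<rbrakk> \<Longrightarrow> madd x c y \<in> cone Y"
proof (induction rule: cone.induct)
  case zero
  then show ?case by (simp add: madd_def)
next
  case (add y \<beta> d)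
  have "madd x c (madd y d \<beta>) = madd (madd x c y) (c * d) \<beta>"
    by (rule ext) (simp add: madd_def algebra_simps)
  then show ?case using add cone.add[of "madd x c y" Y \<beta> "c * d"] by simp
qed

lemma cone_subset: "x \<in> cone X \<Longrightarrow> X \<subseteq> cone Y \<Longrightarrow> x \<in> cone Y"
  by (induction rule: cone.induct) (auto intro: cone.zero madd_cone)

lemma cone_superset: "X \<subseteq> cone X"
proof
  fix \<beta> assume "\<beta> \<in> X"
  then show "\<beta> \<in> cone X" using cone.add[OF cone.zero, of \<beta> X 1] by (simp add: madd_def)
qed

lemma cone_base: "\<beta> \<in> X \<Longrightarrow> \<beta> \<in> cone X"
  using cone_superset by blast

lemma cone_least: "Z \<subseteq> cone X \<Longrightarrow> X \<subseteq> cone Y \<Longrightarrow> Z \<subseteq> cone Y"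
  using cone_subset by blast

section \<open>Chebyshev values and alternating words\<close>

text \<open>Chebyshev polynomials of the second kind, rescaled: at
  \<open>a = 2 * cos \<theta>\<close> the value is sin (k \<theta>) / sin \<theta> when sin \<theta>
  is nonzero. They are the coefficients of roots in rank two. The recursion also covers
  \<open>a = 2\<close>, which belongs to an infinite entry of the matrix.\<close>

fun cheb :: "real \<Rightarrow> nat \<Rightarrow> real" where
  "cheb a 0 = 0"
| "cheb a (Suc 0) = 1"
| "cheb a (Suc (Suc k)) = a * cheb a (Suc k) - cheb a k"

text \<open>The left side is a conserved quantity of the recursion. It takes the place of
  trigonometric identities, so that powers of a product of two reflections can be computed for every
  \<open>a\<close> at once.\<close>

lemma cheb_inv: "(cheb a k)^2 + (cheb a (Suc k))^2 - a * cheb a k * cheb a (Suc k) = 1"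
  by (induction k) (auto simp: power2_eq_square algebra_simps)

lemma cheb_sin: "cheb (2 * cos \<theta>) k * sin \<theta> = sin (real k * \<theta>)"
proof (induction "2 * cos \<theta>" k rule: cheb.induct)
  case (3 k)
  have "sin (real (Suc (Suc k)) * \<theta>) + sin (real k * \<theta>) = 2 * cos \<theta> * sin (real (Suc k) * \<theta>)"
  proof -
    define p where "p = real (Suc k) * \<theta>"
    have "real (Suc (Suc k)) * \<theta> = p + \<theta>" "real k * \<theta> = p - \<theta>"
      by (simp_all add: p_def algebra_simps)
    then show ?thesis unfolding p_def[symmetric] by (simp add: sin_add sin_diff)
  qed
  then show ?case
    using 3 by (simp add: algebra_simps)
qed auto

lemma cheb_two: "cheb 2 k = real k"
  by (induction "2::real" k rule: cheb.induct) auto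

text \<open>The word grows on the left: its last letter is always \<open>t\<close>, and the parity
  of its length decides the first one. This suits suffixes that are split off from the right end of
  an element.\<close>

fun alt :: "'a \<Rightarrow> 'a \<Rightarrow> nat \<Rightarrow> 'a list" where
  "alt s t 0 = []"
| "alt s t (Suc k) = (if even k then t else s) # alt s t k"

lemma alt_even: "concat (replicate k [s, t]) = alt s t (2 * k)"
  by (induction k) auto

lemma length_alt [simp]: "length (alt s t k) = k"
  by (induction k) auto

lemma set_alt: "set (alt s t k) \<subseteq> {s, t}"
  by (induction k) auto

lemma alt_split: "\<exists>xs. alt s t (j + k) = xs @ alt s t k \<and> length xs = j"
  by (induction j) (auto)

lemma alt_last: "\<exists>xs. alt s t (Suc k) = xs @ [t]"
  by (induction k) auto

lemma nneg_neg_zero: "nneg x \<Longrightarrow> nneg (neg x) \<Longrightarrow> x = (\<lambda>_. 0)"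
  unfolding nneg_def neg_def by (metis (no_types) antisym neg_0_le_iff_le ext)

lemma nneg_madd: "nneg x \<Longrightarrow> nneg y \<Longrightarrow> 0 \<le> c \<Longrightarrow> nneg (madd x c y)"
  by (simp add: nneg_def madd_def)

lemma neg_madd_distrib: "neg (madd x c y) = madd (neg x) c (neg y)"
  by (simp add: neg_def madd_def)

lemma neg_zero [simp]: "neg (\<lambda>_. 0) = (\<lambda>_. 0)"
  by (simp add: neg_def)

lemma nneg_zero [simp]: "nneg (\<lambda>_. 0)"
  by (simp add: nneg_def)

lemma nneg_sroot: "nneg (sroot s)"
  by (simp add: nneg_def sroot_def)

lemma cone_support:
  assumes "finite K" "nneg x" "\<And>t. t \<notin> K \<Longrightarrow> x t = 0"
  shows "x \<in> cone (sroot ` K)"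
  using assms
proof (induction K arbitrary: x rule: finite_induct)
  case empty
  then have "x = (\<lambda>_. 0)" by auto
  then show ?case using cone.zero by simp
next
  case (insert s K)
  define z where "z = x(s := 0)"
  have "z \<in> cone (sroot ` K)" using insert by (intro insert.IH) (auto simp: z_def nneg_def)
  then have "z \<in> cone (sroot ` insert s K)" by (rule cone_subset) (auto intro: cone_base)
  then have "madd z (x s) (sroot s) \<in> cone (sroot ` insert s K)"
    using insert by (intro cone.add) (auto simp: nneg_def)
  moreover have "madd z (x s) (sroot s) = x" by (auto simp: madd_def z_def sroot_def)
  ultimately show ?case by simp
qed

text \<open>Collecting the multiples of \<open>\<gamma>\<close> isolates its coefficient, which
  later arguments compare between different representations of one vector.\<close>

lemma cone_insert:
  assumes "x \<in> cone (insert \<gamma> X)"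
  shows "\<exists>\<tau> \<kappa>. \<tau> \<in> cone X \<and> 0 \<le> \<kappa> \<and> x = madd \<tau> \<kappa> \<gamma>"
  using assms
proof (induction rule: cone.induct)
  case zero
  show ?case by (rule exI[of _ "\<lambda>_. 0"], rule exI[of _ 0]) (auto simp: madd_def cone.zero)
next
  case (add x \<beta> c)
  then obtain \<tau> \<kappa> where t: "\<tau> \<in> cone X" "0 \<le> \<kappa>" "x = madd \<tau> \<kappa> \<gamma>" by blast
  show ?case
  proof (cases "\<beta> = \<gamma>")
    case True
    then have "madd x c \<beta> = madd \<tau> (\<kappa> + c) \<gamma>" using t by (simp add: madd_def algebra_simps)
    then show ?thesis using t add(3) by (metis add_nonneg_nonneg)
  next
    case False
    then have "\<beta> \<in> X" using add by blast
    moreover have "madd x c \<beta> = madd (madd \<tau> c \<beta>) \<kappa> \<gamma>" using t by (simp add: madd_def algebra_simps)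
    ultimately show ?thesis using t add(3) cone.add[of \<tau> X \<beta> c] by blast
  qed
qed

lemma lexord_map_Suc:
  "(map Suc xs, map Suc ys) \<in> lexord less_than \<longleftrightarrow> (xs, ys) \<in> lexord less_than"
proof (induction xs arbitrary: ys)
  case Nil
  then show ?case by (cases ys) auto
next
  case (Cons x xs)
  then show ?case by (cases ys) auto
qed

lemma map_Suc_exists: "\<forall>p\<in>set ps. 0 < p \<Longrightarrow> \<exists>qs. ps = map Suc qs"
  by (rule exI[of _ "map (\<lambda>p. p - 1) ps"]) (auto simp: map_idI)

text \<open>\<open>coxeter_system\<close> only asserts that some matrix exists. It is fixed here
  because the bilinear form is defined from its entries.\<close>

locale coxeter_geom = group G for G :: "('a, 'b) monoid_scheme" (structure) +
  fixes S :: "'a set" and m :: "'a \<Rightarrow> 'a \<Rightarrow> nat"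
  assumes S_sub: "S \<subseteq> carrier G"
    and gen: "generate G S = carrier G"
    and fin: "finite S"
    and matrix: "coxeter_matrix S m"
    and pres: "\<lbrakk>us \<in> lists S; vs \<in> lists S\<rbrakk> \<Longrightarrow> word_prod G us = word_prod G vs \<longleftrightarrow> coxeter_cong S m us vs"
begin

subsection \<open>The geometric representation\<close>

abbreviation wp where "wp \<equiv> word_prod G"
abbreviation len where "len \<equiv> cox_length G S"

text \<open>Twice the usual form, so that roots have square length 2 and a reflection subtracts the
  pairing itself. The entry 0 encodes infinity, and -2 is the limit of the other case.\<close>

definition bil :: "'a \<Rightarrow> 'a \<Rightarrow> real" where
  "bil s t = (if m s t = 0 then -2 else -2 * cos (pi / m s t))"

lemma m_diag: "s \<in> S \<Longrightarrow> m s s = 1"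
  and m_sym: "s \<in> S \<Longrightarrow> t \<in> S \<Longrightarrow> m s t = m t s"
  and m_off: "s \<in> S \<Longrightarrow> t \<in> S \<Longrightarrow> s \<noteq> t \<Longrightarrow> m s t = 0 \<or> m s t \<ge> 2"
  using matrix unfolding coxeter_matrix_def by blast+

lemma bil_diag: "s \<in> S \<Longrightarrow> bil s s = 2"
  by (simp add: bil_def m_diag)

lemma bil_sym: "s \<in> S \<Longrightarrow> t \<in> S \<Longrightarrow> bil s t = bil t s"
  by (simp add: bil_def m_sym)

lemma bil_nonpos: assumes "s \<in> S" "t \<in> S" "s \<noteq> t" shows "bil s t \<le> 0"
proof (cases "m s t = 0")
  case False
  then have "m s t \<ge> 2" using m_off[OF assms] by simp
  then have "pi / m s t \<le> pi / 2" using pi_gt_zero by (intro divide_left_mono) linarith+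
  moreover have "0 \<le> pi / m s t" by simp
  ultimately have "0 \<le> cos (pi / m s t)" using pi_gt_zero by (intro cos_ge_zero) linarith+
  then show ?thesis by (simp add: bil_def)
qed (simp add: bil_def)

definition pair :: "'a \<Rightarrow> ('a \<Rightarrow> real) \<Rightarrow> real" where
  "pair s x = (\<Sum>r\<in>S. bil s r * x r)"

definition srefl :: "'a \<Rightarrow> ('a \<Rightarrow> real) \<Rightarrow> 'a \<Rightarrow> real" where
  "srefl s x = madd x (- pair s x) (sroot s)"

definition form :: "('a \<Rightarrow> real) \<Rightarrow> ('a \<Rightarrow> real) \<Rightarrow> real" where
  "form x y = (\<Sum>s\<in>S. x s * pair s y)"

lemma pair_madd: "pair s (madd x c y) = pair s x + c * pair s y"
  by (simp add: pair_def madd_def sum_distrib_left sum.distrib algebra_simps)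

lemma pair_sroot: "t \<in> S \<Longrightarrow> pair s (sroot t) = bil s t"
  using fin by (simp add: pair_def sroot_def if_distrib[of "\<lambda>u. _ * u"] cong: if_cong)

lemma srefl_madd: "srefl s (madd x c y) = madd (srefl s x) c (srefl s y)"
  unfolding srefl_def pair_madd by (rule ext) (simp add: madd_def algebra_simps)

lemma srefl_srefl: "s \<in> S \<Longrightarrow> srefl s (srefl s x) = x"
  unfolding srefl_def pair_madd by (rule ext) (simp add: madd_def pair_sroot bil_diag)

lemma srefl_other: "t \<noteq> s \<Longrightarrow> srefl s x t = x t"
  by (simp add: srefl_def madd_def sroot_def)

lemma srefl_sroot: "s \<in> S \<Longrightarrow> srefl s (sroot s) = neg (sroot s)"
  unfolding srefl_def by (rule ext) (simp add: madd_def pair_sroot bil_diag neg_def)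

lemma form_sym: "form x y = form y x"
proof -
  have "form x y = (\<Sum>s\<in>S. \<Sum>r\<in>S. x s * (bil s r * y r))"
    by (simp add: form_def pair_def sum_distrib_left)
  also have "\<dots> = (\<Sum>r\<in>S. \<Sum>s\<in>S. x s * (bil s r * y r))" by (rule sum.swap)
  also have "\<dots> = (\<Sum>r\<in>S. \<Sum>s\<in>S. y r * (bil r s * x s))"
    by (intro sum.cong HOL.refl) (simp add: bil_sym mult_ac)
  also have "\<dots> = form y x" by (simp add: form_def pair_def sum_distrib_left)
  finally show ?thesis .
qed

lemma form_madd2: "form x (madd y c z) = form x y + c * form x z"
  by (simp add: form_def pair_madd sum_distrib_left sum.distrib algebra_simps)

lemma form_madd1: "form (madd y c z) x = form y x + c * form z x"
  using form_madd2 form_sym by metis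

lemma form_sroot: "s \<in> S \<Longrightarrow> form (sroot s) x = pair s x"
  using fin by (simp add: form_def sroot_def if_distrib[of "\<lambda>u. u * _"] cong: if_cong)

lemma form_refl: "s \<in> S \<Longrightarrow> form (srefl s x) (srefl s y) = form x y"
  unfolding srefl_def form_madd1 form_madd2
  by (simp add: form_sroot form_sym[of x "sroot s"] pair_sroot bil_diag)

text \<open>Both correction terms contain the factor \<open>cheb a k\<close>. Once it vanishes, the
  k-th power of the product is the identity on all vectors, including those outside the plane of the
  two roots; the plane need not be split off from the space.\<close>

lemma braid_act:
  assumes st: "s \<in> S" "t \<in> S" "s \<noteq> t"
  defines "a \<equiv> - bil s t"
  shows "foldr srefl (alt s t (2 * k)) x =
    madd (madd x (- (pair s x * (cheb a k)^2 + pair t x * cheb a k * cheb a (Suc k))) (sroot s))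
      (- (pair t x * (cheb a k)^2 + pair s x * cheb a k * (a * cheb a k - cheb a (Suc k)))) (sroot t)"
proof (induction k)
  case 0
  show ?case by (simp add: madd_def)
next
  case (Suc k)
  define q where "q = cheb a k"
  define p where "p = cheb a (Suc k)"
  define X where "X = pair s x"
  define Y where "Y = pair t x"
  define A where "A = - (X * q^2 + Y * q * p)"
  define B where "B = - (Y * q^2 + X * q * (a * q - p))"
  have inv: "q^2 + p^2 - a * q * p = 1" unfolding q_def p_def by (rule cheb_inv)
  define B' where "B' = - B - Y + a * A"
  define A' where "A' = - A - X + a * B'"
  have bl: "bil t s = -a" "bil s t = -a" using bil_sym[OF st(1,2)] by (simp_all add: a_def)
  have "foldr srefl (alt s t (2 * Suc k)) x = srefl s (srefl t (madd (madd x A (sroot s)) B (sroot t)))"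
    using Suc by (simp add: A_def B_def X_def Y_def p_def q_def)
  also have "srefl t (madd (madd x A (sroot s)) B (sroot t)) = madd (madd x A (sroot s)) B' (sroot t)"
    unfolding srefl_def pair_madd pair_sroot[OF st(1)] pair_sroot[OF st(2)] bil_diag[OF st(2)] bl
    by (rule ext) (simp add: madd_def B'_def Y_def algebra_simps)
  also have "srefl s \<dots> = madd (madd x A' (sroot s)) B' (sroot t)"
    unfolding srefl_def pair_madd pair_sroot[OF st(1)] pair_sroot[OF st(2)] bil_diag[OF st(1)] bl
    by (rule ext) (simp add: madd_def A'_def X_def algebra_simps)
  also have B': "B' = - (Y * p^2 + X * p * q)"
  proof -
    have "B' = Y * (q^2 - 1 - a * q * p) - X * p * q"
      unfolding B'_def A_def B_def by (simp add: power2_eq_square algebra_simps)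
    also have "q^2 - 1 - a * q * p = - (p^2)" using inv by simp
    finally show ?thesis by simp
  qed
  also have A': "A' = - (X * p^2 + Y * p * (a * p - q))"
  proof -
    have "A' = X * (q^2 - 1 - a * q * p) + Y * p * (q - a * p)"
      unfolding A'_def A_def B' by (simp add: power2_eq_square algebra_simps)
    also have "q^2 - 1 - a * q * p = - (p^2)" using inv by simp
    finally show ?thesis by (simp add: algebra_simps)
  qed
  finally show ?case by (simp add: X_def Y_def p_def q_def)
qed

text \<open>With \<open>\<theta> = pi / m s t\<close> the value is sin (m \<theta>) / sin \<theta>,
  and m \<theta> is \<pi>.\<close>

lemma cheb_zero:
  assumes st: "s \<in> S" "t \<in> S" "s \<noteq> t" "m s t \<noteq> 0"
  shows "cheb (- bil s t) (m s t) = 0"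
proof -
  define \<theta> where "\<theta> = pi / m s t"
  have m2: "m s t \<ge> 2" using m_off[OF st(1-3)] st(4) by simp
  then have "pi / m s t \<le> pi / 2" using pi_gt_zero by (intro divide_left_mono) linarith+
  moreover have "0 < pi / m s t" using m2 by simp
  ultimately have "0 < sin \<theta>" using pi_gt_zero unfolding \<theta>_def by (intro sin_gt_zero) linarith+
  moreover have "cheb (2 * cos \<theta>) (m s t) * sin \<theta> = 0"
    unfolding cheb_sin using st(4) by (simp add: \<theta>_def)
  ultimately have "cheb (2 * cos \<theta>) (m s t) = 0" by simp
  moreover have "- bil s t = 2 * cos \<theta>" using st(4) by (simp add: bil_def \<theta>_def)
  ultimately show ?thesis by simp
qed

text \<open>Up to k = m the angle k \<theta> stays in [0, \<pi>]. An infinite entry gives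
  \<open>a = 2\<close>, where the value is \<open>k\<close>.\<close>

lemma cheb_nonneg:
  assumes st: "s \<in> S" "t \<in> S" "s \<noteq> t" and k: "m s t = 0 \<or> k \<le> m s t"
  shows "0 \<le> cheb (- bil s t) k"
proof (cases "m s t = 0")
  case True
  then show ?thesis by (simp add: bil_def cheb_two)
next
  case False
  define \<theta> where "\<theta> = pi / m s t"
  have m2: "m s t \<ge> 2" using m_off[OF st] False by simp
  then have "pi / m s t \<le> pi / 2" using pi_gt_zero by (intro divide_left_mono) linarith+
  moreover have "0 < pi / m s t" using m2 by simp
  ultimately have s0: "0 < sin \<theta>" using pi_gt_zero unfolding \<theta>_def by (intro sin_gt_zero) linarith+
  have "real k * \<theta> \<le> real (m s t) * \<theta>" using k False by (intro mult_right_mono) (auto simp: \<theta>_def)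
  also have "\<dots> = pi" using False by (simp add: \<theta>_def)
  finally have "0 \<le> sin (real k * \<theta>)" by (intro sin_ge_zero) (auto simp: \<theta>_def)
  then have "0 \<le> cheb (2 * cos \<theta>) k * sin \<theta>" by (simp add: cheb_sin)
  then have "0 \<le> cheb (2 * cos \<theta>) k" using s0 by (simp add: zero_le_mult_iff)
  moreover have "- bil s t = 2 * cos \<theta>" using False by (simp add: bil_def \<theta>_def)
  ultimately show ?thesis by simp
qed

text \<open>Each reflection changes one of the two coefficients, by exactly one step of the
  Chebyshev recursion; the parity tells which of the roots carries the newer value.\<close>

lemma alt_sroot:
  assumes st: "s \<in> S" "t \<in> S" "s \<noteq> t"
  defines "a \<equiv> - bil s t"
  shows "foldr srefl (alt s t k) (sroot s) =
    (if even k then madd (madd (\<lambda>_. 0) (cheb a (Suc k)) (sroot s)) (cheb a k) (sroot t)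
     else madd (madd (\<lambda>_. 0) (cheb a k) (sroot s)) (cheb a (Suc k)) (sroot t))"
proof (induction k)
  case 0
  show ?case by (simp add: madd_def)
next
  case (Suc k)
  have bl: "bil t s = -a" "bil s t = -a" using bil_sym[OF st(1,2)] by (simp_all add: a_def)
  have p0: "pair r (\<lambda>_. 0) = 0" for r by (simp add: pair_def)
  show ?case
  proof (cases "even k")
    case True
    then have e: "foldr srefl (alt s t (Suc k)) (sroot s) =
        srefl t (madd (madd (\<lambda>_. 0) (cheb a (Suc k)) (sroot s)) (cheb a k) (sroot t))"
      using Suc by simp
    show ?thesis unfolding e using True
      by (simp add: srefl_def pair_madd pair_sroot st bil_diag bl p0) (simp add: madd_def algebra_simps)
  next
    case False
    then have e: "foldr srefl (alt s t (Suc k)) (sroot s) =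
        srefl s (madd (madd (\<lambda>_. 0) (cheb a k) (sroot s)) (cheb a (Suc k)) (sroot t))"
      using Suc by simp
    show ?thesis unfolding e using False
      by (simp add: srefl_def pair_madd pair_sroot st bil_diag bl p0) (simp add: madd_def algebra_simps)
  qed
qed

lemma relation_act:
  assumes st: "s \<in> S" "t \<in> S"
  shows "foldr srefl (concat (replicate (m s t) [s, t])) x = x"
proof (cases "s = t")
  case True
  then show ?thesis using st by (simp add: m_diag srefl_srefl)
next
  case False
  show ?thesis
  proof (cases "m s t = 0")
    case nz: False
    show ?thesis
      unfolding alt_even braid_act[OF st False] cheb_zero[OF st False nz] by (simp add: madd_def)
  qed simp
qed

lemma cong_act: "coxeter_cong S m us vs \<Longrightarrow> foldr srefl us x = foldr srefl vs x"
  by (induction arbitrary: x rule: coxeter_cong.induct) (auto simp: relation_act simp del: alt_even)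

lemma cong_parity: "coxeter_cong S m us vs \<Longrightarrow> even (length us) = even (length vs)"
proof (induction rule: coxeter_cong.induct)
  case (relation s t us vs)
  then show ?case by (simp add: length_concat sum_list_replicate)
qed auto

subsection \<open>Positivity of roots\<close>

declare in_lists_conv_set [simp]

lemma wp_Nil [simp]: "wp [] = \<one>" and wp_Cons [simp]: "wp (x # xs) = x \<otimes> wp xs"
  by (simp_all add: word_prod_def)

lemma S_closed [simp]: "s \<in> S \<Longrightarrow> s \<in> carrier G"
  using S_sub by auto

lemma wp_closed [simp]: "ws \<in> lists S \<Longrightarrow> wp ws \<in> carrier G"
  by (induction ws) auto

lemma wp_append: "us \<in> lists S \<Longrightarrow> vs \<in> lists S \<Longrightarrow> wp (us @ vs) = wp us \<otimes> wp vs"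
  by (induction us) (auto simp: m_assoc)

lemma S_square: assumes "s \<in> S" shows "s \<otimes> s = \<one>"
proof -
  have "coxeter_cong S m [s, s] []"
    using coxeter_cong.relation[OF assms assms, of "[]" "[]" m] assms by (simp add: m_diag)
  then show ?thesis using pres[of "[s, s]" "[]"] assms by simp
qed

lemma S_inv [simp]: "s \<in> S \<Longrightarrow> inv s = s"
  using S_square by (simp add: inv_equality)

lemma S_cancel [simp]: "s \<in> S \<Longrightarrow> g \<in> carrier G \<Longrightarrow> s \<otimes> (s \<otimes> g) = g"
  using S_square by (simp flip: m_assoc)

lemma S_cancel_right [simp]: "s \<in> S \<Longrightarrow> g \<in> carrier G \<Longrightarrow> g \<otimes> s \<otimes> s = g"
  using S_square by (simp add: m_assoc)

lemma wp_rev: "ws \<in> lists S \<Longrightarrow> wp (rev ws) = inv (wp ws)"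
  by (induction ws) (auto simp: wp_append inv_mult_group)

lemma word_exists: assumes "g \<in> carrier G" shows "\<exists>ws\<in>lists S. wp ws = g"
proof -
  have "g \<in> generate G S" using assms gen by simp
  then show ?thesis
  proof (induction rule: generate.induct)
    case one
    show ?case by (rule bexI[of _ "[]"]) auto
  next
    case (incl h)
    then show ?case by (intro bexI[of _ "[h]"]) auto
  next
    case (inv h)
    then show ?case by (intro bexI[of _ "[h]"]) auto
  next
    case (eng h1 h2)
    then obtain us vs where "us \<in> lists S" "wp us = h1" "vs \<in> lists S" "wp vs = h2" by blast
    then show ?case by (intro bexI[of _ "us @ vs"]) (auto simp: wp_append)
  qed
qed

text \<open>Some word of \<open>g\<close> is chosen. Congruent words act alike, so
  \<open>act_wp\<close> frees the action from this choice.\<close>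

definition act :: "'a \<Rightarrow> ('a \<Rightarrow> real) \<Rightarrow> 'a \<Rightarrow> real" where
  "act g = foldr srefl (SOME ws. ws \<in> lists S \<and> wp ws = g)"

lemma act_wp: assumes "ws \<in> lists S" shows "act (wp ws) x = foldr srefl ws x"
proof -
  define us where "us = (SOME us. us \<in> lists S \<and> wp us = wp ws)"
  have "us \<in> lists S \<and> wp us = wp ws"
    unfolding us_def by (rule someI[of _ ws]) (use assms in auto)
  then have "coxeter_cong S m us ws" using pres[of us ws] assms by auto
  then show ?thesis unfolding act_def us_def[symmetric] by (rule cong_act)
qed

lemma act_mult: assumes "g \<in> carrier G" "h \<in> carrier G" shows "act (g \<otimes> h) x = act g (act h x)"
proof -
  obtain us vs where "us \<in> lists S" "wp us = g" "vs \<in> lists S" "wp vs = h"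
    using word_exists assms by metis
  then show ?thesis
    using act_wp[of "us @ vs" x] act_wp[of us "foldr srefl vs x"] act_wp[of vs x] by (auto simp: wp_append)
qed

lemma act_one [simp]: "act \<one> x = x"
  using act_wp[of "[]"] by simp

lemma act_gen: "s \<in> S \<Longrightarrow> act s x = srefl s x"
  using act_wp[of "[s]"] by simp

lemma act_inv_cancel [simp]: "g \<in> carrier G \<Longrightarrow> act (inv g) (act g x) = x"
  and act_cancel_inv [simp]: "g \<in> carrier G \<Longrightarrow> act g (act (inv g) x) = x"
  by (simp_all flip: act_mult)

lemma carrier_induct [consumes 1, case_names one step]:
  assumes "g \<in> carrier G" and "P \<one>"
    and step: "\<And>s g. s \<in> S \<Longrightarrow> g \<in> carrier G \<Longrightarrow> P g \<Longrightarrow> P (s \<otimes> g)"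
  shows "P g"
proof -
  obtain ws where "ws \<in> lists S" "wp ws = g" using word_exists assms(1) by blast
  then show ?thesis
  proof (induction ws arbitrary: g)
    case Nil
    then show ?case using assms(2) by simp
  next
    case (Cons s ws)
    then show ?case using step[of s "wp ws"] by auto
  qed
qed

lemma act_madd: "g \<in> carrier G \<Longrightarrow> act g (madd x c y) = madd (act g x) c (act g y)"
proof (induction rule: carrier_induct)
  case (step s g)
  then show ?case by (simp add: act_mult act_gen srefl_madd)
qed simp

lemma act_form: "g \<in> carrier G \<Longrightarrow> form (act g x) (act g y) = form x y"
proof (induction rule: carrier_induct)
  case (step s g)
  then show ?case by (simp add: act_mult act_gen form_refl)
qed simp

lemma act_zero [simp]: assumes "g \<in> carrier G" shows "act g (\<lambda>_. 0) = (\<lambda>_. 0)"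
proof -
  have "madd (\<lambda>_. 0) (-1) (\<lambda>_. 0) = (\<lambda>_::'a. 0::real)" by (simp add: madd_def)
  then have "act g (\<lambda>_. 0) = madd (act g (\<lambda>_. 0)) (-1) (act g (\<lambda>_. 0))"
    using act_madd[OF assms, of "\<lambda>_. 0" "-1" "\<lambda>_. 0"] by simp
  then show ?thesis by (auto simp: madd_def fun_eq_iff)
qed

lemma neg_madd: "neg x = madd (\<lambda>_. 0) (-1) x"
  by (simp add: neg_def madd_def)

lemma act_neg: "g \<in> carrier G \<Longrightarrow> act g (neg x) = neg (act g x)"
  by (simp add: neg_madd act_madd)

lemma neg_neg [simp]: "neg (neg x) = x"
  by (simp add: neg_def)

section \<open>Lengths and descents\<close>

lemma len_le: "ws \<in> lists S \<Longrightarrow> len (wp ws) \<le> length ws"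
  unfolding cox_length_def by (rule Least_le) auto

lemma reduced_exists: assumes "g \<in> carrier G" shows "\<exists>ws. reduced_word G S ws g"
proof -
  obtain us where "us \<in> lists S" "wp us = g" using word_exists assms by blast
  then have "\<exists>k. \<exists>ws\<in>lists S. wp ws = g \<and> length ws = k" by blast
  from LeastI_ex[OF this] show ?thesis unfolding reduced_word_def cox_length_def by blast
qed

lemma len_one [simp]: "len \<one> = 0"
  using len_le[of "[]"] by simp

lemma len_mult: assumes "g \<in> carrier G" "h \<in> carrier G" shows "len (g \<otimes> h) \<le> len g + len h"
proof -
  obtain us vs where "reduced_word G S us g" "reduced_word G S vs h"
    using reduced_exists assms by metis
  then show ?thesis
    using len_le[of "us @ vs"] unfolding reduced_word_def by (auto simp: wp_append)
qed

lemma len_inv: assumes "g \<in> carrier G" shows "len (inv g) = len g"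
proof -
  have "len (inv h) \<le> len h" if h: "h \<in> carrier G" for h
  proof -
    obtain us where "reduced_word G S us h" using reduced_exists h by metis
    then show ?thesis
      using len_le[of "rev us"] wp_rev[of us] unfolding reduced_word_def by auto
  qed
  from this[of g] this[of "inv g"] show ?thesis using assms by simp
qed

lemma len_parity: assumes "ws \<in> lists S" shows "even (len (wp ws)) = even (length ws)"
proof -
  obtain us where us: "us \<in> lists S" "wp us = wp ws" "length us = len (wp ws)"
    using reduced_exists[of "wp ws"] assms unfolding reduced_word_def by auto
  then have "coxeter_cong S m us ws" using pres[of us ws] assms by auto
  then show ?thesis using cong_parity us by metis
qed

text \<open>A generator changes the length by at most one, and it cannot keep it: the relations have
  even length, so the parity of a word is an invariant of its product.\<close>

lemma len_gen_cases:
  assumes "g \<in> carrier G" "s \<in> S"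
  shows "len (g \<otimes> s) = Suc (len g) \<or> len g = Suc (len (g \<otimes> s))"
proof -
  have s1: "len s \<le> 1" using len_le[of "[s]"] assms by simp
  have 1: "len (g \<otimes> s) \<le> len g + 1" using len_mult[of g s] s1 assms by simp
  have 2: "len g \<le> len (g \<otimes> s) + 1" using len_mult[of "g \<otimes> s" s] s1 assms by simp
  obtain ws where "ws \<in> lists S" "wp ws = g" using word_exists assms by blast
  then have "even (len g) \<noteq> even (len (g \<otimes> s))"
    using len_parity[of ws] len_parity[of "ws @ [s]"] assms by (auto simp: wp_append)
  with 1 2 show ?thesis by (cases "len (g \<otimes> s) = len g") auto
qed

lemma len_left: assumes "g \<in> carrier G" "s \<in> S" shows "len (s \<otimes> g) = len (inv g \<otimes> s)"
  using len_inv[of "s \<otimes> g"] assms by (simp add: inv_mult_group)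

lemma len_left_cases:
  assumes "g \<in> carrier G" "s \<in> S"
  shows "len (s \<otimes> g) = Suc (len g) \<or> len g = Suc (len (s \<otimes> g))"
  using len_gen_cases[of "inv g" s] len_left[OF assms] len_inv assms by simp

lemma descent_exists:
  assumes "g \<in> carrier G" "g \<noteq> \<one>" shows "\<exists>s\<in>S. len (s \<otimes> g) < len g"
proof -
  obtain ws where ws: "ws \<in> lists S" "wp ws = g" "length ws = len g"
    using reduced_exists[OF assms(1)] unfolding reduced_word_def by auto
  with assms(2) obtain s us where su: "ws = s # us" by (cases ws) auto
  then have "s \<in> S" "us \<in> lists S" using ws by auto
  moreover have "s \<otimes> g = wp us" using su ws by auto
  ultimately show ?thesis using ws su len_le[of us] by (intro bexI[of _ s]) auto
qed

lemma right_descent_exists: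
  assumes "g \<in> carrier G" "g \<noteq> \<one>" shows "\<exists>s\<in>S. len (g \<otimes> s) < len g"
proof -
  have "inv g \<noteq> \<one>" using assms by (metis inv_inv inv_one)
  then obtain s where "s \<in> S" "len (s \<otimes> inv g) < len (inv g)"
    using descent_exists[of "inv g"] assms by auto
  then show ?thesis using len_left[of "inv g" s] len_inv[of g] assms by auto
qed

lemma alt_lists: "s \<in> S \<Longrightarrow> t \<in> S \<Longrightarrow> alt s t k \<in> lists S"
  using set_alt[of s t k] by auto

text \<open>In the relation that the alternating word of length 2m is trivial, the letters are moved
  to the other side one at a time, each being its own inverse. After m moves the two sides are the
  two braid words.\<close>

lemma alt_braid:
  assumes st: "s \<in> S" "t \<in> S"
  shows "wp (alt s t (m s t)) = wp (alt t s (m s t))"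
proof -
  define k where "k = m s t"
  have "coxeter_cong S m (concat (replicate k [s, t])) []"
    using coxeter_cong.relation[OF st, of "[]" "[]" m] by (simp add: k_def)
  then have eq: "coxeter_cong S m (alt s t (2 * k)) []" by (simp only: alt_even)
  have al: "alt s t j \<in> lists S" "alt t s j \<in> lists S" for j
    using alt_lists[OF st] alt_lists[OF st(2,1)] by blast+
  have one: "wp (alt s t (2 * k)) = \<one>"
    using pres[OF al(1), of "[]"] eq by simp
  have "j \<le> 2 * k \<Longrightarrow> wp (alt s t (2 * k - j)) = wp (alt t s j)" for j
  proof (induction j)
    case (Suc j)
    define r where "r = (if even j then s else t)"
    have rS: "r \<in> S" using st by (simp add: r_def)
    have e: "2 * k - j = Suc (2 * k - Suc j)" using Suc by simp
    have "even (2 * k - Suc j) = odd j" using Suc(2) by auto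
    then have "alt s t (2 * k - j) = r # alt s t (2 * k - Suc j)"
      unfolding e by (simp add: r_def)
    moreover have "wp (alt s t (2 * k - j)) = wp (alt t s j)" using Suc by (metis Suc_leD)
    ultimately have "r \<otimes> wp (alt s t (2 * k - Suc j)) = wp (alt t s j)" by simp
    then have "r \<otimes> (r \<otimes> wp (alt s t (2 * k - Suc j))) = r \<otimes> wp (alt t s j)" by (rule arg_cong)
    then have "wp (alt s t (2 * k - Suc j)) = r \<otimes> wp (alt t s j)"
      unfolding S_cancel[OF rS wp_closed[OF al(1)]] .
    then show ?case by (simp add: r_def)
  qed (simp add: one)
  from this[of k] show ?thesis by (simp add: k_def)
qed

text \<open>The longest alternating suffix in \<open>s\<close> and a right descent \<open>t\<close>
  is split off from \<open>g\<close>. The remaining factor has neither letter as a right descent, so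
  by induction it keeps both simple roots nonnegative. The suffix is shorter than m and hence sends
  \<open>sroot s\<close> to a nonnegative combination of the two.\<close>

theorem root_pos_right:
  assumes "g \<in> carrier G" "s \<in> S" "len g < len (g \<otimes> s)"
  shows "nneg (act g (sroot s))"
  using assms
proof (induction "len g" arbitrary: g s rule: less_induct)
  case less
  note IH = less(1) and gG = less(2) and sS = less(3) and asc = less(4)
  show ?case
  proof (cases "g = \<one>")
    case True
    then show ?thesis by (simp add: nneg_def sroot_def)
  next
    case False
    then obtain t where t: "t \<in> S" "len (g \<otimes> t) < len g"
      using right_descent_exists[OF gG] by blast
    have st: "s \<noteq> t" using t asc by auto
    have al: "alt s t j \<in> lists S" "alt t s j \<in> lists S" for j
      using alt_lists[OF sS t(1)] alt_lists[OF t(1) sS] by blast+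
    define P where "P k \<longleftrightarrow> (\<exists>v\<in>carrier G. g = v \<otimes> wp (alt s t k) \<and> len v + k = len g)" for k
    have P1: "P 1"
      unfolding P_def using t gG len_gen_cases[of g t] by (intro bexI[of _ "g \<otimes> t"]) auto
    define k where "k = (GREATEST k. P k)"
    have bd: "P k' \<Longrightarrow> k' \<le> len g" for k' unfolding P_def by auto
    have Pk: "P k" unfolding k_def using P1 bd by (rule GreatestI_nat)
    have kmax: "P k' \<Longrightarrow> k' \<le> k" for k' unfolding k_def using bd by (intro Greatest_le_nat) auto
    obtain j where kj: "k = Suc j" using kmax[OF P1] by (cases k) auto
    obtain v where v: "v \<in> carrier G" "g = v \<otimes> wp (alt s t k)" "len v + k = len g"
      using Pk unfolding P_def by auto
    \<comment> \<open>\<open>a\<close> is the first letter of the suffix, \<open>b\<close> the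
      letter that would prolong it to the left.\<close>
    define a where "a = (if even j then t else s)"
    define b where "b = (if even j then s else t)"
    have abS: "a \<in> S" "b \<in> S" using t sS by (auto simp: a_def b_def)
    have "len v < len (v \<otimes> a)"
    proof (rule ccontr)
      assume "\<not> ?thesis"
      then have l: "len v = Suc (len (v \<otimes> a))" using len_gen_cases[OF v(1) abS(1)] by auto
      have "g = (v \<otimes> a) \<otimes> wp (alt s t j)"
        using v(1,2) abS wp_closed[OF al(1)[of j]] unfolding kj by (simp add: a_def m_assoc)
      then have "len g \<le> len (v \<otimes> a) + length (alt s t j)"
        using len_mult[of "v \<otimes> a" "wp (alt s t j)"] len_le[OF al(1), of j] v(1) abS wp_closed[OF al(1)[of j]] by simp
      then show False using l v(3) kj by simp
    qed
    moreover have "len v < len (v \<otimes> b)"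
    proof (rule ccontr)
      assume "\<not> ?thesis"
      then have l: "len v = Suc (len (v \<otimes> b))" using len_gen_cases[OF v(1) abS(2)] by auto
      have "alt s t (Suc k) = b # alt s t k" by (simp add: kj b_def)
      then have "g = (v \<otimes> b) \<otimes> wp (alt s t (Suc k))"
        using v(1,2) abS wp_closed[OF al(1)[of k]] by (simp add: m_assoc)
      then have "P (Suc k)" unfolding P_def using l v abS by (intro bexI[of _ "v \<otimes> b"]) auto
      then show False using kmax by force
    qed
    ultimately have "len v < len (v \<otimes> s)" "len v < len (v \<otimes> t)" by (auto simp: a_def b_def split: if_splits)
    moreover have "len v < len g" using v(3) kj by simp
    ultimately have pos: "nneg (act v (sroot s))" "nneg (act v (sroot t))"
      using IH[OF _ v(1) sS] IH[OF _ v(1) t(1)] by blast+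
    \<comment> \<open>A suffix of m or more letters could be rewritten by a braid move to end in
      \<open>s\<close>, and then \<open>g \<otimes> s\<close> would be shorter than
      \<open>g\<close>.\<close>
    have km: "m s t = 0 \<or> Suc k \<le> m s t"
    proof (rule ccontr)
      assume "\<not> ?thesis"
      then have km: "m s t \<le> k" "m s t \<noteq> 0" by auto
      obtain xs where xs: "alt s t k = xs @ alt s t (m s t)" "length xs = k - m s t"
        using alt_split[of s t "k - m s t" "m s t"] km by auto
      have xsS: "xs \<in> lists S" using al(1)[of k] xs by auto
      obtain ys where ys: "alt t s (m s t) = ys @ [s]" using alt_last[of t s "m s t - 1"] km by auto
      have ysS: "ys \<in> lists S" using al(2)[of "m s t"] ys by auto
      have lys: "length ys = m s t - 1" using arg_cong[OF ys, of length] by simp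
      have "wp (alt s t (m s t)) = wp ys \<otimes> s"
        unfolding alt_braid[OF sS t(1)] ys using wp_append[OF ysS, of "[s]"] sS by simp
      then have "wp (alt s t k) = wp xs \<otimes> (wp ys \<otimes> s)"
        unfolding xs(1) wp_append[OF xsS al(1)] by simp
      then have "g \<otimes> s = v \<otimes> wp (xs @ ys)"
        using v(1,2) wp_closed[OF xsS] wp_closed[OF ysS] wp_append[OF xsS ysS] sS S_square
        by (simp add: m_assoc)
      then have "len (g \<otimes> s) \<le> len v + length (xs @ ys)"
      proof -
        have "xs @ ys \<in> lists S" using xsS ysS by auto
        then show ?thesis
          using \<open>g \<otimes> s = _\<close> len_mult[OF v(1) wp_closed] len_le by (metis add_left_mono order_trans)
      qed
      then show False using asc v(3) xs(2) lys km by simp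
    qed
    have c: "0 \<le> cheb (- bil s t) k" "0 \<le> cheb (- bil s t) (Suc k)"
      using cheb_nonneg[OF sS t(1) st] km by auto
    have "act (wp (alt s t k)) (sroot s) = foldr srefl (alt s t k) (sroot s)"
      by (rule act_wp[OF al(1)])
    then have "\<exists>c d. 0 \<le> c \<and> 0 \<le> d \<and> act (wp (alt s t k)) (sroot s) = madd (madd (\<lambda>_. 0) c (sroot s)) d (sroot t)"
      using alt_sroot[OF sS t(1) st, of k] c by (cases "even k") auto
    then obtain c d where cd: "0 \<le> c" "0 \<le> d"
      "act (wp (alt s t k)) (sroot s) = madd (madd (\<lambda>_. 0) c (sroot s)) d (sroot t)" by blast
    have "act g (sroot s) = madd (madd (\<lambda>_. 0) c (act v (sroot s))) d (act v (sroot t))"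
      unfolding v(2) using v(1) wp_closed[OF al(1)[of k]] by (simp add: act_mult cd(3) act_madd)
    then show ?thesis using pos cd by (simp add: nneg_def madd_def)
  qed
qed

subsection \<open>Inversion roots\<close>

definition roots where
  "roots = {act g (sroot s) | g s. g \<in> carrier G \<and> s \<in> S}"

definition pos_roots where
  "pos_roots = {\<beta> \<in> roots. nneg \<beta>}"

definition N :: "'a \<Rightarrow> ('a \<Rightarrow> real) set" where
  "N w = {\<beta> \<in> pos_roots. \<not> nneg (act (inv w) \<beta>)}"

lemma act_roots: assumes g: "g \<in> carrier G" "\<beta> \<in> roots" shows "act g \<beta> \<in> roots"
proof -
  obtain h s where "h \<in> carrier G" "s \<in> S" "\<beta> = act h (sroot s)" using g unfolding roots_def by blast
  then have "act g \<beta> = act (g \<otimes> h) (sroot s)" "g \<otimes> h \<in> carrier G" using g by (simp_all add: act_mult)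
  then show ?thesis unfolding roots_def using \<open>s \<in> S\<close> by blast
qed

lemma act_neg_sroot: assumes "g \<in> carrier G" "s \<in> S" shows "neg (act g (sroot s)) = act (g \<otimes> s) (sroot s)"
  using assms by (simp add: act_mult act_gen srefl_sroot act_neg)

lemma neg_roots: "\<beta> \<in> roots \<Longrightarrow> neg \<beta> \<in> roots"
  unfolding roots_def using act_neg_sroot by fastforce

lemma roots_cases: assumes "\<beta> \<in> roots" shows "nneg \<beta> \<or> nneg (neg \<beta>)"
proof -
  obtain g s where gs: "g \<in> carrier G" "s \<in> S" "\<beta> = act g (sroot s)"
    using assms unfolding roots_def by blast
  show ?thesis
  proof (cases "len g < len (g \<otimes> s)")
    case True
    then show ?thesis using root_pos_right gs by blast
  next
    case False
    then have "len (g \<otimes> s) < len (g \<otimes> s \<otimes> s)" using len_gen_cases[OF gs(1,2)] gs by auto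
    then have "nneg (act (g \<otimes> s) (sroot s))" using root_pos_right gs by simp
    then show ?thesis using gs act_neg_sroot by simp
  qed
qed

lemma form_root: "\<beta> \<in> roots \<Longrightarrow> form \<beta> \<beta> = 2"
  unfolding roots_def by (auto simp: act_form form_sroot pair_sroot bil_diag)

lemma root_nonzero: "\<beta> \<in> roots \<Longrightarrow> \<beta> \<noteq> (\<lambda>_. 0)"
  using form_root by (fastforce simp: form_def)

lemma roots_not_both: "\<beta> \<in> roots \<Longrightarrow> nneg \<beta> \<Longrightarrow> \<not> nneg (neg \<beta>)"
  using nneg_neg_zero root_nonzero by blast

lemma sroot_roots: "s \<in> S \<Longrightarrow> sroot s \<in> roots"
  unfolding roots_def by (rule CollectI, rule exI[of _ "\<one>"], rule exI[of _ s]) auto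

lemma sroot_pos: "s \<in> S \<Longrightarrow> sroot s \<in> pos_roots"
  by (simp add: pos_roots_def sroot_roots nneg_sroot)

text \<open>The square length 2 of a root determines the coefficient up to sign, and positivity
  determines the sign.\<close>

lemma pos_root_multiple:
  assumes "\<beta> \<in> pos_roots" "s \<in> S" "\<And>t. t \<noteq> s \<Longrightarrow> \<beta> t = 0"
  shows "\<beta> = sroot s"
proof -
  have b: "\<beta> = madd (\<lambda>_. 0) (\<beta> s) (sroot s)"
    using assms(3) by (auto simp: madd_def sroot_def)
  have z: "form x (\<lambda>_. 0) = 0" for x by (simp add: form_def pair_def)
  have "form \<beta> \<beta> = 2 * (\<beta> s)^2"
    by (subst (1 2) b) (simp add: form_madd1 form_madd2 z form_sym[of "\<lambda>_. 0"] form_sroot pair_sroot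
        assms(2) bil_diag power2_eq_square)
  then have "(\<beta> s)^2 = 1" using form_root assms(1) by (simp add: pos_roots_def)
  then have "\<beta> s = 1" using assms(1) by (auto simp: pos_roots_def nneg_def power2_eq_1_iff dest: spec[of _ s])
  then show ?thesis using b by (simp add: madd_def)
qed

text \<open>A positive root other than \<open>sroot s\<close> has a positive coordinate away from
  \<open>s\<close>. The reflection does not touch it, and one positive coordinate decides the sign
  of a root.\<close>

lemma srefl_pos_root:
  assumes "\<beta> \<in> pos_roots" "s \<in> S" "\<beta> \<noteq> sroot s"
  shows "srefl s \<beta> \<in> pos_roots"
proof -
  obtain t where t: "t \<noteq> s" "\<beta> t \<noteq> 0" using pos_root_multiple assms by blast
  have r: "srefl s \<beta> \<in> roots"
    using act_roots[of s \<beta>] assms by (simp add: act_gen pos_roots_def)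
  have "\<beta> t > 0" using t assms(1) by (simp add: pos_roots_def nneg_def order_less_le)
  then have "\<not> nneg (neg (srefl s \<beta>))"
    using t(1) by (auto simp: nneg_def neg_def srefl_other not_le intro!: exI[of _ t])
  then show ?thesis using roots_cases[OF r] r by (simp add: pos_roots_def)
qed

lemma N_pos: "\<beta> \<in> N w \<Longrightarrow> \<beta> \<in> pos_roots"
  by (simp add: N_def)

lemma N_iff: assumes "w \<in> carrier G"
  shows "\<beta> \<in> N w \<longleftrightarrow> \<beta> \<in> pos_roots \<and> nneg (neg (act (inv w) \<beta>))"
  using roots_cases[of "act (inv w) \<beta>"] roots_not_both[of "act (inv w) \<beta>"] act_roots[of "inv w" \<beta>] assms
  unfolding N_def pos_roots_def by auto

lemma N_one [simp]: "N \<one> = {}"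
  by (simp add: N_def pos_roots_def)

lemma sroot_N: assumes "w \<in> carrier G" "s \<in> S"
  shows "sroot s \<in> N w \<longleftrightarrow> len (s \<otimes> w) < len w"
proof (cases "len (s \<otimes> w) < len w")
  case True
  then have "len (inv w \<otimes> s) < len (inv w \<otimes> s \<otimes> s)" using assms len_left len_inv by simp
  then have "nneg (act (inv w \<otimes> s) (sroot s))" using root_pos_right assms by simp
  then show ?thesis using True assms by (simp add: N_iff sroot_pos act_neg_sroot)
next
  case False
  then have "len (inv w) < len (inv w \<otimes> s)" using len_left_cases[OF assms] assms len_left len_inv by simp
  then have "nneg (act (inv w) (sroot s))" using root_pos_right assms by simp
  then show ?thesis using False by (simp add: N_def)
qed

lemma sroot_N_mult: assumes "w \<in> carrier G" "s \<in> S"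
  shows "sroot s \<in> N (s \<otimes> w) \<longleftrightarrow> sroot s \<notin> N w"
  using sroot_N[of "s \<otimes> w" s] sroot_N[of w s] len_left_cases[OF assms] assms by auto

lemma N_mult_iff: assumes "w \<in> carrier G" "s \<in> S" "\<beta> \<in> pos_roots" "\<beta> \<noteq> sroot s"
  shows "\<beta> \<in> N (s \<otimes> w) \<longleftrightarrow> srefl s \<beta> \<in> N w"
proof -
  have "act (inv (s \<otimes> w)) \<beta> = act (inv w) (srefl s \<beta>)"
    using assms by (simp add: inv_mult_group act_mult act_gen)
  then show ?thesis using srefl_pos_root assms by (simp add: N_def)
qed

lemma srefl_not_sroot: assumes "s \<in> S" "\<beta> \<in> pos_roots"
  shows "srefl s \<beta> \<noteq> sroot s"
proof
  assume "srefl s \<beta> = sroot s"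
  then have "\<beta> = neg (sroot s)" using srefl_srefl[OF assms(1), of \<beta>] srefl_sroot[OF assms(1)] by simp
  then have "\<beta> s = -1" by (simp add: neg_def sroot_def)
  then show False using assms(2) by (auto simp: pos_roots_def nneg_def dest: spec[of _ s])
qed

lemma N_mult: assumes w: "w \<in> carrier G" "s \<in> S" "sroot s \<notin> N w"
  shows "N (s \<otimes> w) = insert (sroot s) (srefl s ` N w)"
proof (intro equalityI subsetI)
  fix \<beta> assume b: "\<beta> \<in> N (s \<otimes> w)"
  show "\<beta> \<in> insert (sroot s) (srefl s ` N w)"
  proof (cases "\<beta> = sroot s")
    case False
    then have "srefl s \<beta> \<in> N w" using b N_mult_iff[OF w(1,2)] N_pos by blast
    then show ?thesis using srefl_srefl[OF w(2), of \<beta>] by (metis imageI insertCI)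
  qed simp
next
  fix \<beta> assume "\<beta> \<in> insert (sroot s) (srefl s ` N w)"
  then consider "\<beta> = sroot s" | \<gamma> where "\<gamma> \<in> N w" "\<beta> = srefl s \<gamma>" by blast
  then show "\<beta> \<in> N (s \<otimes> w)"
  proof cases
    case 1
    then show ?thesis using sroot_N_mult w by simp
  next
    case 2
    then have g: "\<gamma> \<in> pos_roots" "\<gamma> \<noteq> sroot s" using w N_pos by auto
    then have "\<beta> \<in> pos_roots" "\<beta> \<noteq> sroot s"
      using 2 srefl_pos_root[OF g(1) w(2)] srefl_not_sroot[OF w(2) g(1)] by auto
    then show ?thesis using N_mult_iff[OF w(1,2)] 2 srefl_srefl[OF w(2)] by simp
  qed
qed

lemma N_descent: assumes "w \<in> carrier G" "s \<in> S" "sroot s \<in> N w"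
  shows "sroot s \<notin> N (s \<otimes> w)" "N w = insert (sroot s) (srefl s ` N (s \<otimes> w))" "len (s \<otimes> w) < len w"
proof -
  show n: "sroot s \<notin> N (s \<otimes> w)" using sroot_N_mult assms by simp
  show "N w = insert (sroot s) (srefl s ` N (s \<otimes> w))"
    using N_mult[of "s \<otimes> w" s] n assms by simp
  show "len (s \<otimes> w) < len w" using sroot_N assms by simp
qed

lemma left_induct [consumes 1, case_names one step]:
  assumes "w \<in> carrier G" and one: "P \<one>"
    and step: "\<And>s w. \<lbrakk>s \<in> S; w \<in> carrier G; sroot s \<in> N w; P (s \<otimes> w)\<rbrakk> \<Longrightarrow> P w"
  shows "P w"
  using assms(1)
proof (induction "len w" arbitrary: w rule: less_induct)
  case less
  show ?case
  proof (cases "w = \<one>")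
    case False
    then obtain s where s: "s \<in> S" "len (s \<otimes> w) < len w" using descent_exists less(2) by blast
    then show ?thesis using step[of s w] less sroot_N by simp
  qed (use one in simp)
qed

lemma N_nonempty: assumes "w \<in> carrier G" "w \<noteq> \<one>" shows "\<exists>s\<in>S. sroot s \<in> N w"
  using descent_exists assms sroot_N by auto

lemma finite_N: "w \<in> carrier G \<Longrightarrow> finite (N w)"
proof (induction rule: left_induct)
  case (step s w)
  then show ?case using N_descent(2)[OF step(2,1,3)] by (metis finite_imageI finite_insert)
qed simp

text \<open>This cancels a common left descent from a comparison, the basic move of the inductions
  on length.\<close>

lemma N_mono_strip:
  assumes "v \<in> carrier G" "w \<in> carrier G" "s \<in> S" "sroot s \<notin> N v" "sroot s \<notin> N w"
  shows "N (s \<otimes> v) \<subseteq> N (s \<otimes> w) \<longleftrightarrow> N v \<subseteq> N w"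
proof
  assume l: "N (s \<otimes> v) \<subseteq> N (s \<otimes> w)"
  show "N v \<subseteq> N w"
  proof
    fix \<beta> assume b: "\<beta> \<in> N v"
    then have p: "\<beta> \<in> pos_roots" by (rule N_pos)
    have "srefl s \<beta> \<in> N (s \<otimes> w)" using l N_mult[of v s] assms b by blast
    then have "srefl s \<beta> \<in> srefl s ` N w"
      using N_mult[of w s] assms srefl_not_sroot[OF assms(3) p] by blast
    then show "\<beta> \<in> N w" using srefl_srefl[OF assms(3)] by (metis imageE)
  qed
qed (use assms N_mult in auto)

text \<open>Otherwise \<open>z\<^sup>-\<^sup>1 y\<close> would map every simple root to a
  positive root.\<close>
lemma cover_exists:
  assumes "z \<in> carrier G" "y \<in> carrier G" "N z \<subseteq> N y" "z \<noteq> y"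
  shows "\<exists>p\<in>S. neg (act y (sroot p)) \<in> N y - N z"
proof (rule ccontr)
  assume a: "\<not> ?thesis"
  have "nneg (act (inv z \<otimes> y) (sroot p))" if p: "p \<in> S" for p
  proof -
    let ?b = "act y (sroot p)"
    have r: "?b \<in> roots" using act_roots sroot_roots p assms by blast
    have e: "act (inv z \<otimes> y) (sroot p) = act (inv z) ?b" using assms by (simp add: act_mult)
    from roots_cases[OF r] show ?thesis
    proof
      assume "nneg ?b"
      then have "?b \<in> pos_roots" using r by (simp add: pos_roots_def)
      moreover have "?b \<notin> N y" using assms by (simp add: N_def nneg_sroot)
      ultimately show ?thesis using assms(3) e by (auto simp: N_def)
    next
      assume n: "nneg (neg ?b)"
      then have pr: "neg ?b \<in> pos_roots" using neg_roots r by (simp add: pos_roots_def)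
      have "act (inv y) (neg ?b) = neg (sroot p)" using assms by (simp add: act_neg)
      then have "neg ?b \<in> N y" using pr assms by (simp add: N_iff nneg_sroot)
      then have "neg ?b \<in> N z" using a p by blast
      then show ?thesis using assms e by (simp add: N_iff act_neg)
    qed
  qed
  moreover have c: "inv z \<otimes> y \<in> carrier G" using assms by simp
  ultimately have "inv z \<otimes> y = \<one>"
  proof (rule_tac ccontr)
    assume pos: "\<And>p. p \<in> S \<Longrightarrow> nneg (act (inv z \<otimes> y) (sroot p))" and "inv z \<otimes> y \<noteq> \<one>"
    then obtain p where p: "p \<in> S" "len (inv z \<otimes> y \<otimes> p) < len (inv z \<otimes> y)"
      using right_descent_exists[OF c] by blast
    then have "nneg (act (inv z \<otimes> y \<otimes> p) (sroot p))" using root_pos_right[of "inv z \<otimes> y \<otimes> p" p] c by simp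
    then have "nneg (neg (act (inv z \<otimes> y) (sroot p)))" using act_neg_sroot[OF c p(1)] by simp
    then show False
      using roots_not_both[OF act_roots[OF c sroot_roots[OF p(1)]] pos[OF p(1)]] by simp
  qed
  then have "z \<otimes> (inv z \<otimes> y) = z" using assms by simp
  then have "y = z" using assms by (simp flip: m_assoc)
  then show False using assms by simp
qed

lemma N_inj: assumes "z \<in> carrier G" "y \<in> carrier G" "N z = N y" shows "z = y"
  using cover_exists[OF assms(1,2)] assms(3) by blast

text \<open>Seen from \<open>y\<close>, that is after applying \<open>inv y\<close>, multiplication
  by \<open>p\<close> on the right reflects in \<open>sroot p\<close>. The sign changes only for
  this root and its negative.\<close>

lemma N_right_mult:
  assumes "y \<in> carrier G" "p \<in> S" and d: "neg (act y (sroot p)) \<in> N y"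
  shows "N (y \<otimes> p) = N y - {neg (act y (sroot p))}"
proof -
  define \<delta> where "\<delta> = neg (act y (sroot p))"
  have di: "act (inv y) \<delta> = neg (sroot p)" using assms by (simp add: \<delta>_def act_neg)
  have "\<beta> \<in> N (y \<otimes> p) \<longleftrightarrow> \<beta> \<in> N y \<and> \<beta> \<noteq> \<delta>" if b: "\<beta> \<in> pos_roots" for \<beta>
  proof -
    define \<eta> where "\<eta> = act (inv y) \<beta>"
    have e: "act (inv (y \<otimes> p)) \<beta> = srefl p \<eta>"
      using assms by (simp add: inv_mult_group act_mult act_gen \<eta>_def)
    have er: "\<eta> \<in> roots" using b act_roots assms by (simp add: pos_roots_def \<eta>_def)
    have yb: "\<beta> = act y \<eta>" using assms by (simp add: \<eta>_def)
    show ?thesis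
    proof (cases "\<beta> = \<delta>")
      case True
      then have "srefl p \<eta> = sroot p" using di srefl_srefl[OF assms(2), of "sroot p"]
        by (simp add: \<eta>_def srefl_sroot[OF assms(2)])
      then show ?thesis using True e by (simp add: N_def nneg_sroot)
    next
      case False
      have n1: "\<eta> \<noteq> neg (sroot p)"
        using False yb assms by (auto simp: \<delta>_def act_neg)
      have n2: "\<eta> \<noteq> sroot p"
        using yb b N_pos[OF d] roots_not_both by (auto simp: pos_roots_def)
      have "nneg (srefl p \<eta>) \<longleftrightarrow> nneg \<eta>"
      proof (cases "nneg \<eta>")
        case True
        then show ?thesis using srefl_pos_root[of \<eta> p] er n2 assms by (simp add: pos_roots_def)
      next
        case f: False
        then have "neg \<eta> \<in> pos_roots" using neg_roots[OF er] roots_cases[OF er] by (simp add: pos_roots_def)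
        moreover have "neg \<eta> \<noteq> sroot p" using n1 by (metis neg_neg)
        ultimately have "srefl p (neg \<eta>) \<in> pos_roots" using srefl_pos_root assms by blast
        moreover have "srefl p (neg \<eta>) = neg (srefl p \<eta>)"
          using act_neg[of p \<eta>] assms by (simp add: act_gen)
        ultimately have "nneg (neg (srefl p \<eta>))" by (simp add: pos_roots_def)
        then show ?thesis
          using f roots_not_both[of "srefl p \<eta>"] act_roots[OF S_closed[OF assms(2)] er] assms(2)
          by (auto simp: act_gen)
      qed
      then show ?thesis using False b e by (simp add: N_def \<eta>_def)
    qed
  qed
  then show ?thesis using N_pos unfolding \<delta>_def by blast
qed

lemma cone_N: assumes "w \<in> carrier G" "x \<in> cone (N w)" shows "nneg (neg (act (inv w) x))"
  using assms(2)
proof (induction rule: cone.induct)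
  case (add x \<beta> c)
  then show ?case using assms(1) by (simp add: act_madd neg_madd_distrib nneg_madd N_iff)
qed (use assms(1) in simp)

text \<open>The action is linear, so \<open>inv w\<close> makes every nonnegative combination of
  inversions nonpositive. Hence a cone bound on an inversion set turns into an order relation with
  every element whose inversions include the generators.\<close>

lemma cone_N_closed: assumes "w \<in> carrier G" "\<beta> \<in> pos_roots" "\<beta> \<in> cone (N w)" shows "\<beta> \<in> N w"
  using cone_N[OF assms(1,3)] assms by (simp add: N_iff)

subsection \<open>Bounded joins and meets in the weak order\<close>

lemma act_cone_image: assumes "g \<in> carrier G" "x \<in> cone X" shows "act g x \<in> cone (act g ` X)"
  using assms(2)
proof (induction rule: cone.induct)
  case zero
  then show ?case using cone.zero assms(1) by simp
next
  case (add x \<beta> c)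
  then show ?case using cone.add[of "act g x"] assms(1) by (simp add: act_madd)
qed

lemma nneg_cone: assumes "x \<in> cone X" "\<And>\<beta>. \<beta> \<in> X \<Longrightarrow> nneg \<beta>" shows "nneg x"
  using assms by (induction rule: cone.induct) (auto intro: nneg_madd)

lemma dihedral_factor:
  assumes "y \<in> carrier G" "s \<in> S" "t \<in> S"
  shows "\<exists>ds \<in> lists {s, t}. \<exists>x \<in> carrier G. y = wp ds \<otimes> x \<and> sroot s \<notin> N x \<and> sroot t \<notin> N x"
  using assms(1)
proof (induction "len y" arbitrary: y rule: less_induct)
  case less
  show ?case
  proof (cases "sroot s \<in> N y \<or> sroot t \<in> N y")
    case False
    then show ?thesis using less by (intro bexI[of _ "[]"] bexI[of _ y]) auto
  next
    case True
    then obtain r where r: "r \<in> {s, t}" "sroot r \<in> N y" by blast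
    then have rS: "r \<in> S" using assms by auto
    then obtain ds x where dx: "ds \<in> lists {s, t}" "x \<in> carrier G" "r \<otimes> y = wp ds \<otimes> x"
      "sroot s \<notin> N x" "sroot t \<notin> N x"
      using less(1)[of "r \<otimes> y"] N_descent(3)[OF less(2) rS r(2)] less(2) by auto
    have dS: "wp ds \<in> carrier G" using dx(1) assms by (intro wp_closed) auto
    have "y = r \<otimes> (r \<otimes> y)" using rS less(2) by simp
    also have "\<dots> = wp (r # ds) \<otimes> x" using dx(2,3) dS rS by (simp add: m_assoc)
    finally show ?thesis using dx r by (intro bexI[of _ "r # ds"] bexI[of _ x]) auto
  qed
qed

lemma foldr_srefl_outside: "r \<notin> set ds \<Longrightarrow> foldr srefl ds x r = x r"
  by (induction ds) (auto simp: srefl_other)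

text \<open>The dihedral part \<open>d\<close> of \<open>y\<close> is the required element. Its
  action changes only the coordinates at \<open>s\<close> and \<open>t\<close>; the remaining factor
  \<open>x\<close> has neither letter as a descent, so \<open>inv x\<close> keeps the nonnegative
  vectors of this plane nonnegative. Signs found after applying \<open>inv d\<close> therefore
  persist after \<open>inv y\<close>.\<close>

lemma dihedral_join:
  assumes y: "y \<in> carrier G" and st: "s \<in> S" "t \<in> S" and sy: "sroot s \<in> N y" "sroot t \<in> N y"
  shows "\<exists>d \<in> carrier G. sroot s \<in> N d \<and> sroot t \<in> N d \<and> N d \<subseteq> N y \<and> N d \<subseteq> cone {sroot s, sroot t}"
proof -
  obtain ds x where dx: "ds \<in> lists {s, t}" "x \<in> carrier G" "y = wp ds \<otimes> x"
      "sroot s \<notin> N x" "sroot t \<notin> N x"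
    using dihedral_factor[OF y st] by blast
  define d where "d = wp ds"
  have dsS: "ds \<in> lists S" "rev ds \<in> lists S" using dx(1) st by auto
  have d: "d \<in> carrier G" unfolding d_def using dsS by (intro wp_closed)
  have out: "act (inv d) z r = z r" if "r \<notin> {s, t}" for z r
    using act_wp[OF dsS(2), of z] foldr_srefl_outside[of r "rev ds" z] that dx(1) dsS
    by (auto simp: d_def wp_rev)
  have yi: "act (inv y) z = act (inv x) (act (inv d) z)" for z
    using dx(2,3) d by (simp add: d_def inv_mult_group act_mult)
  have xs: "nneg (act (inv x) (sroot r))" if "r \<in> {s, t}" for r
    using dx(4,5) that st sroot_pos by (auto simp: N_def)
  have xp: "nneg (act (inv x) z)" if "nneg z" "\<And>r. r \<notin> {s, t} \<Longrightarrow> z r = 0" for z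
  proof -
    have "z \<in> cone (sroot ` {s, t})" using that by (intro cone_support) auto
    then have "act (inv x) z \<in> cone (act (inv x) ` sroot ` {s, t})"
      using act_cone_image dx(2) by blast
    then show ?thesis by (rule nneg_cone) (use xs in auto)
  qed
  have "sroot r \<in> N d" if r: "r \<in> {s, t}" for r
  proof (rule ccontr)
    assume "sroot r \<notin> N d"
    then have "nneg (act (inv d) (sroot r))" using r st sroot_pos by (auto simp: N_def)
    then have "nneg (act (inv y) (sroot r))"
      unfolding yi using r by (intro xp) (auto simp: out sroot_def)
    then show False using sy r by (auto simp: N_def)
  qed
  moreover have "\<beta> \<in> N y \<and> \<beta> \<in> cone {sroot s, sroot t}" if b: "\<beta> \<in> N d" for \<beta>
  proof
    have n: "nneg (neg (act (inv d) \<beta>))" "nneg \<beta>" "\<beta> \<in> pos_roots"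
      using b d N_iff[of d] by (auto simp: pos_roots_def)
    have z: "\<beta> r = 0" if "r \<notin> {s, t}" for r
    proof -
      have "0 \<le> neg (act (inv d) \<beta>) r" "0 \<le> \<beta> r" using n unfolding nneg_def by blast+
      then show ?thesis using out[OF that, of \<beta>] by (simp add: neg_def)
    qed
    have "\<beta> \<in> cone (sroot ` {s, t})" using n z by (intro cone_support) auto
    then show "\<beta> \<in> cone {sroot s, sroot t}" by simp
    have "nneg (act (inv x) (neg (act (inv d) \<beta>)))"
      by (rule xp[OF n(1)]) (simp add: neg_def out z)
    then have "nneg (neg (act (inv y) \<beta>))" using yi dx(2) by (simp add: act_neg)
    then show "\<beta> \<in> N y" using n y by (simp add: N_iff)
  qed
  ultimately show ?thesis using d by (intro bexI[of _ d]) auto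
qed

text \<open>Two elements without common descent are compared through a dihedral join of descents.\<close>
lemma join_exists:
  assumes "x \<in> carrier G" "z \<in> carrier G" "y \<in> carrier G" "N x \<subseteq> N y" "N z \<subseteq> N y"
  shows "\<exists>u \<in> carrier G. N x \<subseteq> N u \<and> N z \<subseteq> N u \<and> N u \<subseteq> N y \<and> N u \<subseteq> cone (N x \<union> N z)"
  using assms
proof (induction "len y" arbitrary: x z y rule: less_induct)
  case less
  note IH = less(1) and y = less(4)
  \<comment> \<open>Cancelling the common descent shortens \<open>y\<close>. The cone clause returns
    with the result, since the reflection maps the generators for the shortened elements into
    \<open>N x\<close> and \<open>N z\<close>.\<close>
  have common: "\<exists>u \<in> carrier G. N x \<subseteq> N u \<and> N z \<subseteq> N u \<and> N u \<subseteq> N y \<and> N u \<subseteq> cone (N x \<union> N z)"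
    if xz: "x \<in> carrier G" "z \<in> carrier G" "N x \<subseteq> N y" "N z \<subseteq> N y"
      and s: "s \<in> S" "sroot s \<in> N x" "sroot s \<in> N z" for x z s
  proof -
    have sy: "sroot s \<in> N y" using xz s by blast
    note dx = N_descent[OF xz(1) s(1,2)] and dz = N_descent[OF xz(2) s(1,3)] and dy = N_descent[OF y s(1) sy]
    have c: "s \<otimes> x \<in> carrier G" "s \<otimes> z \<in> carrier G" "s \<otimes> y \<in> carrier G" using xz y s by auto
    have "N (s \<otimes> x) \<subseteq> N (s \<otimes> y)" "N (s \<otimes> z) \<subseteq> N (s \<otimes> y)"
      using N_mono_strip[OF c(1,3) s(1) dx(1) dy(1)] N_mono_strip[OF c(2,3) s(1) dz(1) dy(1)] xz y s by simp_all
    then obtain u where u: "u \<in> carrier G" "N (s \<otimes> x) \<subseteq> N u" "N (s \<otimes> z) \<subseteq> N u" "N u \<subseteq> N (s \<otimes> y)"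
      "N u \<subseteq> cone (N (s \<otimes> x) \<union> N (s \<otimes> z))"
      using IH[OF dy(3) c(1,2,3)] by blast
    have su: "sroot s \<notin> N u" using u dy by blast
    note nu = N_mult[OF u(1) s(1) su]
    have "N (s \<otimes> u) \<subseteq> N y" using nu u(4) dy(2) by blast
    moreover have "N x \<subseteq> N (s \<otimes> u)" "N z \<subseteq> N (s \<otimes> u)" using nu u(2,3) dx(2) dz(2) by blast+
    moreover have "N (s \<otimes> u) \<subseteq> cone (N x \<union> N z)"
    proof
      fix \<beta> assume "\<beta> \<in> N (s \<otimes> u)"
      then consider "\<beta> = sroot s" | \<gamma> where "\<gamma> \<in> N u" "\<beta> = srefl s \<gamma>" using nu by blast
      then show "\<beta> \<in> cone (N x \<union> N z)"
      proof cases
        case 1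
        then show ?thesis using s by (intro cone_base) auto
      next
        case 2
        then have "\<gamma> \<in> cone (N (s \<otimes> x) \<union> N (s \<otimes> z))" using u(5) by blast
        then have "act s \<gamma> \<in> cone (act s ` (N (s \<otimes> x) \<union> N (s \<otimes> z)))" by (rule act_cone_image[OF S_closed[OF s(1)]])
        moreover have "act s = srefl s" using act_gen[OF s(1)] by auto
        ultimately have "\<beta> \<in> cone (srefl s ` (N (s \<otimes> x) \<union> N (s \<otimes> z)))" using 2 by simp
        then show ?thesis
        proof (rule cone_subset)
          have "srefl s ` N (s \<otimes> x) \<subseteq> N x" "srefl s ` N (s \<otimes> z) \<subseteq> N z"
            using equalityD2[OF dx(2)] equalityD2[OF dz(2)] by blast+
          then show "srefl s ` (N (s \<otimes> x) \<union> N (s \<otimes> z)) \<subseteq> cone (N x \<union> N z)"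
            using cone_superset[of "N x \<union> N z"] by (simp add: image_Un) (meson Un_upper1 Un_upper2 order_trans)
        qed
      qed
    qed
    ultimately show ?thesis using u(1) s by (intro bexI[of _ "s \<otimes> u"]) auto
  qed
  show ?case
  proof (cases "x = \<one> \<or> z = \<one>")
    case True
    then show ?thesis
    proof
      assume "x = \<one>"
      then show ?thesis using less(3,6) cone_superset[of "N z"] by (intro bexI[of _ z]) auto
    next
      assume "z = \<one>"
      then show ?thesis using less(2,5) cone_superset[of "N x"] by (intro bexI[of _ x]) auto
    qed
  next
    case False
    then obtain s t where s: "s \<in> S" "sroot s \<in> N x" and t: "t \<in> S" "sroot t \<in> N z"
      using N_nonempty less(2,3) by metis
    then obtain d where d: "d \<in> carrier G" "sroot s \<in> N d" "sroot t \<in> N d" "N d \<subseteq> N y"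
      "N d \<subseteq> cone {sroot s, sroot t}"
      using dihedral_join[OF y s(1) t(1) subsetD[OF less(5) s(2)] subsetD[OF less(6) t(2)]] by blast
    \<comment> \<open>Each of the three joins below has a common descent: \<open>x\<close> and
      \<open>d\<close> share \<open>s\<close>, \<open>z\<close> and \<open>d\<close> share
      \<open>t\<close>, and the two results share \<open>s\<close> through \<open>d\<close>. So
      \<open>common\<close> applies each time with the same \<open>y\<close>.\<close>
    obtain u where u: "u \<in> carrier G" "N x \<subseteq> N u" "N d \<subseteq> N u" "N u \<subseteq> N y" "N u \<subseteq> cone (N x \<union> N d)"
      using common[OF less(2) d(1) less(5) d(4) s d(2)] by blast
    obtain v where v: "v \<in> carrier G" "N z \<subseteq> N v" "N d \<subseteq> N v" "N v \<subseteq> N y" "N v \<subseteq> cone (N z \<union> N d)"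
      using common[OF less(3) d(1) less(6) d(4) t d(3)] by blast
    obtain w where w: "w \<in> carrier G" "N u \<subseteq> N w" "N v \<subseteq> N w" "N w \<subseteq> N y" "N w \<subseteq> cone (N u \<union> N v)"
      using common[OF u(1) v(1) u(4) v(4) s(1) subsetD[OF u(3) d(2)] subsetD[OF v(3) d(2)]] by blast
    have dc: "N d \<subseteq> cone (N x \<union> N z)"
    proof (rule cone_least[OF d(5)])
      show "{sroot s, sroot t} \<subseteq> cone (N x \<union> N z)"
        using s(2) t(2) cone_superset[of "N x \<union> N z"] by auto
    qed
    have "N u \<union> N v \<subseteq> cone (N x \<union> N z)"
    proof -
      have "N x \<union> N d \<subseteq> cone (N x \<union> N z)" "N z \<union> N d \<subseteq> cone (N x \<union> N z)"
        using dc cone_superset[of "N x \<union> N z"] by auto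
      then show ?thesis using cone_least[OF u(5)] cone_least[OF v(5)] by simp
    qed
    then have "N w \<subseteq> cone (N x \<union> N z)" by (rule cone_least[OF w(5)])
    then show ?thesis using w u v by (intro bexI[of _ w]) auto
  qed
qed

text \<open>The cone clause of the binary join gives minimality among all upper bounds, also those
  not below \<open>y\<close>, because the inversion set of an upper bound contains every positive
  root in the cone it spans.\<close>

lemma finite_join_exists:
  assumes "finite F" "F \<subseteq> carrier G" "y \<in> carrier G" "\<forall>f\<in>F. N f \<subseteq> N y"
  shows "\<exists>u \<in> carrier G. (\<forall>f\<in>F. N f \<subseteq> N u) \<and> (\<forall>v \<in> carrier G. (\<forall>f\<in>F. N f \<subseteq> N v) \<longrightarrow> N u \<subseteq> N v)"
  using assms
proof (induction F rule: finite_induct)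
  case empty
  then show ?case by (intro bexI[of _ \<one>]) auto
next
  case (insert f F)
  then obtain u where u: "u \<in> carrier G" "\<forall>f\<in>F. N f \<subseteq> N u"
    "\<forall>v \<in> carrier G. (\<forall>f\<in>F. N f \<subseteq> N v) \<longrightarrow> N u \<subseteq> N v" by auto
  obtain w where w: "w \<in> carrier G" "N f \<subseteq> N w" "N u \<subseteq> N w" "N w \<subseteq> cone (N f \<union> N u)"
    using join_exists[of f u y] insert u by auto
  have "N w \<subseteq> N v" if v: "v \<in> carrier G" "\<forall>f\<in>insert f F. N f \<subseteq> N v" for v
  proof
    fix \<beta> assume b: "\<beta> \<in> N w"
    have "N u \<subseteq> N v" "N f \<subseteq> N v" using u(3) v by auto
    then have "N f \<union> N u \<subseteq> cone (N v)" using cone_superset[of "N v"] by auto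
    from subsetD[OF cone_least[OF w(4) this] b] have "\<beta> \<in> cone (N v)" .
    then show "\<beta> \<in> N v" using cone_N_closed v(1) N_pos b by blast
  qed
  moreover have "\<forall>g\<in>insert f F. N g \<subseteq> N w" using w(2,3) u(2) by (auto dest: subsetD)
  ultimately show ?case using w(1) by blast
qed

lemma finite_below: assumes "y \<in> carrier G" shows "finite {x \<in> carrier G. N x \<subseteq> N y}"
proof (rule inj_on_finite)
  show "inj_on N {x \<in> carrier G. N x \<subseteq> N y}" using N_inj by (auto intro: inj_onI)
  show "N ` {x \<in> carrier G. N x \<subseteq> N y} \<subseteq> Pow (N y)" by auto
  show "finite (Pow (N y))" using finite_N assms by simp
qed

lemma bounded_join_exists:
  assumes "A \<subseteq> carrier G" "y \<in> carrier G" "\<forall>a\<in>A. N a \<subseteq> N y"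
  shows "\<exists>u \<in> carrier G. (\<forall>a\<in>A. N a \<subseteq> N u) \<and> (\<forall>v \<in> carrier G. (\<forall>a\<in>A. N a \<subseteq> N v) \<longrightarrow> N u \<subseteq> N v)"
proof (rule finite_join_exists[OF _ assms])
  show "finite A"
    by (rule finite_subset[OF _ finite_below[OF assms(2)]]) (use assms(1,3) in blast)
qed

text \<open>The meet is the join of all lower bounds, which are bounded by any member of
  \<open>A\<close>.\<close>

lemma meet_exists:
  assumes "A \<subseteq> carrier G" "A \<noteq> {}"
  shows "\<exists>u \<in> carrier G. (\<forall>a\<in>A. N u \<subseteq> N a) \<and> (\<forall>v \<in> carrier G. (\<forall>a\<in>A. N v \<subseteq> N a) \<longrightarrow> N v \<subseteq> N u)"
proof -
  obtain a0 where a0: "a0 \<in> A" using assms by blast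
  define L where "L = {x \<in> carrier G. \<forall>a\<in>A. N x \<subseteq> N a}"
  have "L \<subseteq> carrier G" "a0 \<in> carrier G" "\<forall>x\<in>L. N x \<subseteq> N a0" using a0 assms by (auto simp: L_def)
  from bounded_join_exists[OF this] obtain u where u: "u \<in> carrier G" "\<forall>x\<in>L. N x \<subseteq> N u"
    "\<forall>v\<in>carrier G. (\<forall>x\<in>L. N x \<subseteq> N v) \<longrightarrow> N u \<subseteq> N v" by blast
  have "N u \<subseteq> N a" if "a \<in> A" for a
    using u(3) assms(1) that unfolding L_def by blast
  moreover have "N v \<subseteq> N u" if "v \<in> carrier G" "\<forall>a\<in>A. N v \<subseteq> N a" for v
    using u(2) that unfolding L_def by blast
  ultimately show ?thesis using u(1) by blast
qed

subsection \<open>The Euler form and the projection to sortable elements\<close>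

definition cword :: "'a list \<Rightarrow> bool" where
  "cword ss \<longleftrightarrow> distinct ss \<and> set ss \<subseteq> S"

definition supp :: "'a list \<Rightarrow> ('a \<Rightarrow> real) \<Rightarrow> bool" where
  "supp ss x \<longleftrightarrow> (\<forall>t. t \<notin> set ss \<longrightarrow> x t = 0)"

text \<open>\<open>euler ss \<alpha>\<^sub>r \<alpha>\<^sub>s\<close> is \<open>1\<close> if \<open>r = s\<close>, \<open>bil s r\<close> if \<open>r\<close> comes after \<open>s\<close> in \<open>ss\<close>, and \<open>0\<close> otherwise.\<close>
fun euler :: "'a list \<Rightarrow> ('a \<Rightarrow> real) \<Rightarrow> ('a \<Rightarrow> real) \<Rightarrow> real" where
  "euler [] x y = 0"
| "euler (s # ss) x y = (x s + (\<Sum>r\<in>set ss. bil s r * x r)) * y s + euler ss x y"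

lemma cword_Cons: "cword (s # ss) \<longleftrightarrow> s \<in> S \<and> s \<notin> set ss \<and> cword ss"
  by (auto simp: cword_def)

lemma cword_rotate: "cword (s # ss) \<Longrightarrow> cword (ss @ [s])"
  by (auto simp: cword_def)

lemma supp_rotate: "supp (ss @ [s]) x \<longleftrightarrow> supp (s # ss) x"
  by (auto simp: supp_def)

lemma supp_srefl: "supp (s # ss) x \<Longrightarrow> supp (s # ss) (srefl s x)"
  by (auto simp: supp_def srefl_other)

lemma euler_madd1: "euler ss (madd x c z) y = euler ss x y + c * euler ss z y"
proof (induction ss)
  case (Cons s ss)
  have "(\<Sum>r\<in>set ss. bil s r * madd x c z r) = (\<Sum>r\<in>set ss. bil s r * x r) + c * (\<Sum>r\<in>set ss. bil s r * z r)"
    by (simp add: madd_def sum.distrib sum_distrib_left algebra_simps)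
  then show ?case using Cons by (simp add: madd_def algebra_simps)
qed simp

lemma euler_cong:
  assumes "\<And>t. t \<in> set ss \<Longrightarrow> x t = x' t" "\<And>t. t \<in> set ss \<Longrightarrow> y t = y' t"
  shows "euler ss x y = euler ss x' y'"
  using assms
proof (induction ss)
  case (Cons s ss)
  have "(\<Sum>r\<in>set ss. bil s r * x r) = (\<Sum>r\<in>set ss. bil s r * x' r)"
    by (rule sum.cong) (use Cons(2) in auto)
  moreover have "euler ss x y = euler ss x' y'" using Cons by simp
  ultimately show ?case using Cons(2)[of s] Cons(3)[of s] by simp
qed simp

lemma euler_zero2: "(\<And>t. t \<in> set ss \<Longrightarrow> y t = 0) \<Longrightarrow> euler ss x y = 0"
  by (induction ss) auto

lemma euler_zero1: "(\<And>t. t \<in> set ss \<Longrightarrow> x t = 0) \<Longrightarrow> euler ss x y = 0"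
proof (induction ss)
  case (Cons s ss)
  have "(\<Sum>r\<in>set ss. bil s r * x r) = 0" by (rule sum.neutral) (use Cons(2) in auto)
  then show ?case using Cons by simp
qed simp

lemma euler_snoc:
  "cword (ss @ [s]) \<Longrightarrow>
    euler (ss @ [s]) x y = euler ss x y + x s * (y s + (\<Sum>r\<in>set ss. bil s r * y r))"
proof (induction ss)
  case (Cons a ss)
  have w: "s \<notin> set ss" "a \<notin> set ss" "a \<in> S" "s \<in> S" "cword (ss @ [s])" using Cons(2) by (auto simp: cword_def)
  have "(\<Sum>r\<in>set (ss @ [s]). bil a r * x r) = bil s a * x s + (\<Sum>r\<in>set ss. bil a r * x r)"
    using w by (simp add: bil_sym)
  moreover have "(\<Sum>r\<in>set (a # ss). bil s r * y r) = bil s a * y a + (\<Sum>r\<in>set ss. bil s r * y r)"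
    using w by simp
  ultimately show ?case using Cons(1)[OF w(5)] by (simp add: algebra_simps)
qed simp

lemma pair_supp:
  assumes "cword (s # ss)" "supp (s # ss) x"
  shows "pair s x = 2 * x s + (\<Sum>r\<in>set ss. bil s r * x r)"
proof -
  have "pair s x = (\<Sum>r\<in>set (s # ss). bil s r * x r)"
    unfolding pair_def using assms fin
    by (intro sum.mono_neutral_right) (auto simp: cword_def supp_def)
  then show ?thesis using assms by (simp add: cword_Cons bil_diag)
qed

lemma srefl_at:
  assumes "cword (s # ss)" "supp (s # ss) x"
  shows "srefl s x s = - (x s + (\<Sum>r\<in>set ss. bil s r * x r))"
  by (simp add: srefl_def madd_def sroot_def pair_supp[OF assms])

text \<open>Only the term of \<open>s\<close> is affected. In the original word it is
  \<open>a * y s\<close>, where \<open>a\<close> is \<open>x s\<close> plus the weighted sum over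
  the other letters. After reflection the coordinate of the first vector is \<open>- a\<close>, and
  the factor it meets in the rotated word is \<open>- y s\<close>.\<close>

lemma euler_rotate:
  assumes "cword (s # ss)" "supp (s # ss) x" "supp (s # ss) y"
  shows "euler (ss @ [s]) (srefl s x) (srefl s y) = euler (s # ss) x y"
proof -
  have s: "s \<notin> set ss" using assms by (simp add: cword_Cons)
  have "(\<Sum>r\<in>set ss. bil s r * srefl s y r) = (\<Sum>r\<in>set ss. bil s r * y r)"
    by (rule sum.cong) (use s in \<open>auto intro!: srefl_other\<close>)
  moreover have "euler ss (srefl s x) (srefl s y) = euler ss x y"
    by (rule euler_cong) (use s in \<open>auto intro!: srefl_other\<close>)
  ultimately show ?thesis
    using euler_snoc[OF cword_rotate[OF assms(1)]] srefl_at[OF assms(1,2)] srefl_at[OF assms(1,3)]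
    by simp (metis add_uminus_conv_diff minus_add_distrib minus_mult_left minus_minus mult_minus_left)
qed

lemma euler_sroot2: assumes "s \<notin> set ss"
  shows "euler (s # ss) x (sroot s) = x s + (\<Sum>r\<in>set ss. bil s r * x r)"
proof -
  have "euler ss x (sroot s) = 0" by (rule euler_zero2) (use assms in \<open>auto simp: sroot_def\<close>)
  then show ?thesis by (simp add: sroot_def)
qed

lemma euler_sroot1: assumes "s \<notin> set ss"
  shows "euler (s # ss) (sroot s) y = y s"
proof -
  have "euler ss (sroot s) y = 0" by (rule euler_zero1) (use assms in \<open>auto simp: sroot_def\<close>)
  moreover have "(\<Sum>r\<in>set ss. bil s r * sroot s r) = 0"
    by (rule sum.neutral) (use assms in \<open>auto simp: sroot_def\<close>)
  ultimately show ?thesis by (simp add: sroot_def)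
qed

lemma euler_sym_sum:
  "cword ss \<Longrightarrow> euler ss x y + euler ss y x = (\<Sum>s\<in>set ss. \<Sum>r\<in>set ss. x s * (bil s r * y r))"
proof (induction ss)
  case (Cons s ss)
  have w: "s \<in> S" "s \<notin> set ss" "cword ss" using Cons(2) by (auto simp: cword_Cons)
  have sub: "set ss \<subseteq> S" using w by (simp add: cword_def)
  have "(\<Sum>a\<in>set (s # ss). \<Sum>r\<in>set (s # ss). x a * (bil a r * y r)) =
    x s * (bil s s * y s) + (\<Sum>r\<in>set ss. x s * (bil s r * y r))
     + ((\<Sum>a\<in>set ss. x a * (bil a s * y s)) + (\<Sum>a\<in>set ss. \<Sum>r\<in>set ss. x a * (bil a r * y r)))"
    using w by (simp add: sum.distrib)
  also have "(\<Sum>a\<in>set ss. x a * (bil a s * y s)) = (\<Sum>r\<in>set ss. bil s r * x r) * y s"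
    unfolding sum_distrib_right by (rule sum.cong) (use w sub bil_sym in auto)
  also have "(\<Sum>r\<in>set ss. x s * (bil s r * y r)) = (\<Sum>r\<in>set ss. bil s r * y r) * x s"
    unfolding sum_distrib_right by (rule sum.cong) auto
  finally show ?case using Cons(1)[OF w(3)] by (simp add: bil_diag w algebra_simps)
qed simp

text \<open>\<open>euler\<close> takes half of each diagonal entry and one of each pair of symmetric
  off-diagonal entries, so adding its transpose restores the Coxeter form.\<close>

lemma euler_form:
  assumes "cword ss" "supp ss x" "supp ss y"
  shows "euler ss x y + euler ss y x = form x y"
proof -
  have sub: "set ss \<subseteq> S" using assms by (simp add: cword_def)
  have p: "pair s y = (\<Sum>r\<in>set ss. bil s r * y r)" for s
    unfolding pair_def using fin sub assms(3)
    by (intro sum.mono_neutral_right) (auto simp: supp_def)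
  have "form x y = (\<Sum>s\<in>set ss. x s * pair s y)"
    unfolding form_def using fin sub assms(2)
    by (intro sum.mono_neutral_right) (auto simp: supp_def)
  then show ?thesis unfolding euler_sym_sum[OF assms(1)] p by (simp add: sum_distrib_left)
qed

text \<open>The map \<open>\<pi>\<^sub>\<down>\<close> of Reading and Speyer: greedy sorting in which a letter is dropped for good as
  soon as it is skipped.\<close>
function proj :: "'a list \<Rightarrow> 'a \<Rightarrow> 'a" where
  "proj [] y = \<one>"
| "proj (s # ss) y = (if len (s \<otimes> y) < len y then s \<otimes> proj (ss @ [s]) (s \<otimes> y) else proj ss y)"
  by pat_completeness auto
termination by (relation "measures [\<lambda>(ss, y). len y, \<lambda>(ss, y). length ss]") auto

declare proj.simps(2) [simp del]

lemma proj_desc: "s \<in> S \<Longrightarrow> y \<in> carrier G \<Longrightarrow> sroot s \<in> N y \<Longrightarrow> proj (s # ss) y = s \<otimes> proj (ss @ [s]) (s \<otimes> y)"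
  and proj_skip: "s \<in> S \<Longrightarrow> y \<in> carrier G \<Longrightarrow> sroot s \<notin> N y \<Longrightarrow> proj (s # ss) y = proj ss y"
  using sroot_N by (simp_all add: proj.simps(2))

lemma proj_induct [consumes 2, case_names Nil desc skip]:
  assumes "cword ss" "y \<in> carrier G"
    and Nil: "\<And>y. y \<in> carrier G \<Longrightarrow> P [] y"
    and desc: "\<And>s ss y. \<lbrakk>s \<in> S; cword (s # ss); y \<in> carrier G; sroot s \<in> N y; P (ss @ [s]) (s \<otimes> y)\<rbrakk> \<Longrightarrow> P (s # ss) y"
    and skip: "\<And>s ss y. \<lbrakk>s \<in> S; cword (s # ss); y \<in> carrier G; sroot s \<notin> N y; P ss y\<rbrakk> \<Longrightarrow> P (s # ss) y"
  shows "P ss y"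
  using assms(1,2)
proof (induction ss y rule: proj.induct)
  case (1 y)
  then show ?case using Nil by blast
next
  case (2 s ss y)
  have s: "s \<in> S" "cword ss" using 2(3) by (auto simp: cword_Cons)
  show ?case
  proof (cases "sroot s \<in> N y")
    case True
    then have "P (ss @ [s]) (s \<otimes> y)" using 2(1)[OF _ cword_rotate[OF 2(3)]] 2(4) s sroot_N by simp
    then show ?thesis using desc[OF s(1) 2(3,4) True] by blast
  next
    case False
    then have "P ss y" using 2(2)[OF _ s(2)] 2(4) s sroot_N by simp
    then show ?thesis using skip[OF s(1) 2(3,4) False] by blast
  qed
qed

lemma proj_closed: "cword ss \<Longrightarrow> y \<in> carrier G \<Longrightarrow> proj ss y \<in> carrier G"
proof (induction rule: proj_induct)
  case (desc s ss y)
  then show ?case by (simp add: proj_desc)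
next
  case (skip s ss y)
  then show ?case by (simp add: proj_skip)
qed simp

lemma N_proj: "cword ss \<Longrightarrow> y \<in> carrier G \<Longrightarrow> N (proj ss y) \<subseteq> N y"
proof (induction rule: proj_induct)
  case (desc s ss y)
  have c: "proj (ss @ [s]) (s \<otimes> y) \<in> carrier G" using desc by (intro proj_closed cword_rotate) auto
  have n: "sroot s \<notin> N (s \<otimes> y)" using N_descent(1) desc by blast
  then have "sroot s \<notin> N (proj (ss @ [s]) (s \<otimes> y))" using desc by blast
  then have "N (s \<otimes> proj (ss @ [s]) (s \<otimes> y)) \<subseteq> N (s \<otimes> (s \<otimes> y))"
    using N_mono_strip[OF c m_closed[OF S_closed[OF desc(1)] desc(3)] desc(1) _ n] desc(5) by blast
  then show ?case using desc by (simp add: proj_desc)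
next
  case (skip s ss y)
  then show ?case by (simp add: proj_skip)
qed simp

lemma N_proj_desc:
  assumes "s \<in> S" "cword (s # ss)" "y \<in> carrier G" "sroot s \<in> N y"
  defines "z \<equiv> proj (ss @ [s]) (s \<otimes> y)"
  shows "z \<in> carrier G" "sroot s \<notin> N z" "N (proj (s # ss) y) = insert (sroot s) (srefl s ` N z)"
    "proj (s # ss) y = s \<otimes> z"
proof -
  show c: "z \<in> carrier G" unfolding z_def using assms by (intro proj_closed cword_rotate) auto
  have "N z \<subseteq> N (s \<otimes> y)" unfolding z_def using assms by (intro N_proj cword_rotate) auto
  then show n: "sroot s \<notin> N z" using N_descent(1)[OF assms(3,1,4)] by blast
  show e: "proj (s # ss) y = s \<otimes> z" unfolding z_def using assms by (simp add: proj_desc)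
  show "N (proj (s # ss) y) = insert (sroot s) (srefl s ` N z)" unfolding e using N_mult[OF c assms(1) n] .
qed

section \<open>Sortable elements as fixed points\<close>

text \<open>\<open>sorting_sortable\<close> identifies this with the condition on the blocks of the
  sorting word.\<close>

definition sortable :: "'a list \<Rightarrow> 'a \<Rightarrow> bool" where
  "sortable ss w \<longleftrightarrow> w \<in> carrier G \<and> proj ss w = w"

lemma sortable_closed: "sortable ss w \<Longrightarrow> w \<in> carrier G"
  by (simp add: sortable_def)

lemma sortable_desc:
  assumes "s \<in> S" "cword (s # ss)" "w \<in> carrier G" "sroot s \<in> N w"
  shows "sortable (s # ss) w \<longleftrightarrow> sortable (ss @ [s]) (s \<otimes> w)"
proof -
  note z = N_proj_desc[OF assms]
  have "proj (s # ss) w = w \<longleftrightarrow> proj (ss @ [s]) (s \<otimes> w) = s \<otimes> w"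
    using z(1,4) assms by (metis S_cancel)
  then show ?thesis using assms by (simp add: sortable_def)
qed

lemma sortable_skip:
  assumes "s \<in> S" "w \<in> carrier G" "sroot s \<notin> N w"
  shows "sortable (s # ss) w \<longleftrightarrow> sortable ss w"
  using assms by (simp add: sortable_def proj_skip)

lemma sortable_one: "cword ss \<Longrightarrow> sortable ss \<one>"
proof (induction ss)
  case (Cons s ss)
  then show ?case using sortable_skip[of s \<one> ss] by (simp add: cword_Cons)
qed (simp add: sortable_def)

lemma sortable_proj: "cword ss \<Longrightarrow> y \<in> carrier G \<Longrightarrow> sortable ss (proj ss y)"
proof (induction rule: proj_induct)
  case (Nil y)
  then show ?case by (simp add: sortable_def)
next
  case (desc s ss y)
  note z = N_proj_desc[OF desc(1-4)]
  have "sroot s \<in> N (proj (s # ss) y)" using z(3) by simp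
  then show ?case using sortable_desc[OF desc(1,2)] z(1,4) desc by simp
next
  case (skip s ss y)
  have w: "cword ss" using skip by (simp add: cword_Cons)
  then have "sroot s \<notin> N (proj ss y)" using N_proj[OF w skip(3)] skip by blast
  then show ?case using skip sortable_skip[OF skip(1) proj_closed[OF w skip(3)]] by (simp add: proj_skip)
qed

lemma N_proj_supp: "cword ss \<Longrightarrow> y \<in> carrier G \<Longrightarrow> \<forall>\<beta> \<in> N (proj ss y). supp ss \<beta>"
proof (induction rule: proj_induct)
  case (desc s ss y)
  show ?case
  proof
    fix \<beta> assume "\<beta> \<in> N (proj (s # ss) y)"
    then consider "\<beta> = sroot s" | \<gamma> where "\<gamma> \<in> N (proj (ss @ [s]) (s \<otimes> y))" "\<beta> = srefl s \<gamma>"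
      using N_proj_desc(3)[OF desc(1-4)] by blast
    then show "supp (s # ss) \<beta>"
    proof cases
      case 2
      then show ?thesis using desc(5) supp_rotate supp_srefl by blast
    qed (auto simp: supp_def sroot_def)
  qed
next
  case (skip s ss y)
  then show ?case by (auto simp: proj_skip supp_def)
qed simp

lemma N_sortable_supp: assumes "cword ss" "sortable ss w" "\<beta> \<in> N w" shows "supp ss \<beta>"
  using N_proj_supp[of ss w] assms by (simp add: sortable_def)

section \<open>Signs of the Euler form on inversions\<close>

text \<open>For a descent \<open>s\<close>, the value at \<open>sroot s\<close> is minus the
  coordinate at \<open>s\<close> of \<open>srefl s x\<close>; so the reflected vector is still
  nonnegative, and \<open>euler_rotate\<close> carries the other conditions over. If
  \<open>s\<close> is skipped, the part of \<open>x\<close> along \<open>sroot s\<close> is split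
  off and stays nonnegative because \<open>s\<close> is no descent of \<open>y\<close>. The lemma
  serves to show that a given positive root is not an inversion of \<open>y\<close>.\<close>

lemma proj_nneg:
  "\<lbrakk>cword ss; y \<in> carrier G; nneg x; supp ss x; \<forall>\<gamma> \<in> N (proj ss y). euler ss x \<gamma> \<le> 0\<rbrakk>
    \<Longrightarrow> nneg (act (inv y) x)"
proof (induction arbitrary: x rule: proj_induct)
  case (Nil y)
  then have "x = (\<lambda>_. 0)" by (auto simp: supp_def)
  then show ?case using Nil by simp
next
  case (desc s ss y)
  define z where "z = proj (ss @ [s]) (s \<otimes> y)"
  note z = N_proj_desc[OF desc(1-4), folded z_def]
  have sn: "s \<notin> set ss" using desc by (simp add: cword_Cons)
  have "euler (s # ss) x (sroot s) \<le> 0" using desc(8) z(3) by blast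
  then have "0 \<le> srefl s x s"
    unfolding srefl_at[OF desc(2,7)] euler_sroot2[OF sn] by simp
  then have n: "nneg (srefl s x)"
    using desc(6) unfolding nneg_def by (metis srefl_other)
  have "euler (ss @ [s]) (srefl s x) \<gamma> \<le> 0" if g: "\<gamma> \<in> N z" for \<gamma>
  proof -
    have "supp (ss @ [s]) \<gamma>"
      using N_proj_supp[OF cword_rotate[OF desc(2)], of "s \<otimes> y"] g desc by (simp add: z_def)
    then have sg: "supp (s # ss) (srefl s \<gamma>)" using supp_srefl supp_rotate by blast
    have "euler (ss @ [s]) (srefl s x) \<gamma> = euler (s # ss) x (srefl s \<gamma>)"
      using euler_rotate[OF desc(2,7) sg] srefl_srefl[OF desc(1)] by simp
    moreover have "srefl s \<gamma> \<in> N (proj (s # ss) y)" using z(3) g by blast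
    ultimately show ?thesis using desc(8) by simp
  qed
  moreover have "supp (ss @ [s]) (srefl s x)" using desc(7) supp_srefl supp_rotate by blast
  ultimately have "nneg (act (inv (s \<otimes> y)) (srefl s x))"
    using desc(5)[OF n] unfolding z_def by blast
  moreover have "act (inv (s \<otimes> y)) (srefl s x) = act (inv y) x"
    using desc by (simp add: inv_mult_group act_mult act_gen srefl_srefl)
  ultimately show ?case by simp
next
  case (skip s ss y)
  have w: "cword ss" "s \<notin> set ss" using skip by (auto simp: cword_Cons)
  define x' where "x' = x(s := 0)"
  have "euler ss x' \<gamma> \<le> 0" if g: "\<gamma> \<in> N (proj ss y)" for \<gamma>
  proof -
    have "supp ss \<gamma>" using N_proj_supp[OF w(1) skip(3)] g by blast
    then have "\<gamma> s = 0" using w by (simp add: supp_def)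
    moreover have "euler ss x' \<gamma> = euler ss x \<gamma>" by (rule euler_cong) (use w in \<open>auto simp: x'_def\<close>)
    moreover have "euler (s # ss) x \<gamma> \<le> 0" using skip(8) g proj_skip[OF skip(1,3,4)] by simp
    ultimately show ?thesis by simp
  qed
  moreover have "nneg x'" "supp ss x'" using skip(6,7) by (auto simp: x'_def nneg_def supp_def)
  ultimately have "nneg (act (inv y) x')" using skip(5) by blast
  moreover have "nneg (act (inv y) (sroot s))" using skip sroot_pos by (auto simp: N_def)
  moreover have "x = madd x' (x s) (sroot s)" by (auto simp: x'_def madd_def sroot_def)
  then have "act (inv y) x = madd (act (inv y) x') (x s) (act (inv y) (sroot s))"
    using act_madd[OF inv_closed[OF skip(3)], of x' "x s" "sroot s"] by simp
  ultimately show ?case using skip(6) by (simp add: nneg_madd nneg_def[of x])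
qed

text \<open>\<open>v\<close> arises by dropping the last letter of the greedy word, and
  \<open>\<gamma>\<close> is the inversion which that letter creates. \<open>euler_rotate\<close>
  transports the signs through the recursion. The only new pair is with \<open>sroot s\<close>; its
  two values are minus the coordinate of \<gamma> at \<open>s\<close> before the reflection and plus
  the coordinate after it, both coordinates of positive roots.\<close>

lemma sortable_last:
  "\<lbrakk>cword ss; w \<in> carrier G; sortable ss w; w \<noteq> \<one>\<rbrakk> \<Longrightarrow>
    \<exists>v \<gamma>. sortable ss v \<and> N w = insert \<gamma> (N v) \<and> \<gamma> \<notin> N v \<and>
      (\<forall>\<mu> \<in> N v. euler ss \<gamma> \<mu> \<le> 0 \<and> 0 \<le> euler ss \<mu> \<gamma>)"
proof (induction rule: proj_induct)
  case (Nil y)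
  then show ?case by (simp add: sortable_def)
next
  case (desc s ss w)
  define u where "u = s \<otimes> w"
  have u: "u \<in> carrier G" "w = s \<otimes> u" using desc by (simp_all add: u_def)
  have us: "sortable (ss @ [s]) u" using sortable_desc[OF desc(1-4)] desc(6) by (simp add: u_def)
  have nu: "sroot s \<notin> N u" "N w = insert (sroot s) (srefl s ` N u)"
    using N_descent[OF desc(3,1,4)] by (simp_all add: u_def)
  have sn: "s \<notin> set ss" using desc by (simp add: cword_Cons)
  show ?case
  proof (cases "u = \<one>")
    case True
    then show ?thesis using nu sortable_one[OF desc(2)]
      by (intro exI[of _ \<one>] exI[of _ "sroot s"]) simp
  next
    case False
    then obtain v \<gamma> where v: "sortable (ss @ [s]) v" "N u = insert \<gamma> (N v)" "\<gamma> \<notin> N v"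
      "\<forall>\<mu> \<in> N v. euler (ss @ [s]) \<gamma> \<mu> \<le> 0 \<and> 0 \<le> euler (ss @ [s]) \<mu> \<gamma>"
      using desc(5) us unfolding u_def by blast
    have vG: "v \<in> carrier G" using v(1) by (rule sortable_closed)
    have sv: "sroot s \<notin> N v" using nu v by blast
    note nv = N_mult[OF vG desc(1) sv]
    have gp: "\<gamma> \<in> pos_roots" using v(2) N_pos by blast
    have gs: "srefl s \<gamma> \<noteq> sroot s" by (rule srefl_not_sroot[OF desc(1) gp])
    have gpos: "srefl s \<gamma> \<in> pos_roots" using srefl_pos_root[OF gp desc(1)] v(2) nu by blast
    have supg: "supp (s # ss) \<mu>" if "\<mu> \<in> N u" for \<mu>
      using N_sortable_supp[OF cword_rotate[OF desc(2)] us that] supp_rotate by blast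
    have gnot: "srefl s \<gamma> \<notin> N (s \<otimes> v)"
    proof
      assume "srefl s \<gamma> \<in> N (s \<otimes> v)"
      then obtain \<mu> where "\<mu> \<in> N v" "srefl s \<gamma> = srefl s \<mu>" using nv gs by blast
      then show False using v(3) srefl_srefl[OF desc(1)] by metis
    qed
    have rot: "euler (s # ss) (srefl s a) (srefl s b) = euler (ss @ [s]) a b"
      if "a \<in> N u" "b \<in> N u" for a b
      using euler_rotate[OF desc(2) supp_srefl[OF supg[OF that(1)]] supp_srefl[OF supg[OF that(2)]]]
      by (simp add: srefl_srefl[OF desc(1)])
    have "euler (s # ss) (srefl s \<gamma>) \<mu> \<le> 0 \<and> 0 \<le> euler (s # ss) \<mu> (srefl s \<gamma>)" if m: "\<mu> \<in> N (s \<otimes> v)" for \<mu>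
    proof (cases "\<mu> = sroot s")
      case True
      have sg: "supp (s # ss) (srefl s \<gamma>)" using supp_srefl supg v(2) by blast
      have "srefl s (srefl s \<gamma>) s = \<gamma> s" using srefl_srefl[OF desc(1)] by simp
      then have "euler (s # ss) (srefl s \<gamma>) (sroot s) = - \<gamma> s"
        using srefl_at[OF desc(2) sg] euler_sroot2[OF sn, of "srefl s \<gamma>"] by simp
      moreover have "0 \<le> \<gamma> s" using gp by (simp add: pos_roots_def nneg_def)
      moreover have "0 \<le> srefl s \<gamma> s" using gpos by (simp add: pos_roots_def nneg_def)
      ultimately show ?thesis using True euler_sroot1[OF sn] by simp
    next
      case False
      then obtain \<mu>' where "\<mu>' \<in> N v" "\<mu> = srefl s \<mu>'" using nv m by blast
      then show ?thesis using v(2,4) rot by simp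
    qed
    moreover have "sortable (s # ss) (s \<otimes> v)"
      using sortable_desc[OF desc(1,2), of "s \<otimes> v"] nv v(1) vG desc(1) by simp
    moreover have "N w = insert (srefl s \<gamma>) (N (s \<otimes> v))" using nu nv v(2) by auto
    ultimately show ?thesis using gnot by blast
  qed
next
  case (skip s ss w)
  have w: "cword ss" "s \<notin> set ss" using skip by (auto simp: cword_Cons)
  have sw: "sortable ss w" using skip sortable_skip by blast
  then obtain v \<gamma> where v: "sortable ss v" "N w = insert \<gamma> (N v)" "\<gamma> \<notin> N v"
      "\<forall>\<mu> \<in> N v. euler ss \<gamma> \<mu> \<le> 0 \<and> 0 \<le> euler ss \<mu> \<gamma>" using skip by blast
  have z: "\<mu> s = 0" if "\<mu> \<in> N w" for \<mu>
    using N_sortable_supp[OF w(1) sw that] w by (simp add: supp_def)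
  have "sortable (s # ss) v"
    using sortable_skip[OF skip(1) sortable_closed[OF v(1)]] v skip(4) by blast
  moreover have "\<forall>\<mu> \<in> N v. euler (s # ss) \<gamma> \<mu> \<le> 0 \<and> 0 \<le> euler (s # ss) \<mu> \<gamma>"
  proof
    fix \<mu> assume m: "\<mu> \<in> N v"
    then have "\<mu> s = 0" "\<gamma> s = 0" using z v(2) by blast+
    then show "euler (s # ss) \<gamma> \<mu> \<le> 0 \<and> 0 \<le> euler (s # ss) \<mu> \<gamma>" using v(4) m by simp
  qed
  ultimately show ?case using v by blast
qed

lemma card_N: "w \<in> carrier G \<Longrightarrow> card (N w) = len w"
proof (induction rule: left_induct)
  case (step s w)
  note d = N_descent[OF step(2,1,3)]
  have c: "s \<otimes> w \<in> carrier G" using step by simp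
  have i: "inj_on (srefl s) (N (s \<otimes> w))" using srefl_srefl[OF step(1)] by (metis inj_onI)
  have n: "sroot s \<notin> srefl s ` N (s \<otimes> w)"
    using srefl_not_sroot[OF step(1)] N_pos by (metis imageE)
  have "card (N w) = Suc (card (N (s \<otimes> w)))"
    unfolding d(2) using n finite_N[OF c] i by (simp add: card_image)
  then show ?case using step(4) d(3) len_left_cases[OF step(2,1)] by simp
qed simp

lemma len_mono: "v \<in> carrier G \<Longrightarrow> w \<in> carrier G \<Longrightarrow> N v \<subseteq> N w \<Longrightarrow> len v \<le> len w"
  using card_mono[OF finite_N] card_N by metis

lemma N_gen: assumes "s \<in> S" shows "N s = {sroot s}"
  using N_mult[of \<one> s] assms by simp

text \<open>In every representation \<open>\<delta> = \<tau> + \<kappa> \<gamma>\<close> with \<open>\<tau> \<in> cone X\<close> the coefficient satisfies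
  \<open>\<kappa> \<le> form \<gamma> \<delta> - E \<gamma> \<delta>\<close>, while reflecting \<open>\<delta>\<close> in the cover root \<open>\<gamma>\<close>, which stays inside \<open>N y\<close>,
  produces one with \<open>\<kappa> \<ge> form \<gamma> \<delta>\<close>.\<close>
lemma cover_euler_nonpos:
  assumes ss: "cword ss" and y: "y \<in> carrier G" and p: "p \<in> S"
    and cov: "neg (act y (sroot p)) = \<gamma>" "\<gamma> \<in> N y"
    and Ny: "N y \<subseteq> cone (insert \<gamma> X)"
    and X: "X \<subseteq> pos_roots" "\<And>\<xi>. \<xi> \<in> X \<Longrightarrow> supp ss \<xi> \<and> euler ss \<gamma> \<xi> \<le> 0 \<and> 0 \<le> euler ss \<xi> \<gamma>"
    and \<gamma>: "supp ss \<gamma>" "\<gamma> s = 0"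
    and \<delta>: "\<delta> \<in> N y" "\<delta> \<noteq> \<gamma>" "0 < \<delta> s"
  shows "euler ss \<gamma> \<delta> \<le> 0"
proof (rule ccontr)
  assume "\<not> ?thesis"
  then have e: "0 < euler ss \<gamma> \<delta>" by simp
  have \<gamma>r: "\<gamma> \<in> roots" "nneg \<gamma>" using N_pos[OF cov(2)] by (auto simp: pos_roots_def)
  have ay: "act y (sroot p) = neg \<gamma>" using cov(1) by (metis neg_neg)
  have \<tau>0: "0 \<le> euler ss \<tau> \<gamma> \<and> supp ss \<tau> \<and> nneg \<tau>" if "\<tau> \<in> cone X" for \<tau>
    using that
  proof (induction rule: cone.induct)
    case zero
    then show ?case by (simp add: euler_zero1 supp_def)
  next
    case (add \<tau> \<xi> c)
    have "nneg \<xi>" using X(1) add(2) by (auto simp: pos_roots_def)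
    then show ?case using X(2)[OF add(2)] add
      by (simp add: euler_madd1 nneg_madd) (simp add: supp_def madd_def)
  qed
  define \<rho> where "\<rho> = madd \<delta> (- form \<gamma> \<delta>) \<gamma>"
  define \<eta> where "\<eta> = act (inv y) \<delta>"
  have \<eta>r: "\<eta> \<in> roots" "nneg (neg \<eta>)"
    using \<delta>(1) y N_iff[OF y] act_roots[OF inv_closed[OF y]] by (auto simp: \<eta>_def pos_roots_def)
  have y\<eta>: "act y \<eta> = \<delta>" using y by (simp add: \<eta>_def)
  have "act y (srefl p \<eta>) = madd \<delta> (- pair p \<eta>) (neg \<gamma>)"
    unfolding srefl_def using act_madd[OF y] y\<eta> ay by simp
  moreover have "pair p \<eta> = - form \<gamma> \<delta>"
  proof -
    have "pair p \<eta> = form (act y (sroot p)) (act y \<eta>)" using act_form[OF y] form_sroot[OF p] by simp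
    also have "\<dots> = - form \<gamma> \<delta>" unfolding ay y\<eta> by (simp add: form_def neg_def sum_negf)
    finally show ?thesis .
  qed
  ultimately have \<rho>: "act y (srefl p \<eta>) = \<rho>" by (simp add: \<rho>_def madd_def neg_def)
  \<comment> \<open>Among negative roots, \<open>p\<close> changes the sign of
    \<open>neg (sroot p)\<close> alone, so \<open>inv y\<close> still makes \<open>\<rho>\<close>
    negative. That \<open>\<rho>\<close> itself is positive follows from its coordinate at
    \<open>s\<close>, where \<open>\<gamma>\<close> vanishes.\<close>
  have "neg \<eta> \<noteq> sroot p"
  proof
    assume "neg \<eta> = sroot p"
    then have "neg (act y \<eta>) = neg \<gamma>" using act_neg[OF y, of \<eta>] ay by simp
    then show False using y\<eta> \<delta>(2) by (metis neg_neg)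
  qed
  then have "srefl p (neg \<eta>) \<in> pos_roots"
    using srefl_pos_root[OF _ p] \<eta>r neg_roots[OF \<eta>r(1)] by (simp add: pos_roots_def)
  then have neg: "nneg (neg (srefl p \<eta>))"
    using act_neg[OF S_closed[OF p], of \<eta>] act_gen[OF p] by (simp add: pos_roots_def)
  have \<rho>r: "\<rho> \<in> roots"
    using act_roots[OF y act_roots[OF S_closed[OF p] \<eta>r(1)]] \<rho> act_gen[OF p] by simp
  have "\<rho> s = \<delta> s" using \<gamma>(2) by (simp add: \<rho>_def madd_def)
  then have "\<not> nneg (neg \<rho>)" using \<delta>(3) by (auto simp: nneg_def neg_def not_le intro!: exI[of _ s])
  then have "\<rho> \<in> pos_roots" using roots_cases[OF \<rho>r] \<rho>r by (simp add: pos_roots_def)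
  moreover have "act (inv y) \<rho> = srefl p \<eta>" using \<rho> y by (metis act_inv_cancel)
  ultimately have \<rho>N: "\<rho> \<in> N y" using neg y by (simp add: N_iff)
  then obtain \<tau>' \<kappa>' where t': "\<tau>' \<in> cone X" "0 \<le> \<kappa>'" "\<rho> = madd \<tau>' \<kappa>' \<gamma>"
    using cone_insert Ny by blast
  define K where "K \<kappa> \<longleftrightarrow> (\<exists>\<tau> \<in> cone X. \<delta> = madd \<tau> \<kappa> \<gamma>)" for \<kappa>
  have "euler ss \<gamma> \<gamma> + euler ss \<gamma> \<gamma> = 2" using euler_form[OF ss \<gamma>(1) \<gamma>(1)] form_root[OF \<gamma>r(1)] by simp
  then have g1: "euler ss \<gamma> \<gamma> = 1" by simp
  have step: "K (\<kappa>' + form \<gamma> \<delta>)"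
    unfolding K_def using t' by (intro bexI[of _ \<tau>']) (auto simp: \<rho>_def madd_def fun_eq_iff algebra_simps)
  \<comment> \<open>\<open>form \<gamma> \<delta>\<close> is the sum of both Euler values, and the
    value at (\<delta>, \<gamma>) is at least \<kappa>, since \<gamma> pairs to 1 with itself and
    nonnegatively with the cone part.\<close>
  have bound: "\<kappa> + euler ss \<gamma> \<delta> \<le> form \<gamma> \<delta>" if k: "K \<kappa>" for \<kappa>
  proof -
    obtain \<tau> where t: "\<tau> \<in> cone X" "\<delta> = madd \<tau> \<kappa> \<gamma>" using k unfolding K_def by blast
    have s\<delta>: "supp ss \<delta>" using t \<tau>0[OF t(1)] \<gamma>(1) by (simp add: supp_def madd_def)
    have "form \<gamma> \<delta> = euler ss \<gamma> \<delta> + euler ss \<delta> \<gamma>" using euler_form[OF ss \<gamma>(1) s\<delta>] by simp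
    moreover have "euler ss \<delta> \<gamma> = euler ss \<tau> \<gamma> + \<kappa>" unfolding t(2) euler_madd1 g1 by simp
    ultimately show ?thesis using \<tau>0[OF t(1)] by simp
  qed
  from bound[OF step] show False using t'(2) e by simp
qed

section \<open>The projection as the largest sortable element below\<close>

text \<open>All generators are nonnegative, so nothing can cancel a contribution of
  \<open>sroot s\<close> to the coordinate at \<open>s\<close>.\<close>

lemma cone_insert_coord:
  assumes "x \<in> cone (insert (sroot s) X)" "x s = 0" "\<And>\<xi>. \<xi> \<in> X \<Longrightarrow> nneg \<xi>"
  shows "x \<in> cone X"
proof -
  obtain \<tau> \<kappa> where t: "\<tau> \<in> cone X" "0 \<le> \<kappa>" "x = madd \<tau> \<kappa> (sroot s)" using cone_insert assms(1) by blast
  have "nneg \<tau>" using nneg_cone[OF t(1)] assms(3) by blast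
  then have "0 \<le> \<tau> s" by (simp add: nneg_def)
  moreover have "\<tau> s + \<kappa> = 0" using assms(2) t(3) by (simp add: madd_def sroot_def)
  ultimately have "\<kappa> = 0" using t(2) by simp
  then show ?thesis using t by (simp add: madd_def)
qed

text \<open>Here \<open>y\<close> plays the role of the join of \<open>s\<close> and
  \<open>v\<close>, expressed by the cone bound, and only the last inversion \<gamma> of
  \<open>v\<close> is still to be found in the projection. If it were missing, it would be a cover
  root of \<open>y\<close> with nonpositive Euler values against the whole projection, and
  \<open>proj_nneg\<close> would deny that it is an inversion of \<open>y\<close>.\<close>

lemma sortable_join_step:
  assumes s: "s \<in> S" "cword (s # ss)" and v: "sortable ss v" "N v = insert \<gamma> (N w)" "\<gamma> \<notin> N w"
      "\<forall>\<mu> \<in> N w. euler ss \<gamma> \<mu> \<le> 0 \<and> 0 \<le> euler ss \<mu> \<gamma>"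
    and y: "y \<in> carrier G" "sroot s \<in> N y" "N v \<subseteq> N y" "N y \<subseteq> cone (insert (sroot s) (N v))"
    and w: "N w \<subseteq> N (proj (s # ss) y)"
  shows "\<gamma> \<in> N (proj (s # ss) y)"
proof (rule ccontr)
  define z where "z = proj (s # ss) y"
  assume "\<gamma> \<notin> N (proj (s # ss) y)"
  then have gz: "\<gamma> \<notin> N z" by (simp add: z_def)
  have ws: "cword ss" "s \<notin> set ss" "set ss \<subseteq> S" using s by (auto simp: cword_def)
  have zG: "z \<in> carrier G" unfolding z_def using s y by (intro proj_closed)
  have zy: "N z \<subseteq> N y" unfolding z_def using s y by (intro N_proj)
  have sz: "sroot s \<in> N z" using N_proj_desc(3)[OF s y(1,2)] by (simp add: z_def)
  have vp: "supp ss \<beta>" "\<beta> s = 0" "nneg \<beta>" if "\<beta> \<in> N v" for \<beta>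
  proof -
    show "supp ss \<beta>" using N_sortable_supp[OF ws(1) v(1) that] .
    then show "\<beta> s = 0" using ws by (simp add: supp_def)
    show "nneg \<beta>" using N_pos[OF that] by (simp add: pos_roots_def)
  qed
  have supps: "supp (s # ss) \<beta>" if "supp ss \<beta>" for \<beta> using that by (simp add: supp_def)
  have gv: "\<gamma> \<in> N v" "\<gamma> \<in> N y" using v(2) y(3) by auto
  note gp = vp[OF gv(1)]
  have eul: "euler (s # ss) a b = euler ss a b" if "b s = 0" for a b using that by simp
  have gs: "euler (s # ss) \<gamma> (sroot s) \<le> 0"
  proof -
    have "(\<Sum>r\<in>set ss. bil s r * \<gamma> r) \<le> 0"
    proof (rule sum_nonpos)
      fix r assume "r \<in> set ss"
      then have "bil s r \<le> 0" "0 \<le> \<gamma> r" using bil_nonpos[OF s(1), of r] ws gp(3) by (auto simp: nneg_def)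
      then show "bil s r * \<gamma> r \<le> 0" by (simp add: mult_nonpos_nonneg)
    qed
    then show ?thesis unfolding euler_sroot2[OF ws(2)] using gp by simp
  qed
  obtain p where p: "p \<in> S" "neg (act y (sroot p)) \<in> N y - N z"
    using cover_exists[OF zG y(1) zy] gz gv by blast
  define \<delta> where "\<delta> = neg (act y (sroot p))"
  have \<delta>: "\<delta> \<in> N y" "\<delta> \<notin> N z" using p by (auto simp: \<delta>_def)
  \<comment> \<open>Any other cover root could be removed from \<open>y\<close> without losing
    \<open>sroot s\<close> or \<open>N v\<close>. The cone bound would then put all of
    \<open>N y\<close>, including the removed root, below the smaller element.\<close>
  have "\<delta> = \<gamma>"
  proof (rule ccontr)
    assume ne: "\<delta> \<noteq> \<gamma>"
    have pG: "y \<otimes> p \<in> carrier G" using y p by simp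
    have "N (y \<otimes> p) = N y - {\<delta>}" using N_right_mult[OF y(1) p(1)] p(2) by (simp add: \<delta>_def)
    moreover have "insert (sroot s) (N v) \<subseteq> N y - {\<delta>}"
      using y(2,3) sz w \<delta> ne v(2) by (auto simp: z_def)
    ultimately have "insert (sroot s) (N v) \<subseteq> N (y \<otimes> p)" by metis
    then have "insert (sroot s) (N v) \<subseteq> cone (N (y \<otimes> p))" by (rule order_trans[OF _ cone_superset])
    then have "N y \<subseteq> cone (N (y \<otimes> p))" by (rule cone_least[OF y(4)])
    then have "\<delta> \<in> cone (N (y \<otimes> p))" using \<delta>(1) by (rule subsetD)
    then have "\<delta> \<in> N (y \<otimes> p)" using cone_N_closed[OF pG N_pos[OF \<delta>(1)]] by simp
    then show False using \<open>N (y \<otimes> p) = N y - {\<delta>}\<close> by simp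
  qed
  then have cov: "neg (act y (sroot p)) = \<gamma>" by (simp add: \<delta>_def)
  define X where "X = insert (sroot s) (N w)"
  have Ny: "N y \<subseteq> cone (insert \<gamma> X)" using y(4) unfolding X_def v(2) by (simp add: insert_commute)
  have Xp: "X \<subseteq> pos_roots" unfolding X_def using sroot_pos[OF s(1)] N_pos by auto
  have Xe: "supp (s # ss) \<xi> \<and> euler (s # ss) \<gamma> \<xi> \<le> 0 \<and> 0 \<le> euler (s # ss) \<xi> \<gamma>" if "\<xi> \<in> X" for \<xi>
  proof (cases "\<xi> = sroot s")
    case True
    then show ?thesis using gs gp(2) euler_sroot1[OF ws(2), of \<gamma>] by (simp add: supp_def sroot_def)
  next
    case False
    then have "\<xi> \<in> N w" using that by (simp add: X_def)
    then show ?thesis using v(2,4) vp[of \<xi>] supps[of \<xi>] eul[of \<xi>] eul[of \<gamma>] gp by simp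
  qed
  \<comment> \<open>A root without coordinate at \<open>s\<close> falls back into
    \<open>N v\<close>, hence into \<open>N w\<close>, where the sign is known. A positive
    coordinate is the case of \<open>cover_euler_nonpos\<close>.\<close>
  have "euler (s # ss) \<gamma> \<beta> \<le> 0" if b: "\<beta> \<in> N z" for \<beta>
  proof (cases "\<beta> s = 0")
    case True
    have "\<beta> \<in> cone (insert (sroot s) (N v))" using subsetD[OF y(4) subsetD[OF zy b]] .
    then have "\<beta> \<in> cone (N v)" by (rule cone_insert_coord) (use True vp(3) in auto)
    then have "\<beta> \<in> N v" using cone_N_closed[OF sortable_closed[OF v(1)] N_pos[OF b]] by simp
    moreover have "\<beta> \<noteq> \<gamma>" using b gz by metis
    ultimately have "\<beta> \<in> N w" using v(2) by simp
    then show ?thesis using v(4) eul[of \<beta>] True by simp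
  next
    case False
    then have "0 < \<beta> s" using N_pos[OF b] by (simp add: pos_roots_def nneg_def order_less_le)
    moreover have "\<beta> \<noteq> \<gamma>" "\<beta> \<in> N y" using b gz zy by auto
    ultimately show ?thesis
      using cover_euler_nonpos[OF s(2) y(1) p(1) cov gv(2) Ny Xp Xe supps[OF gp(1)] gp(2)] by blast
  qed
  then have "nneg (act (inv y) \<gamma>)"
    using proj_nneg[OF s(2) y(1) gp(3) supps[OF gp(1)]] by (simp add: z_def)
  then show False using gv(2) by (simp add: N_def)
qed

text \<open>Three inductions are nested: on the length of \<open>y\<close> for stripping a common
  descent, on the word for a letter that \<open>y\<close> skips, and on the number of inversions
  when \<open>s\<close> is a descent of \<open>y\<close> but not of \<open>v\<close>.\<close>

theorem proj_greatest:
  assumes "y \<in> carrier G" "cword ss" "sortable ss v" "N v \<subseteq> N y"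
  shows "N v \<subseteq> N (proj ss y)"
  using assms
proof (induction "len y" arbitrary: y ss v rule: less_induct)
  case less
  note outer = less(1) and y = less(2)
  show ?case using less(3-5)
  proof (induction ss arbitrary: v)
    case Nil
    then show ?case by (simp add: sortable_def)
  next
    case (Cons s ss)
    have s: "s \<in> S" "cword (s # ss)" "cword ss" using Cons(2) by (auto simp: cword_Cons)
    have vG: "v \<in> carrier G" using Cons(3) by (rule sortable_closed)
    show ?case
    proof (cases "sroot s \<in> N y")
      case False
      then have "sortable ss v" using sortable_skip[OF s(1) vG] Cons(3,4) by blast
      then show ?thesis using Cons(1)[OF s(3)] Cons(4) proj_skip[OF s(1) y False] by simp
    next
      case True
      \<comment> \<open>\<open>y'\<close> ranges over all elements below \<open>y\<close>, since the
        innermost induction replaces the upper element by joins.\<close>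
      have strip: "N x \<subseteq> N (proj (s # ss) y')"
        if y': "y' \<in> carrier G" "N y' \<subseteq> N y" and x: "sortable (s # ss) x" "sroot s \<in> N x" "N x \<subseteq> N y'" for x y'
      proof -
        have sy: "sroot s \<in> N y'" using x by blast
        have xG: "x \<in> carrier G" using x(1) by (rule sortable_closed)
        have c: "s \<otimes> x \<in> carrier G" "s \<otimes> y' \<in> carrier G" using s(1) xG y' by auto
        note dx = N_descent[OF xG s(1) x(2)] and dy = N_descent[OF y'(1) s(1) sy]
        have l: "len (s \<otimes> y') < len y" using dy(3) len_mono[OF y'(1) y y'(2)] by simp
        have "N (s \<otimes> x) \<subseteq> N (s \<otimes> y')" using N_mono_strip[OF c s(1) dx(1) dy(1)] x(3) s(1) xG y'(1) by simp
        moreover have "sortable (ss @ [s]) (s \<otimes> x)" using sortable_desc[OF s(1,2) xG x(2)] x(1) by simp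
        ultimately have "N (s \<otimes> x) \<subseteq> N (proj (ss @ [s]) (s \<otimes> y'))"
          using outer[OF l c(2) cword_rotate[OF s(2)]] by blast
        then show ?thesis unfolding N_proj_desc(3)[OF s(1,2) y'(1) sy] dx(2) by blast
      qed
      show ?thesis
      proof (cases "sroot s \<in> N v")
        case True
        then show ?thesis using strip[OF y subset_refl Cons(3)] Cons(4) by blast
      next
        case False
        then have "sortable ss v" using sortable_skip[OF s(1) vG] Cons(3) by blast
        moreover have "N x \<subseteq> N (proj (s # ss) y')"
          if "sortable ss x" "y' \<in> carrier G" "N y' \<subseteq> N y" "sroot s \<in> N y'" "N x \<subseteq> N y'" for x y'
          using that
        proof (induction "card (N x)" arbitrary: x y' rule: less_induct)
          case less
          note IH = less(1) and sx = less(2) and y' = less(3-6)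
          have xG: "x \<in> carrier G" using sx by (rule sortable_closed)
          show ?case
          proof (cases "x = \<one>")
            case False
            then obtain w \<gamma> where w: "sortable ss w" "N x = insert \<gamma> (N w)" "\<gamma> \<notin> N w"
              "\<forall>\<mu> \<in> N w. euler ss \<gamma> \<mu> \<le> 0 \<and> 0 \<le> euler ss \<mu> \<gamma>"
              using sortable_last[OF s(3) xG sx] by blast
            have wG: "w \<in> carrier G" using w(1) by (rule sortable_closed)
            \<comment> \<open>The join of \<open>s\<close> and \<open>x\<close> comes with the cone
              bound that \<open>sortable_join_step\<close> asks for; \<open>y'\<close> itself need
              not satisfy it.\<close>
            obtain u where u: "u \<in> carrier G" "N s \<subseteq> N u" "N x \<subseteq> N u" "N u \<subseteq> N y'" "N u \<subseteq> cone (N s \<union> N x)"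
              using join_exists[OF S_closed[OF s(1)] xG y'(1)] y' N_gen[OF s(1)] by auto
            have u': "sroot s \<in> N u" "N u \<subseteq> cone (insert (sroot s) (N x))"
              using u N_gen[OF s(1)] by auto
            have "card (N w) < card (N x)" unfolding w(2) using finite_N[OF wG] w(3) by simp
            then have "N w \<subseteq> N (proj (s # ss) u)"
              using IH[OF _ w(1) u(1) _ u'(1)] u(3,4) y'(2) w(2) by blast
            then have "N x \<subseteq> N (proj (s # ss) u)"
              using sortable_join_step[OF s(1,2) sx w(2-4) u(1) u'(1) u(3) u'(2)] w(2) by simp
            \<comment> \<open>The projection of \<open>u\<close> is sortable and does have the
              descent \<open>s\<close>, so it can be compared with \<open>y'\<close> by
              stripping.\<close>
            moreover have "N (proj (s # ss) u) \<subseteq> N (proj (s # ss) y')"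
            proof (rule strip[OF y'(1,2) sortable_proj[OF s(2) u(1)]])
              show "sroot s \<in> N (proj (s # ss) u)" using N_proj_desc(3)[OF s(1,2) u(1) u'(1)] by blast
              show "N (proj (s # ss) u) \<subseteq> N y'" using N_proj[OF s(2) u(1)] u(4) by blast
            qed
            ultimately show ?thesis by blast
          qed simp
        qed
        ultimately show ?thesis using Cons(4) y True by blast
      qed
    qed
  qed
qed

section \<open>Meets and joins of sortable elements\<close>

text \<open>Inversions other than the last one, \<gamma>, come from the smaller sortable element by
  monotonicity of the projection, a consequence of \<open>proj_greatest\<close>. If \<gamma> itself
  were lost, all inversions of \<open>proj ss a\<close> would lie in \<open>N v\<close>, where
  \<gamma> has nonpositive Euler values; then \<open>proj_nneg\<close> shows that \<gamma> is no
  inversion of \<open>a\<close>.\<close>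

lemma sortable_parabolic:
  assumes s: "s \<in> S" "cword (s # ss)"
  shows "\<lbrakk>a \<in> carrier G; sortable (s # ss) a; \<beta> \<in> N a; \<beta> s = 0\<rbrakk> \<Longrightarrow> \<beta> \<in> N (proj ss a)"
proof (induction "card (N a)" arbitrary: a \<beta> rule: less_induct)
  case less
  note IH = less(1) and a = less(2,3)
  have w: "cword ss" "s \<notin> set ss" using s(2) by (auto simp: cword_Cons)
  have "a \<noteq> \<one>" using less(4) by auto
  then obtain v \<gamma> where v: "sortable (s # ss) v" "N a = insert \<gamma> (N v)" "\<gamma> \<notin> N v"
    "\<forall>\<mu> \<in> N v. euler (s # ss) \<gamma> \<mu> \<le> 0 \<and> 0 \<le> euler (s # ss) \<mu> \<gamma>"
    using sortable_last[OF s(2) a] by blast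
  have vG: "v \<in> carrier G" using v(1) by (rule sortable_closed)
  have pv: "proj ss v \<in> carrier G" using proj_closed w vG by blast
  have "N (proj ss v) \<subseteq> N a" using N_proj[OF w(1) vG] v(2) by blast
  then have vz: "N (proj ss v) \<subseteq> N (proj ss a)"
    using proj_greatest[OF a(1) w(1) sortable_proj[OF w(1) vG]] by blast
  show ?case
  proof (cases "\<beta> = \<gamma>")
    case False
    have "card (N v) < card (N a)" unfolding v(2) using finite_N[OF vG] v(3) by simp
    then have "\<beta> \<in> N (proj ss v)" using IH[OF _ vG v(1), of \<beta>] less(4,5) v(2) False by simp
    then show ?thesis using vz by blast
  next
    case True
    show ?thesis
    proof (rule ccontr)
      assume n: "\<beta> \<notin> N (proj ss a)"
      have "euler ss \<gamma> \<mu> \<le> 0" if m: "\<mu> \<in> N (proj ss a)" for \<mu>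
      proof -
        have "\<mu> s = 0" using N_proj_supp[OF w(1) a(1)] m w(2) by (auto simp: supp_def)
        moreover have "\<mu> \<in> N a" using m N_proj[OF w(1) a(1)] by blast
        moreover have "\<mu> \<noteq> \<gamma>" using m n True by metis
        ultimately show ?thesis using v(2,4) by auto
      qed
      moreover have "supp ss \<gamma>"
        using N_sortable_supp[OF s(2) a(2), of \<gamma>] v(2) less(5) True by (auto simp: supp_def)
      moreover have "nneg \<gamma>" using N_pos[OF less(4)] True by (simp add: pos_roots_def)
      ultimately have "nneg (act (inv a) \<gamma>)" using proj_nneg[OF w(1) a(1)] by blast
      then show False using less(4) True by (simp add: N_def)
    qed
  qed
qed

theorem sortable_meet:
  "\<lbrakk>cword ss; u \<in> carrier G; A \<noteq> {}; \<forall>a\<in>A. sortable ss a; \<forall>a\<in>A. N u \<subseteq> N a;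
    \<forall>x \<in> carrier G. (\<forall>a\<in>A. N x \<subseteq> N a) \<longrightarrow> N x \<subseteq> N u\<rbrakk> \<Longrightarrow> sortable ss u"
proof (induction arbitrary: A rule: proj_induct)
  case (Nil u)
  then obtain a where a: "a \<in> A" "sortable [] a" by blast
  then have "a = \<one>" by (simp add: sortable_def)
  then have "N u = {}" using Nil(4) a(1) N_one by blast
  then have "u = \<one>" using N_inj[OF Nil(1) one_closed] by simp
  then show ?case by (simp add: sortable_def)
next
  case (desc s ss u)
  have AG: "a \<in> carrier G" if "a \<in> A" for a using desc(7) that sortable_closed by blast
  have sA: "sroot s \<in> N a" if "a \<in> A" for a using desc(4,8) that by blast
  have "sortable (ss @ [s]) (s \<otimes> u)"
  proof (rule desc(5)[of "(\<otimes>) s ` A"])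
    show "(\<otimes>) s ` A \<noteq> {}" using desc by simp
    show "\<forall>a\<in>(\<otimes>) s ` A. sortable (ss @ [s]) a"
      using desc(7) sortable_desc[OF desc(1,2) AG sA] by blast
    show "\<forall>a\<in>(\<otimes>) s ` A. N (s \<otimes> u) \<subseteq> N a"
    proof (clarify)
      fix a \<beta> assume a: "a \<in> A" "\<beta> \<in> N (s \<otimes> u)"
      have "N (s \<otimes> u) \<subseteq> N (s \<otimes> a)"
        using N_mono_strip[of "s \<otimes> u" "s \<otimes> a" s] N_descent(1)[OF desc(3,1,4)]
          N_descent(1)[OF AG[OF a(1)] desc(1) sA[OF a(1)]] desc(1,3,8) AG[OF a(1)] a(1) by simp
      then show "\<beta> \<in> N (s \<otimes> a)" using a by blast
    qed
    show "\<forall>x\<in>carrier G. (\<forall>a\<in>(\<otimes>) s ` A. N x \<subseteq> N a) \<longrightarrow> N x \<subseteq> N (s \<otimes> u)"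
    proof (intro ballI impI)
      fix x assume x: "x \<in> carrier G" "\<forall>a\<in>(\<otimes>) s ` A. N x \<subseteq> N a"
      obtain a0 where a0: "a0 \<in> A" using desc(6) by blast
      have nx: "sroot s \<notin> N x" using N_descent(1)[OF AG[OF a0] desc(1) sA[OF a0]] x(2) a0 by blast
      have "N (s \<otimes> x) \<subseteq> N a" if a: "a \<in> A" for a
      proof -
        have "N x \<subseteq> N (s \<otimes> a)" using x a by blast
        then show ?thesis
          using N_mono_strip[of x "s \<otimes> a" s] nx N_descent(1)[OF AG[OF a] desc(1) sA[OF a]] desc(1) AG[OF a] x(1)
          by simp
      qed
      then have "N (s \<otimes> x) \<subseteq> N u" using desc(1,9) x(1) by simp
      then show "N x \<subseteq> N (s \<otimes> u)"
        using N_mono_strip[of x "s \<otimes> u" s] nx N_descent(1)[OF desc(3,1,4)] desc(1,3) x(1) by simp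
    qed
  qed
  then show ?case using sortable_desc[OF desc(1-4)] by simp
next
  case (skip s ss u)
  have w: "cword ss" "s \<notin> set ss" using skip(2) by (auto simp: cword_Cons)
  have AG: "a \<in> carrier G" if "a \<in> A" for a using skip(7) that sortable_closed by blast
  \<comment> \<open>Otherwise \<open>s\<close> would be a lower bound of \<open>A\<close>, and
    \<open>sroot s\<close> would be an inversion of the meet.\<close>
  have "\<exists>a\<in>A. sroot s \<notin> N a"
    using skip(9)[rule_format, OF S_closed[OF skip(1)]] N_gen[OF skip(1)] skip(4) by auto
  then obtain a0 where a0: "a0 \<in> A" "sroot s \<notin> N a0" by blast
  \<comment> \<open>A single element without \<open>s\<close> suffices: its inversions vanish at
    \<open>s\<close>, and so do those of \<open>u\<close> below it. This is why
    \<open>sortable_parabolic\<close> loses nothing of \<open>N u\<close>.\<close>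
  have "sortable ss a0" using sortable_skip[OF skip(1) AG[OF a0(1)] a0(2)] skip(7) a0(1) by blast
  then have us: "\<beta> s = 0" if "\<beta> \<in> N u" for \<beta>
    using N_sortable_supp[OF w(1), of a0 \<beta>] skip(8) a0(1) that w(2) by (auto simp: supp_def)
  have "sortable ss u"
  proof (rule skip(5)[of "proj ss ` A"])
    show "proj ss ` A \<noteq> {}" using skip by simp
    show "\<forall>a\<in>proj ss ` A. sortable ss a" using sortable_proj[OF w(1)] AG by blast
    show "\<forall>a\<in>proj ss ` A. N u \<subseteq> N a"
      using sortable_parabolic[OF skip(1,2) AG] skip(7,8) us by blast
    show "\<forall>x\<in>carrier G. (\<forall>a\<in>proj ss ` A. N x \<subseteq> N a) \<longrightarrow> N x \<subseteq> N u"
    proof (intro ballI impI)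
      fix x assume x: "x \<in> carrier G" "\<forall>a\<in>proj ss ` A. N x \<subseteq> N a"
      then have "\<forall>a\<in>A. N x \<subseteq> N a" using N_proj[OF w(1) AG] by blast
      then show "N x \<subseteq> N u" using skip(9) x by blast
    qed
  qed
  then show ?case using sortable_skip[OF skip(1,3,4)] by simp
qed

theorem sortable_join:
  assumes "cword ss" "u \<in> carrier G" "\<forall>a\<in>A. sortable ss a" "\<forall>a\<in>A. N a \<subseteq> N u"
    and "\<forall>x \<in> carrier G. (\<forall>a\<in>A. N a \<subseteq> N x) \<longrightarrow> N u \<subseteq> N x"
  shows "sortable ss u"
proof -
  have "\<forall>a\<in>A. N a \<subseteq> N (proj ss u)" using proj_greatest[OF assms(2,1)] assms(3,4) by blast
  then have "N u \<subseteq> N (proj ss u)" using assms proj_closed by blast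
  then have "N (proj ss u) = N u" using N_proj[OF assms(1,2)] by blast
  then have "proj ss u = u" using N_inj[OF proj_closed[OF assms(1,2)] assms(2)] by simp
  then show ?thesis using assms(2) by (simp add: sortable_def)
qed

subsection \<open>The weak order and the words of a Coxeter element\<close>

lemma act_faithful:
  assumes "g \<in> carrier G" "h \<in> carrier G" "\<And>x. act g x = act h x"
  shows "g = h"
proof -
  have "act (inv g) x = act (inv h) x" for x
  proof -
    have "act g (act (inv h) x) = x" using assms(3)[of "act (inv h) x"] assms(2) by simp
    then show ?thesis using act_inv_cancel[OF assms(1), of "act (inv h) x"] by simp
  qed
  then have "N g = N h" by (simp add: N_def)
  then show ?thesis using N_inj assms by blast
qed

lemma act_reflection:
  assumes "u \<in> carrier G" "s \<in> S"
  shows "act (u \<otimes> s \<otimes> inv u) x = madd x (- form (act u (sroot s)) x) (act u (sroot s))"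
proof -
  have "pair s (act (inv u) x) = form (act u (sroot s)) x"
    using act_form[OF assms(1), of "sroot s" "act (inv u) x"] form_sroot[OF assms(2)] assms(1) by simp
  then show ?thesis using assms by (simp add: act_mult act_gen srefl_def act_madd)
qed

lemma reflection_eq_gen:
  assumes "u \<in> carrier G" "s \<in> S" "r \<in> S" "act u (sroot s) = sroot r"
  shows "u \<otimes> s \<otimes> inv u = r"
proof (rule act_faithful)
  fix x
  show "act (u \<otimes> s \<otimes> inv u) x = act r x"
    using act_reflection[OF assms(1,2)] assms by (simp add: act_gen srefl_def form_sroot)
qed (use assms in auto)

text \<open>Stripping a left descent \<open>r\<close> of \<open>w\<close> conjugates the reflection
  by \<open>r\<close>. The length of \<open>w\<close> drops by exactly one, that of the product by
  at most one, so the inequality carries over.\<close>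

lemma reflection_len:
  assumes "w \<in> carrier G"
  shows "\<lbrakk>u \<in> carrier G; s \<in> S; act u (sroot s) \<in> N w\<rbrakk> \<Longrightarrow> len (u \<otimes> s \<otimes> inv u \<otimes> w) < len w"
  using assms
proof (induction arbitrary: u s rule: left_induct)
  case one
  then show ?case by simp
next
  case (step r w)
  note d = N_descent[OF step(2,1,3)]
  let ?b = "act u (sroot s)"
  show ?case
  proof (cases "?b = sroot r")
    case True
    then show ?thesis using reflection_eq_gen[OF step(5,6,1)] d(3) by simp
  next
    case False
    have c: "r \<otimes> w \<in> carrier G" "r \<otimes> u \<in> carrier G" using step by auto
    have "srefl r ?b \<in> N (r \<otimes> w)"
      using N_mult_iff[OF c(1) step(1) N_pos[OF step(7)] False] step by simp
    then have "act (r \<otimes> u) (sroot s) \<in> N (r \<otimes> w)" using step by (simp add: act_mult act_gen)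
    then have "len (r \<otimes> u \<otimes> s \<otimes> inv (r \<otimes> u) \<otimes> (r \<otimes> w)) < len (r \<otimes> w)"
      using step(4)[OF c(2) step(6)] by blast
    moreover have "r \<otimes> u \<otimes> s \<otimes> inv (r \<otimes> u) \<otimes> (r \<otimes> w) = r \<otimes> (u \<otimes> s \<otimes> inv u \<otimes> w)"
      using step by (simp add: inv_mult_group m_assoc)
    moreover have "len (u \<otimes> s \<otimes> inv u \<otimes> w) \<le> Suc (len (r \<otimes> (u \<otimes> s \<otimes> inv u \<otimes> w)))"
      using len_left_cases[of "u \<otimes> s \<otimes> inv u \<otimes> w" r] step by auto
    moreover have "len w = Suc (len (r \<otimes> w))" using len_left_cases[OF step(2,1)] d(3) by auto
    ultimately show ?thesis by simp
  qed
qed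

text \<open>For the converse, the reflection negates its root, so a root that is no inversion of
  \<open>w\<close> is one of the reflected element. Reflecting back would then shorten that
  element.\<close>

lemma reflection_len_iff:
  assumes "w \<in> carrier G" "u \<in> carrier G" "s \<in> S" "act u (sroot s) \<in> pos_roots"
  shows "len (u \<otimes> s \<otimes> inv u \<otimes> w) < len w \<longleftrightarrow> act u (sroot s) \<in> N w"
proof
  let ?t = "u \<otimes> s \<otimes> inv u" and ?b = "act u (sroot s)"
  assume l: "len (?t \<otimes> w) < len w"
  show "?b \<in> N w"
  proof (rule ccontr)
    assume n: "?b \<notin> N w"
    have tG: "?t \<in> carrier G" using assms by simp
    have ti: "inv ?t = ?t" using assms by (simp add: inv_mult_group m_assoc)
    have "inv ?t \<otimes> (?t \<otimes> w) = w"
      using m_assoc[OF inv_closed[OF tG] tG assms(1)] l_inv[OF tG] l_one[OF assms(1)] by metis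
    then have tt: "?t \<otimes> (?t \<otimes> w) = w" unfolding ti .
    have "act ?t ?b = neg ?b"
      using assms by (simp add: act_mult act_gen srefl_sroot act_neg)
    then have "act (inv (?t \<otimes> w)) ?b = neg (act (inv w) ?b)"
      using assms tG ti by (simp add: inv_mult_group[of ?t w] act_mult act_neg)
    moreover have "nneg (act (inv w) ?b)" using n assms(4) by (simp add: N_def)
    ultimately have "?b \<in> N (?t \<otimes> w)" using assms(1,4) tG by (simp add: N_iff)
    then have "len (?t \<otimes> (?t \<otimes> w)) < len (?t \<otimes> w)"
      using reflection_len[of "?t \<otimes> w" u s] assms tG by simp
    then show False using l tt by simp
  qed
qed (use reflection_len assms in auto)

lemma inversions_subset_iff:
  assumes "v \<in> carrier G" "w \<in> carrier G"
  shows "inversions G S v \<subseteq> inversions G S w \<longleftrightarrow> N v \<subseteq> N w"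
proof
  assume l: "inversions G S v \<subseteq> inversions G S w"
  show "N v \<subseteq> N w"
  proof
    fix \<beta> assume b: "\<beta> \<in> N v"
    then have "\<beta> \<in> pos_roots" by (rule N_pos)
    then obtain u s where u: "u \<in> carrier G" "s \<in> S" "\<beta> = act u (sroot s)" "act u (sroot s) \<in> pos_roots"
      unfolding pos_roots_def roots_def by blast
    have "u \<otimes> s \<otimes> inv u \<in> inversions G S v"
      using reflection_len_iff[OF assms(1) u(1,2,4)] b u unfolding inversions_def reflections_def by blast
    then have "len (u \<otimes> s \<otimes> inv u \<otimes> w) < len w" using l unfolding inversions_def by blast
    then show "\<beta> \<in> N w" using reflection_len_iff[OF assms(2) u(1,2,4)] u(3) by blast
  qed
next
  assume l: "N v \<subseteq> N w"
  show "inversions G S v \<subseteq> inversions G S w"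
  proof
    fix t assume t: "t \<in> inversions G S v"
    then obtain u s where u: "u \<in> carrier G" "s \<in> S" "t = u \<otimes> s \<otimes> inv u"
      unfolding inversions_def reflections_def by blast
    \<comment> \<open>Passing from \<open>u\<close> to \<open>u \<otimes> s\<close> negates the root
      and keeps the reflection, so a positive representative can be chosen.\<close>
    have "\<exists>u' \<in> carrier G. t = u' \<otimes> s \<otimes> inv u' \<and> act u' (sroot s) \<in> pos_roots"
    proof (cases "nneg (act u (sroot s))")
      case True
      then show ?thesis using u act_roots sroot_roots by (auto simp: pos_roots_def)
    next
      case False
      have r: "act u (sroot s) \<in> roots" using act_roots[OF u(1) sroot_roots[OF u(2)]] .
      then have "act (u \<otimes> s) (sroot s) \<in> pos_roots"
        using False roots_cases[OF r] neg_roots[OF r] act_neg_sroot[OF u(1,2)] by (simp add: pos_roots_def)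
      moreover have "t = (u \<otimes> s) \<otimes> s \<otimes> inv (u \<otimes> s)" using u by (simp add: inv_mult_group m_assoc)
      moreover have "u \<otimes> s \<in> carrier G" using u by simp
      ultimately show ?thesis by (intro bexI[of _ "u \<otimes> s"] conjI)
    qed
    then obtain u' where u': "u' \<in> carrier G" "t = u' \<otimes> s \<otimes> inv u'" "act u' (sroot s) \<in> pos_roots" by blast
    have "act u' (sroot s) \<in> N w"
      using t reflection_len_iff[OF assms(1) u'(1) u(2) u'(3)] l unfolding u'(2) inversions_def by blast
    then show "t \<in> inversions G S w"
      using t reflection_len_iff[OF assms(2) u'(1) u(2) u'(3)] unfolding u'(2) inversions_def by blast
  qed
qed

lemma weak_carrier: "carrier (right_weak_order G S) = carrier G"
  by (simp add: right_weak_order_def)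

lemma weak_le:
  "v \<in> carrier G \<Longrightarrow> w \<in> carrier G \<Longrightarrow> le (right_weak_order G S) v w \<longleftrightarrow> N v \<subseteq> N w"
  using inversions_subset_iff by (simp add: right_weak_order_def)

lemma weak_Lower: assumes "A \<subseteq> carrier G"
  shows "Lower (right_weak_order G S) A = {y \<in> carrier G. \<forall>a\<in>A. N y \<subseteq> N a}"
proof (rule Set.set_eqI)
  fix y
  have "le (right_weak_order G S) y a \<longleftrightarrow> N y \<subseteq> N a" if "y \<in> carrier G" "a \<in> A" for a
    using weak_le that assms by blast
  then show "y \<in> Lower (right_weak_order G S) A \<longleftrightarrow> y \<in> {y \<in> carrier G. \<forall>a\<in>A. N y \<subseteq> N a}"
    using assms unfolding Lower_def weak_carrier by fast
qed

lemma weak_Upper: assumes "A \<subseteq> carrier G"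
  shows "Upper (right_weak_order G S) A = {y \<in> carrier G. \<forall>a\<in>A. N a \<subseteq> N y}"
proof (rule Set.set_eqI)
  fix y
  have "le (right_weak_order G S) a y \<longleftrightarrow> N a \<subseteq> N y" if "y \<in> carrier G" "a \<in> A" for a
    using weak_le that assms by blast
  then show "y \<in> Upper (right_weak_order G S) A \<longleftrightarrow> y \<in> {y \<in> carrier G. \<forall>a\<in>A. N a \<subseteq> N y}"
    using assms unfolding Upper_def weak_carrier by fast
qed

lemma weak_meet:
  assumes "A \<subseteq> carrier G" "A \<noteq> {}"
  defines "u \<equiv> \<Sqinter>\<^bsub>right_weak_order G S\<^esub> A"
  shows "u \<in> carrier G" "\<forall>a\<in>A. N u \<subseteq> N a" "\<forall>x \<in> carrier G. (\<forall>a\<in>A. N x \<subseteq> N a) \<longrightarrow> N x \<subseteq> N u"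
proof -
  let ?L = "right_weak_order G S"
  have sub: "Lower ?L A \<subseteq> carrier G" unfolding weak_Lower[OF assms(1)] by blast
  obtain v where v: "v \<in> carrier G" "\<forall>a\<in>A. N v \<subseteq> N a" "\<forall>x \<in> carrier G. (\<forall>a\<in>A. N x \<subseteq> N a) \<longrightarrow> N x \<subseteq> N v"
    using meet_exists[OF assms(1,2)] by blast
  have "greatest ?L v (Lower ?L A)"
    unfolding greatest_def weak_carrier weak_Lower[OF assms(1)]
  proof (intro conjI ballI)
    fix x assume "x \<in> {y \<in> carrier G. \<forall>a\<in>A. N y \<subseteq> N a}"
    then have "x \<in> carrier G" "N x \<subseteq> N v" using v(3) by auto
    then show "le ?L x v" using weak_le[OF _ v(1)] by simp
  qed (use v in auto)
  \<comment> \<open>The infimum is a choice among greatest lower bounds, so the existence of one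
    gives \<open>u\<close> the defining property.\<close>
  then have "greatest ?L u (Lower ?L A)" unfolding u_def inf_def by (rule someI)
  then have u: "u \<in> Lower ?L A" "\<forall>x\<in>Lower ?L A. le ?L x u" unfolding greatest_def by blast+
  show uG: "u \<in> carrier G" "\<forall>a\<in>A. N u \<subseteq> N a" using u(1) unfolding weak_Lower[OF assms(1)] by blast+
  show "\<forall>x \<in> carrier G. (\<forall>a\<in>A. N x \<subseteq> N a) \<longrightarrow> N x \<subseteq> N u"
    using u(2) weak_le[OF _ uG(1)] unfolding weak_Lower[OF assms(1)] by simp
qed

lemma weak_join:
  assumes "A \<subseteq> carrier G" "Upper (right_weak_order G S) A \<noteq> {}"
  defines "u \<equiv> \<Squnion>\<^bsub>right_weak_order G S\<^esub> A"
  shows "u \<in> carrier G" "\<forall>a\<in>A. N a \<subseteq> N u" "\<forall>x \<in> carrier G. (\<forall>a\<in>A. N a \<subseteq> N x) \<longrightarrow> N u \<subseteq> N x"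
proof -
  let ?L = "right_weak_order G S"
  obtain y where y: "y \<in> carrier G" "\<forall>a\<in>A. N a \<subseteq> N y" using assms(2) unfolding weak_Upper[OF assms(1)] by blast
  obtain v where v: "v \<in> carrier G" "\<forall>a\<in>A. N a \<subseteq> N v" "\<forall>x \<in> carrier G. (\<forall>a\<in>A. N a \<subseteq> N x) \<longrightarrow> N v \<subseteq> N x"
    using bounded_join_exists[OF assms(1) y] by blast
  have "least ?L v (Upper ?L A)"
    unfolding least_def weak_carrier weak_Upper[OF assms(1)]
  proof (intro conjI ballI)
    fix x assume "x \<in> {y \<in> carrier G. \<forall>a\<in>A. N a \<subseteq> N y}"
    then have "x \<in> carrier G" "N v \<subseteq> N x" using v(3) by auto
    then show "le ?L v x" using weak_le[OF v(1)] by simp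
  qed (use v in auto)
  then have "least ?L u (Upper ?L A)" unfolding u_def sup_def by (rule someI)
  then have u: "u \<in> Upper ?L A" "\<forall>x\<in>Upper ?L A. le ?L u x" unfolding least_def by blast+
  show uG: "u \<in> carrier G" "\<forall>a\<in>A. N a \<subseteq> N u" using u(1) unfolding weak_Upper[OF assms(1)] by blast+
  show "\<forall>x \<in> carrier G. (\<forall>a\<in>A. N a \<subseteq> N x) \<longrightarrow> N u \<subseteq> N x"
    using u(2) weak_le[OF uG(1)] unfolding weak_Upper[OF assms(1)] by simp
qed

text \<open>Reflections in the letters of \<open>ws\<close> leave any other coordinate unchanged.
  There both the root and the negative of its image are nonnegative, which forces 0.\<close>

lemma N_word_supp: assumes "ws \<in> lists S" "\<beta> \<in> N (wp ws)" shows "supp ws \<beta>"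
  unfolding supp_def
proof (intro allI impI)
  fix t assume t: "t \<notin> set ws"
  have r: "rev ws \<in> lists S" using assms(1) by auto
  have "nneg (neg (act (inv (wp ws)) \<beta>))" "nneg \<beta>"
    using assms N_iff[of "wp ws"] by (auto simp: pos_roots_def)
  then have "0 \<le> neg (act (inv (wp ws)) \<beta>) t" "0 \<le> \<beta> t" unfolding nneg_def by blast+
  moreover have "act (inv (wp ws)) \<beta> t = \<beta> t"
    using act_wp[OF r, of \<beta>] wp_rev[OF assms(1)] foldr_srefl_outside[of t "rev ws" \<beta>] t by simp
  ultimately show "\<beta> t = 0" by (simp add: neg_def)
qed

section \<open>Commuting letters and the words of one Coxeter element\<close>

lemma srefl_fixes_iff: assumes "a \<in> S" "b \<in> S" "a \<noteq> b"
  shows "srefl a (sroot b) = sroot b \<longleftrightarrow> bil a b = 0"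
proof
  assume "srefl a (sroot b) = sroot b"
  then have "srefl a (sroot b) a = 0" using assms by (simp add: sroot_def)
  then show "bil a b = 0" using assms by (simp add: srefl_def madd_def sroot_def pair_sroot[unfolded sroot_def])
qed (simp add: srefl_def madd_def pair_sroot assms)

text \<open>The two products send \<open>sroot b\<close> to vectors with opposite coordinates at
  \<open>a\<close>. Equality makes this coordinate, which is \<open>bil a b\<close> up to sign,
  vanish.\<close>

lemma commute_iff: assumes "a \<in> S" "b \<in> S" "a \<noteq> b"
  shows "a \<otimes> b = b \<otimes> a \<longleftrightarrow> bil a b = 0"
proof
  assume c: "a \<otimes> b = b \<otimes> a"
  have "act (a \<otimes> b) (sroot b) = neg (srefl a (sroot b))"
    using act_neg[of a "sroot b"] assms by (simp add: act_mult act_gen srefl_sroot)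
  moreover have "act (b \<otimes> a) (sroot b) a = srefl a (sroot b) a"
    using assms by (simp add: act_mult act_gen srefl_other)
  ultimately have "srefl a (sroot b) a = 0" using c by (simp add: neg_def)
  then show "bil a b = 0" using assms by (simp add: srefl_def madd_def sroot_def pair_sroot[unfolded sroot_def])
next
  assume z: "bil a b = 0"
  have z': "bil b a = 0" using z bil_sym assms by simp
  show "a \<otimes> b = b \<otimes> a"
  proof (rule act_faithful)
    fix x
    show "act (a \<otimes> b) x = act (b \<otimes> a) x"
      using assms z z' by (simp add: act_mult act_gen srefl_def pair_madd pair_sroot)
        (simp add: madd_def algebra_simps)
  qed (use assms in auto)
qed

lemma commute_descent:
  assumes "a \<in> S" "b \<in> S" "a \<noteq> b" "a \<otimes> b = b \<otimes> a" "w \<in> carrier G"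
  shows "sroot b \<in> N (a \<otimes> w) \<longleftrightarrow> sroot b \<in> N w"
proof -
  have "sroot b \<noteq> sroot a" using assms(3) by (auto simp: sroot_def fun_eq_iff)
  then show ?thesis
    using N_mult_iff[OF assms(5,1) sroot_pos[OF assms(2)]] srefl_fixes_iff[OF assms(1-3)]
      commute_iff[OF assms(1-3)] assms(4) by simp
qed

text \<open>Commuting letters do not influence each other's being descents. If both are descents,
  the two words rotate to words that end in the pair in either order, and the element is shorter by
  two; if one is skipped, both words lead to the same state.\<close>

lemma sortable_swap:
  assumes "w \<in> carrier G" "cword (us @ [a, b] @ vs)" "a \<otimes> b = b \<otimes> a"
  shows "sortable (us @ [a, b] @ vs) w \<longleftrightarrow> sortable (us @ [b, a] @ vs) w"
  using assms
proof (induction "len w" arbitrary: w us a b vs rule: less_induct)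
  case less
  note outer = less(1) and w = less(2) and ab = less(4)
  show ?case using less(3)
  proof (induction us)
    case Nil
    have S: "a \<in> S" "b \<in> S" "a \<noteq> b" using Nil by (auto simp: cword_def)
    have cw: "cword (a # b # vs)" "cword (b # a # vs)" "cword (b # vs)" "cword (a # vs)"
      "cword (b # vs @ [a])" "cword (a # vs @ [b])"
      using Nil by (auto simp: cword_def)
    have da: "sroot b \<in> N (a \<otimes> w) \<longleftrightarrow> sroot b \<in> N w" and db: "sroot a \<in> N (b \<otimes> w) \<longleftrightarrow> sroot a \<in> N w"
      using commute_descent[OF S ab w] commute_descent[OF S(2,1) _ _ w] S(3) ab by auto
    have c: "a \<otimes> w \<in> carrier G" "b \<otimes> w \<in> carrier G" using S w by auto
    have comm: "b \<otimes> (a \<otimes> w) = a \<otimes> (b \<otimes> w)"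
      using ab S w by (simp flip: m_assoc)
    consider "sroot a \<in> N w" "sroot b \<in> N w" | "sroot a \<in> N w" "sroot b \<notin> N w"
      | "sroot a \<notin> N w" "sroot b \<in> N w" | "sroot a \<notin> N w" "sroot b \<notin> N w" by blast
    then show ?case
    proof cases
      case 1
      have "sortable (a # b # vs) w \<longleftrightarrow> sortable ((vs @ [a]) @ [b]) (b \<otimes> (a \<otimes> w))"
        using sortable_desc[OF S(1) cw(1) w 1(1)] sortable_desc[OF S(2) cw(5) c(1)] da 1 by simp
      moreover have "sortable (b # a # vs) w \<longleftrightarrow> sortable ((vs @ [b]) @ [a]) (b \<otimes> (a \<otimes> w))"
        using sortable_desc[OF S(2) cw(2) w 1(2)] sortable_desc[OF S(1) cw(6) c(2)] db 1 comm by simp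
      moreover have "sortable (vs @ [a, b] @ []) (b \<otimes> (a \<otimes> w)) \<longleftrightarrow> sortable (vs @ [b, a] @ []) (b \<otimes> (a \<otimes> w))"
      proof (rule outer[OF _ _ _ ab])
        show "len (b \<otimes> (a \<otimes> w)) < len w"
          using N_descent(3)[OF w S(1) 1(1)] N_descent(3)[OF c(1) S(2)] da 1 by simp
        show "b \<otimes> (a \<otimes> w) \<in> carrier G" using S c by simp
        show "cword (vs @ [a, b] @ [])" using cw(1) by (auto simp: cword_def)
      qed
      ultimately show ?thesis by simp
    next
      case 2
      then show ?thesis
        using sortable_desc[OF S(1) cw(1) w] sortable_skip[OF S(2) c(1), of "vs @ [a]"] da
          sortable_skip[OF S(2) w, of "a # vs"] sortable_desc[OF S(1) cw(4) w] by simp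
    next
      case 3
      then show ?thesis
        using sortable_desc[OF S(2) cw(2) w] sortable_skip[OF S(1) c(2), of "vs @ [b]"] db
          sortable_skip[OF S(1) w, of "b # vs"] sortable_desc[OF S(2) cw(3) w] by simp
    next
      case 4
      then show ?thesis
        using sortable_skip[OF S(1) w] sortable_skip[OF S(2) w] by simp
    qed
  next
    case (Cons u us)
    have u: "u \<in> S" "cword (us @ [a, b] @ vs)" using Cons(2) by (auto simp: cword_def)
    have cw: "cword (u # us @ [a, b] @ vs)" "cword (u # us @ [b, a] @ vs)" "cword (us @ [a, b] @ vs @ [u])"
      using Cons(2) by (auto simp: cword_def)
    show ?case
    proof (cases "sroot u \<in> N w")
      case True
      have "sortable (us @ [a, b] @ (vs @ [u])) (u \<otimes> w) \<longleftrightarrow> sortable (us @ [b, a] @ (vs @ [u])) (u \<otimes> w)"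
        using outer[OF N_descent(3)[OF w u(1) True] _ cw(3) ab] u w by simp
      then show ?thesis
        using sortable_desc[OF u(1) cw(1) w True] sortable_desc[OF u(1) cw(2) w True] by simp
    next
      case False
      then show ?thesis using sortable_skip[OF u(1) w False] Cons(1)[OF u(2)] by simp
    qed
  qed
qed

inductive comm_eq :: "'a list \<Rightarrow> 'a list \<Rightarrow> bool" where
  base: "comm_eq ss ss"
| swap: "comm_eq ss (us @ [a, b] @ vs) \<Longrightarrow> a \<otimes> b = b \<otimes> a \<Longrightarrow> comm_eq ss (us @ [b, a] @ vs)"

lemma comm_eq_trans: "comm_eq us vs \<Longrightarrow> comm_eq ss us \<Longrightarrow> comm_eq ss vs"
proof (induction rule: comm_eq.induct)
  case (swap us vs a b ws)
  then show ?case using comm_eq.swap by blast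
qed

lemma comm_eq_Cons: "comm_eq us vs \<Longrightarrow> comm_eq (s # us) (s # vs)"
proof (induction rule: comm_eq.induct)
  case (swap ss us a b vs)
  then show ?case using comm_eq.swap[of "s # ss" "s # us" a b vs] by simp
qed (rule comm_eq.base)

lemma comm_eq_move: "\<forall>x\<in>set xs. s \<otimes> x = x \<otimes> s \<Longrightarrow> comm_eq (s # xs @ ys) (xs @ s # ys)"
proof (induction xs)
  case (Cons x xs)
  have "comm_eq (s # x # xs @ ys) (x # s # xs @ ys)"
    using comm_eq.swap[of "s # x # xs @ ys" "[]" s x "xs @ ys"] comm_eq.base Cons(2) by simp
  moreover have "comm_eq (x # s # xs @ ys) (x # xs @ s # ys)" using Cons by (intro comm_eq_Cons) simp
  ultimately show ?case using comm_eq_trans by simp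
qed (simp add: comm_eq.base)

lemma comm_eq_sortable:
  "comm_eq ss ss' \<Longrightarrow> cword ss \<Longrightarrow> w \<in> carrier G \<Longrightarrow> cword ss' \<and> (sortable ss w \<longleftrightarrow> sortable ss' w)"
proof (induction rule: comm_eq.induct)
  case (swap ss us a b vs)
  then have "cword (us @ [b, a] @ vs)" by (auto simp: cword_def)
  then show ?case using swap sortable_swap by blast
qed simp

lemma cword_lists: "cword ss \<Longrightarrow> ss \<in> lists S"
  by (auto simp: cword_def)

text \<open>Reflecting \<open>sroot s\<close> in the first letter \<open>r\<close> gives an
  inversion of the rest of the word, which vanishes at \<open>r\<close>. So \<open>bil r s\<close>
  is 0, and \<open>s\<close> moves past \<open>r\<close>.\<close>

lemma initial_letter:
  "\<lbrakk>cword ss; s \<in> S; sroot s \<in> N (wp ss)\<rbrakk> \<Longrightarrow> \<exists>xs ys. ss = xs @ s # ys \<and> (\<forall>x\<in>set xs. s \<otimes> x = x \<otimes> s)"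
proof (induction ss)
  case (Cons r ss)
  have r: "r \<in> S" "r \<notin> set ss" "cword ss" using Cons(2) by (auto simp: cword_Cons)
  have G: "wp ss \<in> carrier G" using cword_lists[OF r(3)] by (rule wp_closed)
  show ?case
  proof (cases "s = r")
    case True
    then show ?thesis by (intro exI[of _ "[]"] exI[of _ ss]) auto
  next
    case False
    then have "sroot s \<noteq> sroot r" by (auto simp: sroot_def fun_eq_iff)
    then have n: "srefl r (sroot s) \<in> N (wp ss)"
      using N_mult_iff[OF G r(1) sroot_pos[OF Cons(3)]] Cons(4) by simp
    then have "srefl r (sroot s) r = 0" using N_word_supp[OF cword_lists[OF r(3)]] r(2) by (simp add: supp_def)
    then have z: "bil r s = 0"
      using False Cons(3) by (simp add: srefl_def madd_def sroot_def pair_sroot[unfolded sroot_def])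
    then have "srefl r (sroot s) = sroot s" "r \<otimes> s = s \<otimes> r"
      using srefl_fixes_iff commute_iff r(1) Cons(3) False by auto
    then obtain xs ys where "ss = xs @ s # ys" "\<forall>x\<in>set xs. s \<otimes> x = x \<otimes> s"
      using Cons(1)[OF r(3) Cons(3)] n by auto
    then show ?thesis using \<open>r \<otimes> s = s \<otimes> r\<close> by (intro exI[of _ "r # xs"] exI[of _ ys]) auto
  qed
qed simp

lemma wp_move:
  assumes "s \<in> S" "xs \<in> lists S" "ys \<in> lists S" "\<forall>x\<in>set xs. s \<otimes> x = x \<otimes> s"
  shows "wp (xs @ s # ys) = s \<otimes> wp (xs @ ys)"
  using assms(2,4)
proof (induction xs)
  case (Cons x xs)
  have G: "wp (xs @ ys) \<in> carrier G" using Cons.prems Cons.hyps assms(3) by (intro wp_closed) auto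
  have x: "x \<in> S" using Cons by auto
  have "wp ((x # xs) @ s # ys) = x \<otimes> (s \<otimes> wp (xs @ ys))" using Cons by simp
  also have "\<dots> = (s \<otimes> x) \<otimes> wp (xs @ ys)"
    using Cons.prems m_assoc[OF S_closed[OF x] S_closed[OF assms(1)] G] by simp
  also have "\<dots> = s \<otimes> wp ((x # xs) @ ys)" using x assms(1) G by (simp add: m_assoc)
  finally show ?case .
qed simp

text \<open>The first letter of one word is a left descent of the product, so in the other word it
  commutes to the front and can be cancelled. With \<open>comm_eq_sortable\<close> this makes
  sortability independent of the word for the Coxeter element.\<close>

lemma coxeter_words_comm_eq:
  "\<lbrakk>cword ss; cword ss'; set ss = set ss'; wp ss = wp ss'\<rbrakk> \<Longrightarrow> comm_eq ss ss'"
proof (induction ss arbitrary: ss')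
  case Nil
  then show ?case using comm_eq.base by simp
next
  case (Cons s ss)
  have s: "s \<in> S" "s \<notin> set ss" "cword ss" using Cons(2) by (auto simp: cword_Cons)
  have G: "wp ss \<in> carrier G" using cword_lists[OF s(3)] by (rule wp_closed)
  have "\<not> supp ss (sroot s)" using s(2) by (auto simp: supp_def sroot_def)
  then have "sroot s \<notin> N (wp ss)" using N_word_supp[OF cword_lists[OF s(3)]] by blast
  then have "sroot s \<in> N (wp ss')" using sroot_N_mult[OF G s(1)] Cons(5) by simp
  then obtain xs ys where xy: "ss' = xs @ s # ys" "\<forall>x\<in>set xs. s \<otimes> x = x \<otimes> s"
    using initial_letter[OF Cons(3) s(1)] by blast
  have l: "xs \<in> lists S" "ys \<in> lists S" "cword (xs @ ys)" "s \<notin> set (xs @ ys)"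
    using Cons(3) unfolding xy(1) cword_def by auto
  have G': "wp (xs @ ys) \<in> carrier G" using cword_lists[OF l(3)] by (rule wp_closed)
  have "s \<otimes> wp ss = s \<otimes> wp (xs @ ys)" using Cons(5) wp_move[OF s(1) l(1,2) xy(2)] xy(1) by simp
  then have "wp ss = wp (xs @ ys)" using S_cancel[OF s(1) G] S_cancel[OF s(1) G'] by metis
  moreover have "set ss = set (xs @ ys)" using Cons(4) s(2) l(4) unfolding xy(1) by auto
  ultimately have "comm_eq ss (xs @ ys)" using Cons(1)[OF s(3) l(3)] by blast
  then have "comm_eq (s # ss) (s # xs @ ys)" by (rule comm_eq_Cons)
  then show ?case unfolding xy(1) using comm_eq_trans[OF comm_eq_move[OF xy(2)]] by blast
qed

subsection \<open>Sorting words\<close>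

definition subword_pos :: "(nat \<Rightarrow> 'a) \<Rightarrow> 'a \<Rightarrow> nat list \<Rightarrow> bool" where
  "subword_pos f w ps \<longleftrightarrow> sorted_wrt (<) ps \<and> reduced_word G S (map f ps) w"

definition lex_first :: "(nat \<Rightarrow> 'a) \<Rightarrow> 'a \<Rightarrow> nat list \<Rightarrow> bool" where
  "lex_first f w ps \<longleftrightarrow> subword_pos f w ps \<and>
    (\<forall>qs. subword_pos f w qs \<longrightarrow> qs = ps \<or> (ps, qs) \<in> lexord less_than)"

text \<open>The infinite word is a function of the position, so that removing its first letter is
  composition with \<open>Suc\<close>. For lists this would be a rotation together with a
  renumbering of the copies.\<close>

definition periodic :: "nat \<Rightarrow> (nat \<Rightarrow> 'a) \<Rightarrow> bool" where
  "periodic n f \<longleftrightarrow> 0 < n \<and> (\<forall>i. f (i + n) = f i) \<and> inj_on f {..<n} \<and> f ` {..<n} = S"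

lemma periodic_mult: "periodic n f \<Longrightarrow> f (i + k * n) = f i"
proof (induction k)
  case (Suc k)
  have "f (i + k * n + n) = f (i + k * n)" using Suc(2) by (simp add: periodic_def)
  then show ?case using Suc by (simp add: algebra_simps)
qed simp

lemma periodic_mod: "periodic n f \<Longrightarrow> f (i mod n) = f i"
  using periodic_mult[of n f "i mod n" "i div n"] by simp

lemma periodic_in: "periodic n f \<Longrightarrow> f i \<in> S"
  using periodic_mod[of n f i] unfolding periodic_def by (metis imageI lessThan_iff mod_less_divisor)

lemma periodic_eq: "periodic n f \<Longrightarrow> f i = f j \<longleftrightarrow> i mod n = j mod n"
proof
  assume f: "periodic n f" and e: "f i = f j"
  then have "f (i mod n) = f (j mod n)" using periodic_mod by metis
  then show "i mod n = j mod n" using f unfolding periodic_def inj_on_def by simp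
qed (metis periodic_mod)

lemma periodic_late: assumes "periodic n f" "s \<in> S" shows "\<exists>p\<ge>k. f p = s"
proof -
  obtain i where i: "f i = s" using assms unfolding periodic_def by blast
  have "k \<le> i + k * n" using assms by (simp add: periodic_def trans_le_add2)
  then show ?thesis using periodic_mult[OF assms(1), of i k] i by blast
qed

lemma periodic_shift: assumes "periodic n f" shows "periodic n (f \<circ> Suc)"
proof -
  have n: "0 < n" using assms by (simp add: periodic_def)
  have inj: "inj_on (f \<circ> Suc) {..<n}"
  proof (rule inj_onI)
    fix i j assume ij: "i \<in> {..<n}" "j \<in> {..<n}" "(f \<circ> Suc) i = (f \<circ> Suc) j"
    then have "Suc i mod n = Suc j mod n" using periodic_eq[OF assms] by simp
    then show "i = j" using ij by (auto simp: mod_Suc split: if_splits)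
  qed
  have "(f \<circ> Suc) ` {..<n} = S"
  proof (rule card_subset_eq[OF fin])
    show "(f \<circ> Suc) ` {..<n} \<subseteq> S" using periodic_in[OF assms] by auto
    have "card ((f \<circ> Suc) ` {..<n}) = card (f ` {..<n})"
      using assms card_image[OF inj] card_image[of f "{..<n}"] by (simp add: periodic_def)
    then show "card ((f \<circ> Suc) ` {..<n}) = card S" using assms by (simp add: periodic_def)
  qed
  moreover have "(f \<circ> Suc) (i + n) = (f \<circ> Suc) i" for i
    using assms unfolding periodic_def comp_def by (metis add_Suc)
  ultimately show ?thesis using inj n by (simp add: periodic_def)
qed

lemma late_subword: assumes "periodic n f" "ws \<in> lists S"
  shows "\<exists>ps. sorted_wrt (<) ps \<and> (\<forall>p\<in>set ps. k \<le> p) \<and> map f ps = ws"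
  using assms(2)
proof (induction ws arbitrary: k)
  case (Cons s ws)
  then obtain p where p: "k \<le> p" "f p = s" using periodic_late[OF assms(1), of s k] by auto
  obtain ps where ps: "sorted_wrt (<) ps" "\<forall>q\<in>set ps. Suc p \<le> q" "map f ps = ws"
    using Cons.IH[of "Suc p"] by blast
  have "\<forall>q\<in>set ps. p < q \<and> k \<le> q" using ps(2) p(1) by auto
  then show ?case using p ps by (intro exI[of _ "p # ps"]) simp
qed auto

lemma subword_exists: assumes "periodic n f" "w \<in> carrier G" shows "\<exists>ps. subword_pos f w ps"
proof -
  obtain ws where ws: "reduced_word G S ws w" using reduced_exists assms(2) by blast
  then have "ws \<in> lists S" by (simp add: reduced_word_def)
  then show ?thesis using late_subword[OF assms(1)] ws unfolding subword_pos_def by metis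
qed

text \<open>\<open>lexord\<close> is not well-founded, but all competing position lists have the
  length of \<open>w\<close>, and on lists of equal length it agrees with the well-founded
  \<open>lenlex\<close>.\<close>

lemma lex_first_exists: assumes "periodic n f" "w \<in> carrier G" shows "\<exists>ps. lex_first f w ps"
proof -
  obtain ps0 where "subword_pos f w ps0" using subword_exists[OF assms] by blast
  then obtain ps where ps: "subword_pos f w ps"
    "\<And>qs. (qs, ps) \<in> lenlex less_than \<Longrightarrow> \<not> subword_pos f w qs"
    using wfE_min[OF wf_lenlex[OF wf_less_than], of ps0 "{ps. subword_pos f w ps}"] by auto
  have "qs = ps \<or> (ps, qs) \<in> lexord less_than" if q: "subword_pos f w qs" for qs
  proof -
    have l: "length qs = length ps" using q ps(1) unfolding subword_pos_def reduced_word_def by (metis length_map)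
    have "(qs, ps) \<notin> lenlex less_than" using ps(2) q by blast
    then have "qs = ps \<or> (ps, qs) \<in> lenlex less_than"
      using total_lenlex[OF total_less_than] by (auto simp: total_on_def)
    then show ?thesis using l by (auto simp: lenlex_conv lexord_lex)
  qed
  then show ?thesis using ps(1) unfolding lex_first_def by blast
qed

lemma reduced_Cons:
  assumes "s \<in> S" "w \<in> carrier G" "sroot s \<in> N w"
  shows "reduced_word G S (s # us) w \<longleftrightarrow> reduced_word G S us (s \<otimes> w)"
proof -
  have l: "len w = Suc (len (s \<otimes> w))" using len_left_cases[OF assms(2,1)] sroot_N assms by auto
  have "s \<otimes> wp us = w \<longleftrightarrow> wp us = s \<otimes> w" if "us \<in> lists S"
    using wp_closed[OF that] assms by (metis S_cancel)
  then show ?thesis using l assms(1) unfolding reduced_word_def by auto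
qed

lemma reduced_Cons_descent:
  assumes "w \<in> carrier G" "reduced_word G S (s # us) w"
  shows "s \<in> S" "sroot s \<in> N w"
proof -
  have us: "s \<in> S" "us \<in> lists S" "w = s \<otimes> wp us" "len w = Suc (length us)"
    using assms(2) unfolding reduced_word_def by auto
  then have "s \<otimes> w = wp us" by simp
  then have "len (s \<otimes> w) < len w" using len_le[OF us(2)] us(4) by simp
  then show "s \<in> S" "sroot s \<in> N w" using sroot_N assms(1) us(1) by auto
qed

lemma sorted_map_Suc: "sorted_wrt (<) (map Suc ps) \<longleftrightarrow> sorted_wrt (<) ps"
  by (simp add: sorted_wrt_map)

lemma subword_map_Suc: "subword_pos f w (map Suc ps) \<longleftrightarrow> subword_pos (f \<circ> Suc) w ps"
  by (simp add: subword_pos_def sorted_map_Suc)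

lemma subword_Cons_0:
  assumes "f 0 \<in> S" "w \<in> carrier G" "sroot (f 0) \<in> N w"
  shows "subword_pos f w (0 # map Suc ps) \<longleftrightarrow> subword_pos (f \<circ> Suc) (f 0 \<otimes> w) ps"
  using reduced_Cons[OF assms] by (simp add: subword_pos_def sorted_map_Suc)

text \<open>A left descent begins some reduced word, and no position precedes 0, so the
  lexicographically first subword must use it.\<close>

lemma lex_first_desc:
  assumes f: "periodic n f" and w: "w \<in> carrier G" "sroot (f 0) \<in> N w" and ps: "lex_first f w ps"
  shows "\<exists>qs. ps = 0 # map Suc qs \<and> lex_first (f \<circ> Suc) (f 0 \<otimes> w) qs"
proof -
  have f0: "f 0 \<in> S" using periodic_in[OF f] .
  have sw: "f 0 \<otimes> w \<in> carrier G" using f0 w by simp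
  obtain rs where rs: "subword_pos (f \<circ> Suc) (f 0 \<otimes> w) rs"
    using subword_exists[OF periodic_shift[OF f] sw] by blast
  then have "subword_pos f w (0 # map Suc rs)" using subword_Cons_0[where f = f, OF f0 w] by simp
  then have "0 # map Suc rs = ps \<or> (ps, 0 # map Suc rs) \<in> lexord less_than"
    using ps unfolding lex_first_def by blast
  moreover have "ps \<noteq> []"
  proof
    assume "ps = []"
    then have "w = \<one>" using ps unfolding lex_first_def subword_pos_def reduced_word_def by simp
    then show False using w(2) by simp
  qed
  ultimately obtain pr where pr: "ps = 0 # pr" by (cases ps) auto
  have "\<forall>p\<in>set pr. 0 < p" using ps unfolding pr lex_first_def subword_pos_def by simp
  then obtain qs where qs: "pr = map Suc qs" using map_Suc_exists by blast
  have "lex_first (f \<circ> Suc) (f 0 \<otimes> w) qs"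
    unfolding lex_first_def
  proof (intro conjI allI impI)
    show "subword_pos (f \<circ> Suc) (f 0 \<otimes> w) qs"
      using ps subword_Cons_0[where f = f, OF f0 w] unfolding lex_first_def pr qs by simp
    fix us assume "subword_pos (f \<circ> Suc) (f 0 \<otimes> w) us"
    then have "subword_pos f w (0 # map Suc us)" using subword_Cons_0[where f = f, OF f0 w] by simp
    then have "0 # map Suc us = 0 # map Suc qs \<or> (0 # map Suc qs, 0 # map Suc us) \<in> lexord less_than"
      using ps unfolding lex_first_def pr qs by blast
    then show "us = qs \<or> (qs, us) \<in> lexord less_than"
      using lexord_map_Suc by (auto simp: inj_map_eq_map)
  qed
  then show ?thesis using pr qs by blast
qed

lemma lex_first_skip:
  assumes f: "periodic n f" and w: "w \<in> carrier G" "sroot (f 0) \<notin> N w" and ps: "lex_first f w ps"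
  shows "\<exists>qs. ps = map Suc qs \<and> lex_first (f \<circ> Suc) w qs"
proof -
  have sp: "subword_pos f w ps" using ps by (simp add: lex_first_def)
  have "\<forall>p\<in>set ps. 0 < p"
  proof (cases ps)
    case (Cons p pr)
    have "p \<noteq> 0"
    proof
      assume "p = 0"
      then have "reduced_word G S (f 0 # map f pr) w" using sp Cons by (simp add: subword_pos_def)
      then show False using reduced_Cons_descent w by blast
    qed
    then show ?thesis using sp Cons unfolding subword_pos_def by fastforce
  qed simp
  then obtain qs where qs: "ps = map Suc qs" using map_Suc_exists by blast
  have "lex_first (f \<circ> Suc) w qs"
    unfolding lex_first_def
  proof (intro conjI allI impI)
    show "subword_pos (f \<circ> Suc) w qs" using sp subword_map_Suc unfolding qs by blast
    fix us assume "subword_pos (f \<circ> Suc) w us"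
    then have "subword_pos f w (map Suc us)" using subword_map_Suc by blast
    then have "map Suc us = map Suc qs \<or> (map Suc qs, map Suc us) \<in> lexord less_than"
      using ps unfolding lex_first_def qs by blast
    then show "us = qs \<or> (qs, us) \<in> lexord less_than"
      using lexord_map_Suc by (auto simp: inj_map_eq_map)
  qed
  then show ?thesis using qs by blast
qed

text \<open>The word with which \<open>proj\<close> continues: the letters not yet dropped, in the
  order in which they occur from the current position on.\<close>

definition remaining :: "nat \<Rightarrow> (nat \<Rightarrow> 'a) \<Rightarrow> 'a set \<Rightarrow> 'a list" where
  "remaining n f D = filter (\<lambda>s. s \<notin> D) (map f [0..<n])"

lemma remaining_cword: assumes "periodic n f" shows "cword (remaining n f D)"
  using assms unfolding cword_def remaining_def periodic_def
  by (auto intro!: distinct_filter simp: distinct_map atLeast0LessThan)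

lemma remaining_step: assumes "periodic n f"
  obtains ss where "f 0 \<notin> set ss"
    "remaining n f D = (if f 0 \<in> D then ss else f 0 # ss)"
    "remaining n (f \<circ> Suc) D = (if f 0 \<in> D then ss else ss @ [f 0])"
    "remaining n (f \<circ> Suc) (insert (f 0) D) = ss"
proof -
  obtain k where k: "n = Suc k" using assms by (cases n) (auto simp: periodic_def)
  define ts where "ts = map f [1..<n]"
  have u: "[0..<n] = 0 # [1..<n]" unfolding k by (simp add: upt_rec)
  have fn: "f n = f 0" using assms by (metis add_0 periodic_def)
  have 1: "map f [0..<n] = f 0 # ts" unfolding u ts_def by simp
  have "map (f \<circ> Suc) [0..<n] = map f (map Suc [0..<n])" by simp
  also have "map Suc [0..<n] = [1..<n] @ [n]" unfolding map_Suc_upt k by simp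
  finally have 2: "map (f \<circ> Suc) [0..<n] = ts @ [f 0]" unfolding ts_def using fn by (simp add: comp_def)
  have "distinct (map f [0..<n])" using assms by (simp add: periodic_def distinct_map atLeast0LessThan)
  then have nt: "f 0 \<notin> set ts" unfolding 1 by simp
  have 3: "filter (\<lambda>s. s \<notin> insert (f 0) D) ts = filter (\<lambda>s. s \<notin> D) ts"
    by (rule filter_cong) (use nt in auto)
  show ?thesis
  proof (rule that[of "filter (\<lambda>s. s \<notin> D) ts"])
    show "f 0 \<notin> set (filter (\<lambda>s. s \<notin> D) ts)" using nt by simp
  qed (use 1 2 3 in \<open>auto simp: remaining_def simp del: upt_Suc\<close>)
qed

text \<open>While the positions are read off, \<open>D\<close> collects the letters that have already been skipped.\<close>
lemma lex_first_sortable: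
  assumes "periodic n f" "w \<in> carrier G" "lex_first f w ps" "\<forall>p\<in>set ps. p < M"
  shows "(\<forall>i. i + n \<in> set ps \<longrightarrow> i \<in> set ps) \<and> (\<forall>p\<in>set ps. f p \<notin> D) \<longleftrightarrow> sortable (remaining n f D) w"
  using assms
\<comment> \<open>A skipped position shrinks neither \<open>w\<close> nor the list of positions.
  What decreases in every step is the bound \<open>M\<close>.\<close>
proof (induction M arbitrary: f w ps D)
  case 0
  then have "ps = []" by (cases ps) auto
  moreover from this have "w = \<one>"
    using 0(3) unfolding lex_first_def subword_pos_def reduced_word_def by simp
  ultimately show ?case using sortable_one[OF remaining_cword[OF 0(1)]] by simp
next
  case (Suc M)
  note IH = Suc(1) and f = Suc(2) and w = Suc(3) and ps = Suc(4) and bd = Suc(5)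
  have n: "0 < n" using f by (simp add: periodic_def)
  have f0: "f 0 \<in> S" using periodic_in[OF f] .
  have fs: "periodic n (f \<circ> Suc)" by (rule periodic_shift[OF f])
  obtain ss where ss: "f 0 \<notin> set ss" "remaining n f D = (if f 0 \<in> D then ss else f 0 # ss)"
    "remaining n (f \<circ> Suc) D = (if f 0 \<in> D then ss else ss @ [f 0])"
    "remaining n (f \<circ> Suc) (insert (f 0) D) = ss"
    using remaining_step[OF f] by metis
  have cw: "cword ss" using remaining_cword[OF fs, of "insert (f 0) D"] ss(4) by simp
  then have cw0: "cword (f 0 # ss)" using ss(1) f0 by (simp add: cword_Cons)
  show ?case
  proof (cases "sroot (f 0) \<in> N w")
    case True
    obtain qs where qs: "ps = 0 # map Suc qs" "lex_first (f \<circ> Suc) (f 0 \<otimes> w) qs"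
      using lex_first_desc[OF f w True ps] by blast
    have z: "0 \<in> set ps" using qs by simp
    show ?thesis
    proof (cases "f 0 \<in> D")
      case in_D: True
      \<comment> \<open>A letter dropped earlier is now a descent: position 0 violates the condition
        on \<open>D\<close>, and the support of sortable elements rules out the other side.\<close>
      have "\<not> sortable ss w"
      proof
        assume "sortable ss w"
        then have "supp ss (sroot (f 0))" using N_sortable_supp[OF cw] True by blast
        then show False using ss(1) by (auto simp: supp_def sroot_def)
      qed
      then show ?thesis using in_D z ss(2) by auto
    next
      case nD: False
      have bq: "\<forall>p\<in>set qs. p < M" using bd qs(1) by auto
      have sw: "f 0 \<otimes> w \<in> carrier G" using f0 w by simp
      have "(\<forall>i. i + n \<in> set ps \<longrightarrow> i \<in> set ps) \<longleftrightarrow> (\<forall>i. i + n \<in> set qs \<longrightarrow> i \<in> set qs)"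
      proof -
        have m: "Suc i \<in> set ps \<longleftrightarrow> i \<in> set qs" for i using qs(1) by auto
        have "(\<forall>i. i + n \<in> set ps \<longrightarrow> i \<in> set ps) \<longleftrightarrow> (\<forall>i. Suc i + n \<in> set ps \<longrightarrow> Suc i \<in> set ps)"
          using z by (metis not0_implies_Suc)
        then show ?thesis using m by simp
      qed
      moreover have "(\<forall>p\<in>set ps. f p \<notin> D) \<longleftrightarrow> (\<forall>p\<in>set qs. (f \<circ> Suc) p \<notin> D)"
        using qs(1) nD by auto
      moreover note IH[OF fs sw qs(2) bq, of D]
      moreover have "sortable (remaining n f D) w \<longleftrightarrow> sortable (remaining n (f \<circ> Suc) D) (f 0 \<otimes> w)"
        using sortable_desc[OF f0 cw0 w True] ss(2,3) nD by simp
      ultimately show ?thesis by blast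
    qed
  next
    case False
    obtain qs where qs: "ps = map Suc qs" "lex_first (f \<circ> Suc) w qs"
      using lex_first_skip[OF f w False ps] by blast
    have bq: "\<forall>p\<in>set qs. p < M" using bd qs(1) by auto
    have m: "Suc i \<in> set ps \<longleftrightarrow> i \<in> set qs" "0 \<notin> set ps" for i using qs(1) by auto
    have "sortable (remaining n f D) w \<longleftrightarrow> sortable (remaining n (f \<circ> Suc) (insert (f 0) D)) w"
      using sortable_skip[OF f0 w False] ss(2,4) by simp
    moreover note IH[OF fs w qs(2) bq, of "insert (f 0) D"]
    moreover have "(\<forall>i. i + n \<in> set ps \<longrightarrow> i \<in> set ps) \<and> (\<forall>p\<in>set ps. f p \<notin> D) \<longleftrightarrow>
      (\<forall>i. i + n \<in> set qs \<longrightarrow> i \<in> set qs) \<and> (\<forall>p\<in>set qs. (f \<circ> Suc) p \<notin> insert (f 0) D)"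
    proof (intro iffI conjI)
      assume l: "(\<forall>i. i + n \<in> set ps \<longrightarrow> i \<in> set ps) \<and> (\<forall>p\<in>set ps. f p \<notin> D)"
      show "\<forall>i. i + n \<in> set qs \<longrightarrow> i \<in> set qs" using l m(1) by (metis add_Suc)
      show "\<forall>p\<in>set qs. (f \<circ> Suc) p \<notin> insert (f 0) D"
      proof
        fix p assume p: "p \<in> set qs"
        \<comment> \<open>A recurrence of the skipped letter would sit at a multiple of
          \<open>n\<close>, and going back by periods from there would reach position 0.\<close>
        have "f (Suc p) \<noteq> f 0"
        proof
          assume "f (Suc p) = f 0"
          then have "Suc p mod n = 0" using periodic_eq[OF f, of "Suc p" 0] by simp
          then obtain k where k: "Suc p = k * n" by (metis mod_0_imp_dvd dvd_def mult.commute)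
          have "k * n \<in> set ps \<Longrightarrow> 0 \<in> set ps" for k
            using l by (induction k) (auto simp: add.commute)
          then show False using k m p by metis
        qed
        then show "(f \<circ> Suc) p \<notin> insert (f 0) D" using l m(1) p by auto
      qed
    next
      assume l: "(\<forall>i. i + n \<in> set qs \<longrightarrow> i \<in> set qs) \<and> (\<forall>p\<in>set qs. (f \<circ> Suc) p \<notin> insert (f 0) D)"
      show "\<forall>p\<in>set ps. f p \<notin> D" using l qs(1) by auto
      show "\<forall>i. i + n \<in> set ps \<longrightarrow> i \<in> set ps"
      proof (intro allI impI)
        fix i assume i: "i + n \<in> set ps"
        show "i \<in> set ps"
        proof (cases i)
          \<comment> \<open>Position \<open>n\<close> carries the letter just skipped at position 0,
            which the enlarged set \<open>D\<close> forbids.\<close>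
          case 0
          then obtain p where "p \<in> set qs" "n = Suc p" using i qs(1) by auto
          then have "f n \<noteq> f 0" using l by auto
          then show ?thesis using periodic_eq[OF f, of n 0] by simp
        next
          case (Suc j)
          then show ?thesis using i l m(1) by simp
        qed
      qed
    qed
    ultimately show ?thesis by blast
  qed
qed

section \<open>Blocks of the sorting word\<close>

lemma periodic_letter_periodic:
  assumes "distinct ss" "set ss = S" "ss \<noteq> []"
  shows "periodic (length ss) (periodic_letter ss)"
proof -
  have "periodic_letter ss i = ss ! i" if "i < length ss" for i using that by (simp add: periodic_letter_def)
  then have "inj_on (periodic_letter ss) {..<length ss}" "periodic_letter ss ` {..<length ss} = S"
    using assms by (auto simp: inj_on_def nth_eq_iff_index_eq set_conv_nth image_def)
  then show ?thesis using assms(3) by (simp add: periodic_def periodic_letter_def)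
qed

text \<open>Letters within a period are distinct, so a letter and the number of its copy determine
  the position. Nested blocks thus mean that the set of positions is closed under going back by one
  period.\<close>

lemma block_iff:
  assumes "distinct ss" "set ss = S" "ss \<noteq> []"
  shows "(\<forall>k. block ss ps (Suc k) \<subseteq> block ss ps k) \<longleftrightarrow>
    (\<forall>i. i + length ss \<in> set ps \<longrightarrow> i \<in> set ps)"
proof -
  define n where "n = length ss"
  define f where "f = periodic_letter ss"
  have f: "periodic n f" unfolding n_def f_def by (rule periodic_letter_periodic[OF assms])
  then have n: "0 < n" by (simp add: periodic_def)
  have b: "x \<in> block ss ps k \<longleftrightarrow> (\<exists>i\<in>set ps. i div n = k \<and> x = f i)" for x k
    unfolding block_def n_def f_def by blast
  have "(\<forall>k. block ss ps (Suc k) \<subseteq> block ss ps k) \<longleftrightarrow> (\<forall>i. i + n \<in> set ps \<longrightarrow> i \<in> set ps)"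
  proof (intro iffI allI impI)
    fix i assume l: "\<forall>k. block ss ps (Suc k) \<subseteq> block ss ps k" and i: "i + n \<in> set ps"
    have "f (i + n) \<in> block ss ps (Suc (i div n))" unfolding b using i n by (intro bexI[of _ "i + n"]) auto
    then have "f (i + n) \<in> block ss ps (i div n)" using l by blast
    then obtain j where j: "j \<in> set ps" "j div n = i div n" "f (i + n) = f j" unfolding b by blast
    then have "j mod n = i mod n" using periodic_eq[OF f, of "i + n" j] by simp
    then have "j = i" using j(2) by (metis div_mult_mod_eq)
    then show "i \<in> set ps" using j by simp
  next
    fix k assume l: "\<forall>i. i + n \<in> set ps \<longrightarrow> i \<in> set ps"
    show "block ss ps (Suc k) \<subseteq> block ss ps k"
    proof
      fix x assume "x \<in> block ss ps (Suc k)"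
      then obtain i where i: "i \<in> set ps" "i div n = Suc k" "x = f i" unfolding b by blast
      then have "n \<le> i" by (metis div_less not_less Zero_not_Suc)
      then obtain j where j: "i = j + n" by (metis add.commute le_Suc_ex)
      then have "j div n = k" "f i = f j" using i(2) n f by (auto simp: periodic_def)
      moreover have "j \<in> set ps" using l i(1) j by blast
      ultimately show "x \<in> block ss ps k" unfolding b using i(3) by blast
    qed
  qed
  then show ?thesis by (simp add: n_def)
qed

lemma sorting_positions_lex_first:
  "sorting_positions G S ss w ps \<longleftrightarrow> lex_first (periodic_letter ss) w ps"
  by (simp add: sorting_positions_def lex_first_def subword_for_def subword_pos_def)

lemma sorting_sortable:
  assumes ss: "distinct ss" "set ss = S" and w: "w \<in> carrier G"
  shows "(\<exists>ps. sorting_positions G S ss w ps \<and> (\<forall>k. block ss ps (Suc k) \<subseteq> block ss ps k)) \<longleftrightarrow> sortable ss w"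
proof (cases "ss = []")
  case True
  \<comment> \<open>The empty word has no positive period and is treated apart; the group is then
    trivial.\<close>
  then have S: "S = {}" using ss by simp
  have w1: "w = \<one>" using word_exists[OF w] S by auto
  have "sorting_positions G S ss w []"
    unfolding sorting_positions_def subword_for_def reduced_word_def using S w1 len_one by auto
  moreover have "block ss [] k = {}" for k by (simp add: block_def)
  ultimately show ?thesis using True w1 by (auto simp: sortable_def)
next
  case False
  define n where "n = length ss"
  define f where "f = periodic_letter ss"
  have f: "periodic n f" unfolding n_def f_def by (rule periodic_letter_periodic[OF ss False])
  have r: "remaining n f {} = ss"
    unfolding remaining_def n_def f_def by (rule nth_equalityI) (auto simp: periodic_letter_def)
  have key: "(\<forall>k. block ss ps (Suc k) \<subseteq> block ss ps k) \<longleftrightarrow> sortable ss w"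
    if "sorting_positions G S ss w ps" for ps
  proof -
    have lf: "lex_first f w ps" using that unfolding sorting_positions_lex_first f_def .
    have "\<forall>p\<in>set ps. p < Suc (Max (set ps))" by (simp add: le_imp_less_Suc)
    from lex_first_sortable[OF f w lf this, of "{}"] show ?thesis
      using block_iff[OF ss False, of ps] r by (simp add: n_def)
  qed
  have "\<exists>ps. sorting_positions G S ss w ps"
    using lex_first_exists[OF f w] unfolding sorting_positions_lex_first f_def .
  then show ?thesis using key by blast
qed

lemma c_sortable_iff:
  assumes "coxeter_word G S ss c" "w \<in> carrier G"
  shows "c_sortable G S c w \<longleftrightarrow> sortable ss w"
proof -
  have ss: "distinct ss" "set ss = S" "wp ss = c" using assms(1) by (auto simp: coxeter_word_def)
  have "sortable ts w \<longleftrightarrow> sortable ss w" if "coxeter_word G S ts c" for ts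
  proof -
    have ts: "distinct ts" "set ts = S" "wp ts = c" using that by (auto simp: coxeter_word_def)
    have "comm_eq ts ss" using coxeter_words_comm_eq[of ts ss] ss ts by (simp add: cword_def)
    then show ?thesis using comm_eq_sortable[of ts ss w] ts assms(2) by (simp add: cword_def)
  qed
  then show ?thesis
    using sorting_sortable[OF _ _ assms(2)] assms(1) unfolding c_sortable_def coxeter_word_def by metis
qed

end

theorem theorem7p1:
  fixes G :: "('a, 'b) monoid_scheme" and S :: "'a set" and c :: 'a and A :: "'a set"
  assumes "coxeter_system G S"
    and "finite S"
    and "coxeter_element G S c"
    and "A \<subseteq> carrier G"
    and "\<forall>w\<in>A. c_sortable G S c w"
  shows "(A \<noteq> {} \<longrightarrow> c_sortable G S c (\<Sqinter>\<^bsub>right_weak_order G S\<^esub> A)) \<and>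
         (Upper (right_weak_order G S) A \<noteq> {} \<longrightarrow>
            c_sortable G S c (\<Squnion>\<^bsub>right_weak_order G S\<^esub> A))"
proof -
  interpret cs: coxeter_system G S by fact
  obtain m where m: "coxeter_matrix S m"
    "\<forall>us\<in>lists S. \<forall>vs\<in>lists S. word_prod G us = word_prod G vs \<longleftrightarrow> coxeter_cong S m us vs"
    using cs.presentation by blast
  interpret coxeter_geom G S m
  proof
    show "S \<subseteq> carrier G" "generate G S = carrier G"
      by (rule cs.generators_closed, rule cs.generates)
  qed (use m assms(2) in auto)
  obtain ss where ss: "coxeter_word G S ss c" using assms(3) unfolding coxeter_element_def by blast
  have cw: "cword ss" using ss by (simp add: cword_def coxeter_word_def)
  have sA: "\<forall>a\<in>A. sortable ss a" using assms(4,5) c_sortable_iff[OF ss] by blast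
  show ?thesis
  proof (intro conjI impI)
    assume ne: "A \<noteq> {}"
    note u = weak_meet[OF assms(4) ne]
    have "sortable ss (\<Sqinter>\<^bsub>right_weak_order G S\<^esub> A)" by (rule sortable_meet[OF cw u(1) ne sA u(2,3)])
    then show "c_sortable G S c (\<Sqinter>\<^bsub>right_weak_order G S\<^esub> A)" using c_sortable_iff[OF ss u(1)] by simp
  next
    assume ne: "Upper (right_weak_order G S) A \<noteq> {}"
    note u = weak_join[OF assms(4) ne]
    have "sortable ss (\<Squnion>\<^bsub>right_weak_order G S\<^esub> A)" by (rule sortable_join[OF cw u(1) sA u(2,3)])
    then show "c_sortable G S c (\<Squnion>\<^bsub>right_weak_order G S\<^esub> A)" using c_sortable_iff[OF ss u(1)] by simp
  qed
qed

end
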